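(* Let $(H,\mu_H,\Delta_H,\alpha_H,\sigma)$ be a coquasitriangular Hom-bialgebra with $\alpha_H$ bijective and $\sigma=\sigma\circ(\alpha_H\otimes\alpha_H)$. Denote by ${}^H\mathcal M$ the category whose objects are left $H$-comodules $(M,\alpha_M)$ with $\alpha_M$ bijective and whose morphisms are morphisms of left $H$-comodules. Then ${}^H\mathcal M$ is a quasi-braided pre-tensor subcategory of ${}_H^H\mathcal{YD}$ (the latter with the structure $\tilde\otimes$, $\mathfrak a$, $c$ recalled in the context), with tensor product $(M\otimes N,\alpha_M\otimes\alpha_N)$ with coaction $m\otimes n\mapsto m_{(-1)}n_{(-1)}\otimes(m_{(0)}\otimes n_{(0)})$, associativity constraints $\mathfrak a_{M,N,P}((m\otimes n)\otimes p)=\alpha_M(m)\otimes(n\otimes\alpha_P^{-1}(p))$ for $M,N,P\in{}^H\mathcal M$, and quasi-braiding $c_{M,N}:M\otimes N\to N\otimes M$, $c_{M,N}(m\otimes n)=\sigma(n_{(-1)}\otimes m_{(-1)})\,\alpha_N^{-1}(n_{(0)})\otimes\alpha_M^{-1}(m_{(0)})$ for all $M,N\in{}^H\mathcal M$. Here a left $H$-comodule $(M,\alpha_M)$ is regarded as an object of ${}_H^H\mathcal{YD}$ via the action $H\otimes M\to M$, $h\cdot m=\sigma(m_{(-1)}\otimes\alpha_H(h))m_{(0)}$.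
   Context: Everything is over a field $k$, $\otimes=\otimes_k$; (co)algebras are not assumed (co)unital. Sweedler notation: $\Delta(h)=h_1\otimes h_2$; multiplications are written by juxtaposition. A Hom-bialgebra is $(H,\mu,\Delta,\alpha)$ with $\mu:H\otimes H\to H$, $\Delta:H\to H\otimes H$, $\alpha:H\to H$ linear such that for all $h,h',h''$: $\alpha(hh')=\alpha(h)\alpha(h')$; $\alpha(h)(h'h'')=(hh')\alpha(h'')$; $\Delta(h_1)\otimes\alpha(h_2)=\alpha(h_1)\otimes\Delta(h_2)$; $\Delta(hh')=h_1h'_1\otimes h_2h'_2$; $\Delta(\alpha(h))=\alpha(h_1)\otimes\alpha(h_2)$. It is coquasitriangular, with a linear map $\sigma:H\otimes H\to k$, if for all $x,y,z\in H$: $\sigma(xy\otimes\alpha(z))=\sigma(\alpha(x)\otimes z_1)\sigma(\alpha(y)\otimes z_2)$; $\sigma(\alpha(x)\otimes yz)=\sigma(x_1\otimes\alpha(z))\sigma(x_2\otimes\alpha(y))$; $y_1x_1\sigma(x_2\otimes y_2)=\sigma(x_1\otimes y_1)x_2y_2$. Let $(H,\mu_H,\Delta_H,\alpha_H)$ be a Hom-bialgebra, $M$ a linear space, $\alpha_M:M\to M$ linear. $(M,\alpha_M)$ is a left $H$-module if there is a linear map $H\otimes M\to M$, $h\otimes m\mapsto h\cdot m$, with $\alpha_M(h\cdot m)=\alpha_H(h)\cdot\alpha_M(m)$ and $\alpha_H(h)\cdot(h'\cdot m)=(hh')\cdot\alpha_M(m)$. It is a left $H$-comodule if there is a linear map $\lambda_M:M\to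 H\otimes M$, $\lambda_M(m)=m_{(-1)}\otimes m_{(0)}$, with $(\alpha_H\otimes\alpha_M)\circ\lambda_M=\lambda_M\circ\alpha_M$ and $(\Delta_H\otimes\alpha_M)\circ\lambda_M=(\alpha_H\otimes\lambda_M)\circ\lambda_M$. A morphism $f:M\to N$ of left $H$-modules is a linear map with $\alpha_N\circ f=f\circ\alpha_M$ and $f(h\cdot m)=h\cdot f(m)$; a morphism of left $H$-comodules is a linear map with $\alpha_N\circ f=f\circ\alpha_M$ and $(id_H\otimes f)\circ\lambda_M=\lambda_N\circ f$. $(M,\alpha_M)$ is a (left-left) Yetter-Drinfeld module over $H$ if it is both a left $H$-module and a left $H$-comodule and, for all $h\in H$, $m\in M$, $$(h_1\cdot m)_{(-1)}\alpha_H^2(h_2)\otimes(h_1\cdot m)_{(0)}=\alpha_H^2(h_1)\alpha_H(m_{(-1)})\otimes\alpha_H(h_2)\cdot m_{(0)}.$$ For $\alpha_H$ bijective, ${}_H^H\mathcal{YD}$ is the category whose objects are Yetter-Drinfeld modules $(M,\alpha_M)$ over $H$ with $\alpha_M$ bijective, and whose morphisms are the maps that are morphisms of both left $H$-modules and left $H$-comodules. A pre-tensor category $(\mathcal C,\otimes,a)$ satisfies all the axioms of a tensor (monoidal) category except that no unit object or unit constraints are required: $\otimes$ is a bifunctor and $a_{U,V,W}:(U\otimes V)\otimes W\to U\otimes(V\otimes W)$ is a natural isomorphism satisfying the pentagon axiom. A quasi-braiding is a family of natural morphisms $c_{V,W}:V\otimes W\to W\otimes V$ (not required to be isomorphisms)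 satisfying the two hexagon axioms $a_{V,W,U}\circ c_{U,V\otimes W}\circ a_{U,V,W}=(id_V\otimes c_{U,W})\circ a_{V,U,W}\circ(c_{U,V}\otimes id_W)$ and $a_{W,U,V}^{-1}\circ c_{U\otimes V,W}\circ a_{U,V,W}^{-1}=(c_{U,W}\otimes id_V)\circ a_{U,W,V}^{-1}\circ(id_U\otimes c_{V,W})$. Then $(\mathcal C,\otimes,a,c)$ is a quasi-braided pre-tensor category. A quasi-braided pre-tensor subcategory is a subcategory which is itself a quasi-braided pre-tensor category with tensor product, associativity constraints and quasi-braiding being those of the ambient category. The quasi-braided pre-tensor structure on ${}_H^H\mathcal{YD}$ used here: $M\tilde\otimes N=(M\otimes N,\alpha_M\otimes\alpha_N)$ with action $h\cdot(m\otimes n)=\alpha_H^{-2}(h_1)\cdot m\otimes\alpha_H^{-2}(h_2)\cdot n$ and coaction $m\otimes n\mapsto m_{(-1)}n_{(-1)}\otimes(m_{(0)}\otimes n_{(0)})$; $\mathfrak a_{M,N,P}((m\otimes n)\otimes p)=\alpha_M(m)\otimes(n\otimes\alpha_P^{-1}(p))$; $c_{M,N}(m\otimes n)=\alpha_N^{-1}(\alpha_H^{-1}(m_{(-1)})\cdot n)\otimes\alpha_M^{-1}(m_{(0)})$. *)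

theory Defs
  imports "HOL-Algebra.Module"
begin

section \<open>Linear spaces and tensor products in a universe\<close>

text \<open>
  The objects of the categories below are linear spaces whose carriers are arbitrary subsets of
  one fixed type, the universe. To be closed under tensor products this type has to contain
  (representatives of) formal sums of pairs of its own elements. The type \<open>'a univ\<close> is
  the free such type over a type of atoms; as \<open>'a\<close> is an arbitrary type parameter, the
  linear spaces in the universe are not bounded in size.
\<close>

datatype 'a univ = Atom 'a | Tens "('a univ \<times> 'a univ) list"

primrec summands :: "'a univ \<Rightarrow> ('a univ \<times> 'a univ) list" where
  "summands (Atom a) = []"
| "summands (Tens xs) = xs"

text \<open>
  A list of pairs \<open>(m, n)\<close> stands for the formal sum of the symbols \<open>m \<otimes> n\<close>. The relation
  below is the congruence generated by commutativity of formal sums, biadditivity and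
  \<open>K\<close>-balancedness, so that the formal sums modulo it are the tensor product over \<open>K\<close>.
\<close>

inductive tensor_eq ::
  "('k, 'r) ring_scheme \<Rightarrow> ('k, 'b) module \<Rightarrow> ('k, 'c) module \<Rightarrow>
   ('b \<times> 'c) list \<Rightarrow> ('b \<times> 'c) list \<Rightarrow> bool"
  for K M N where
  refl: "set xs \<subseteq> carrier M \<times> carrier N \<Longrightarrow> tensor_eq K M N xs xs"
| sym: "tensor_eq K M N xs ys \<Longrightarrow> tensor_eq K M N ys xs"
| trans: "tensor_eq K M N xs ys \<Longrightarrow> tensor_eq K M N ys zs \<Longrightarrow> tensor_eq K M N xs zs"
| append: "tensor_eq K M N xs xs' \<Longrightarrow> tensor_eq K M N ys ys' \<Longrightarrow>
    tensor_eq K M N (xs @ ys) (xs' @ ys')"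
| commute: "set xs \<subseteq> carrier M \<times> carrier N \<Longrightarrow> set ys \<subseteq> carrier M \<times> carrier N \<Longrightarrow>
    tensor_eq K M N (xs @ ys) (ys @ xs)"
| zero: "n \<in> carrier N \<Longrightarrow> tensor_eq K M N [(\<zero>\<^bsub>M\<^esub>, n)] []"
| add_left: "m \<in> carrier M \<Longrightarrow> m' \<in> carrier M \<Longrightarrow> n \<in> carrier N \<Longrightarrow>
    tensor_eq K M N [(m \<oplus>\<^bsub>M\<^esub> m', n)] [(m, n), (m', n)]"
| add_right: "m \<in> carrier M \<Longrightarrow> n \<in> carrier N \<Longrightarrow> n' \<in> carrier N \<Longrightarrow>
    tensor_eq K M N [(m, n \<oplus>\<^bsub>N\<^esub> n')] [(m, n), (m, n')]"
| balanced: "a \<in> carrier K \<Longrightarrow> m \<in> carrier M \<Longrightarrow> n \<in> carrier N \<Longrightarrow>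
    tensor_eq K M N [(a \<odot>\<^bsub>M\<^esub> m, n)] [(m, a \<odot>\<^bsub>N\<^esub> n)]"

text \<open>An equivalence class is represented in the universe by one chosen element of it.\<close>

definition tensor_class ::
  "('k, 'r) ring_scheme \<Rightarrow> ('k, 'a univ) module \<Rightarrow> ('k, 'a univ) module \<Rightarrow>
   ('a univ \<times> 'a univ) list \<Rightarrow> 'a univ" where
  "tensor_class K M N xs = Tens (SOME ys. tensor_eq K M N xs ys)"

text \<open>
  The record type of modules extends that of rings, and its fields \<^const>\<open>mult\<close> and
  \<^const>\<open>one\<close> play no role for modules. The otherwise unused field \<^const>\<open>mult\<close> of the
  tensor product stores the canonical bilinear map, so that \<open>m \<otimes>\<^bsub>M \<boxtimes>\<^bsub>K\<^esub> N\<^esub> n\<close> denotes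
  the pure tensor of \<open>m\<close> and \<open>n\<close>.
\<close>

definition tensor_prod ::
  "('k, 'a univ) module \<Rightarrow> ('k, 'r) ring_scheme \<Rightarrow> ('k, 'a univ) module \<Rightarrow> ('k, 'a univ) module"
  ("(_ \<boxtimes>\<^bsub>_\<^esub> _)" [71, 0, 70] 70) where
  "M \<boxtimes>\<^bsub>K\<^esub> N =
    \<lparr>carrier = tensor_class K M N ` {xs. set xs \<subseteq> carrier M \<times> carrier N},
     monoid.mult = (\<lambda>m n. tensor_class K M N [(m, n)]),
     one = undefined,
     zero = tensor_class K M N [],
     add = (\<lambda>s t. tensor_class K M N (summands s @ summands t)),
     smult = (\<lambda>a t. tensor_class K M N (map (\<lambda>(m, n). (a \<odot>\<^bsub>M\<^esub> m, n)) (summands t)))\<rparr>"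

text \<open>
  Sweedler notation: if \<open>t = t\<^sub>1 \<otimes> t\<^sub>2\<close> (summation understood), then \<open>sweedler P t f\<close> is
  the element \<open>f t\<^sub>1 t\<^sub>2\<close> of \<open>P\<close> (summation understood). It is only used for \<open>f\<close> that are
  bilinear on the two factors in question; by \<open>sweedler_tensor_class\<close> below, the value then
  does not depend on the way \<open>t\<close> is written as a sum.
\<close>

definition sweedler ::
  "('p, 'r) ring_scheme \<Rightarrow> 'a univ \<Rightarrow> ('a univ \<Rightarrow> 'a univ \<Rightarrow> 'p) \<Rightarrow> 'p" where
  "sweedler P t f = foldr (\<lambda>(m, n) s. f m n \<oplus>\<^bsub>P\<^esub> s) (summands t) \<zero>\<^bsub>P\<^esub>"

lemma sweedler_tensor_class:
  assumes "abelian_group P" "Module.module K M" "Module.module K N"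
    and closed: "\<And>m n. m \<in> carrier M \<Longrightarrow> n \<in> carrier N \<Longrightarrow> f m n \<in> carrier P"
    and addl: "\<And>m m' n. m \<in> carrier M \<Longrightarrow> m' \<in> carrier M \<Longrightarrow> n \<in> carrier N \<Longrightarrow>
      f (m \<oplus>\<^bsub>M\<^esub> m') n = f m n \<oplus>\<^bsub>P\<^esub> f m' n"
    and addr: "\<And>m n n'. m \<in> carrier M \<Longrightarrow> n \<in> carrier N \<Longrightarrow> n' \<in> carrier N \<Longrightarrow>
      f m (n \<oplus>\<^bsub>N\<^esub> n') = f m n \<oplus>\<^bsub>P\<^esub> f m n'"
    and bal: "\<And>a m n. a \<in> carrier K \<Longrightarrow> m \<in> carrier M \<Longrightarrow> n \<in> carrier N \<Longrightarrow>
      f (a \<odot>\<^bsub>M\<^esub> m) n = f m (a \<odot>\<^bsub>N\<^esub> n)"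
    and xs: "set xs \<subseteq> carrier M \<times> carrier N"
  shows "sweedler P (tensor_class K M N xs) f =
    foldr (\<lambda>(m, n) s. f m n \<oplus>\<^bsub>P\<^esub> s) xs \<zero>\<^bsub>P\<^esub>"
proof -
  interpret P: abelian_group P by fact
  interpret M: Module.module K M by fact
  interpret N: Module.module K N by fact
  define S where "S = (\<lambda>xs. foldr (\<lambda>(m, n) s. f m n \<oplus>\<^bsub>P\<^esub> s) xs \<zero>\<^bsub>P\<^esub>)"
  have Sc: "S xs \<in> carrier P" if "set xs \<subseteq> carrier M \<times> carrier N" for xs
    using that by (induction xs) (auto simp: S_def closed)
  have Sa: "S (xs @ ys) = S xs \<oplus>\<^bsub>P\<^esub> S ys"
    if "set xs \<subseteq> carrier M \<times> carrier N" "set ys \<subseteq> carrier M \<times> carrier N" for xs ys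
    using that
  proof (induction xs)
    case Nil
    then show ?case using Sc[of ys] by (simp add: S_def)
  next
    case (Cons p xs)
    obtain m n where p: "p = (m, n)" by force
    have mn: "m \<in> carrier M" "n \<in> carrier N" "set xs \<subseteq> carrier M \<times> carrier N"
      using Cons.prems p by auto
    have "S (p # xs @ ys) = f m n \<oplus>\<^bsub>P\<^esub> S (xs @ ys)" by (simp add: S_def p)
    also have "\<dots> = f m n \<oplus>\<^bsub>P\<^esub> (S xs \<oplus>\<^bsub>P\<^esub> S ys)" using Cons mn by simp
    also have "\<dots> = (f m n \<oplus>\<^bsub>P\<^esub> S xs) \<oplus>\<^bsub>P\<^esub> S ys"
      using P.a_assoc closed mn Sc Cons.prems(2) by simp
    finally show ?case by (simp add: S_def p)
  qed
  have z: "f \<zero>\<^bsub>M\<^esub> n = \<zero>\<^bsub>P\<^esub>" if n: "n \<in> carrier N" for n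
  proof -
    have "f \<zero>\<^bsub>M\<^esub> n = f \<zero>\<^bsub>M\<^esub> n \<oplus>\<^bsub>P\<^esub> f \<zero>\<^bsub>M\<^esub> n"
      using addl[of "\<zero>\<^bsub>M\<^esub>" "\<zero>\<^bsub>M\<^esub>" n] n by simp
    then show ?thesis using closed[of "\<zero>\<^bsub>M\<^esub>" n] n by (simp add: P.add.l_cancel_one')
  qed
  have inv: "set xs \<subseteq> carrier M \<times> carrier N \<and> set ys \<subseteq> carrier M \<times> carrier N \<and> S xs = S ys"
    if "tensor_eq K M N xs ys" for xs ys
    using that
  proof (induction rule: tensor_eq.induct)
    case (append xs xs' ys ys')
    then show ?case by (auto simp: Sa)
  next
    case (commute xs ys)
    then show ?case by (simp add: Sa Sc P.a_comm)
  qed (auto simp: S_def z addl addr bal closed)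
  have "tensor_eq K M N xs (SOME ys. tensor_eq K M N xs ys)"
    by (rule someI) (rule tensor_eq.refl[OF xs])
  from inv[OF this] show ?thesis
    by (simp add: sweedler_def tensor_class_def S_def)
qed

lemma module_tensor_prod:
  fixes M N :: "('k, 'a univ) module"
  assumes "Module.module K M" "Module.module K N"
  shows "Module.module K (M \<boxtimes>\<^bsub>K\<^esub> N)"
proof -
  interpret M: Module.module K M by fact
  interpret N: Module.module K N by fact
  let ?L = "{xs. set xs \<subseteq> carrier M \<times> carrier N}"
  note [intro] = tensor_eq.refl tensor_eq.append tensor_eq.zero tensor_eq.add_left tensor_eq.add_right
    tensor_eq.balanced
  have eqL: "xs \<in> ?L \<and> ys \<in> ?L" if "tensor_eq K M N xs ys" for xs ys
    using that by (induction) auto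
  have cls: "tensor_class K M N xs = tensor_class K M N ys" if "tensor_eq K M N xs ys" for xs ys
  proof -
    have "tensor_eq K M N xs = tensor_eq K M N ys"
      using that by (intro ext) (meson tensor_eq.sym tensor_eq.trans)
    then show ?thesis by (simp add: tensor_class_def)
  qed
  have rep: "tensor_eq K M N xs (summands (tensor_class K M N xs))" if "xs \<in> ?L" for xs
    unfolding tensor_class_def summands.simps by (rule someI) (use that in auto)
  define A where "A = (\<lambda>a. map (\<lambda>(m, n::'a univ). (a \<odot>\<^bsub>M\<^esub> m, n)))"
  have AL: "A a xs \<in> ?L" if "xs \<in> ?L" "a \<in> carrier K" for a xs
    using that unfolding A_def by auto
  have Aeq: "tensor_eq K M N (A a xs) (A a ys)" if "tensor_eq K M N xs ys" "a \<in> carrier K" for a xs ys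
    using that
  proof (induction)
    case (refl xs) then show ?case using AL[of xs a] by auto
  next
    case (sym xs ys) then show ?case by (blast intro: tensor_eq.sym)
  next
    case (trans xs ys zs) then show ?case by (blast intro: tensor_eq.trans)
  next
    case (append xs xs' ys ys') then show ?case by (auto simp: A_def)
  next
    case (commute xs ys) then have "tensor_eq K M N (A a xs @ A a ys) (A a ys @ A a xs)" using AL[of xs a] AL[of ys a] by (intro tensor_eq.commute) auto
    then show ?case by (simp add: A_def)
  next
    case (balanced b m n)
    have "tensor_eq K M N [(b \<odot>\<^bsub>M\<^esub> (a \<odot>\<^bsub>M\<^esub> m), n)] [(a \<odot>\<^bsub>M\<^esub> m, b \<odot>\<^bsub>N\<^esub> n)]"
      using balanced by (intro tensor_eq.balanced) auto
    moreover have "b \<odot>\<^bsub>M\<^esub> (a \<odot>\<^bsub>M\<^esub> m) = a \<odot>\<^bsub>M\<^esub> (b \<odot>\<^bsub>M\<^esub> m)"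
      using balanced by (metis M.smult_assoc1 M.m_comm)
    ultimately show ?case by (simp add: A_def)
  qed (auto simp: A_def M.smult_r_distr M.smult_r_null)
  have add: "tensor_class K M N xs \<oplus>\<^bsub>M \<boxtimes>\<^bsub>K\<^esub> N\<^esub> tensor_class K M N ys = tensor_class K M N (xs @ ys)"
    if "xs \<in> ?L" "ys \<in> ?L" for xs ys
    unfolding tensor_prod_def by simp (metis cls rep that tensor_eq.append tensor_eq.sym)
  have sm: "a \<odot>\<^bsub>M \<boxtimes>\<^bsub>K\<^esub> N\<^esub> tensor_class K M N xs = tensor_class K M N (A a xs)"
    if "xs \<in> ?L" "a \<in> carrier K" for xs a
  proof -
    have "tensor_class K M N (A a (summands (tensor_class K M N xs))) = tensor_class K M N (A a xs)"
      using cls Aeq rep that tensor_eq.sym by metis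
    then show ?thesis by (simp add: tensor_prod_def A_def)
  qed
  have car: "carrier (M \<boxtimes>\<^bsub>K\<^esub> N) = tensor_class K M N ` ?L" by (simp add: tensor_prod_def)
  have ze: "\<zero>\<^bsub>M \<boxtimes>\<^bsub>K\<^esub> N\<^esub> = tensor_class K M N []" by (simp add: tensor_prod_def)
  have neg: "tensor_eq K M N (A a xs @ A b xs) (A (a \<oplus>\<^bsub>K\<^esub> b) xs)" if "xs \<in> ?L" "a \<in> carrier K" "b \<in> carrier K" for a b xs
    using that(1)
  proof (induction xs)
    case Nil then show ?case by (auto simp: A_def)
  next
    case (Cons p xs)
    obtain m n where p: "p = (m, n)" "m \<in> carrier M" "n \<in> carrier N" "xs \<in> ?L" using Cons by auto
    have 1: "tensor_eq K M N (A a xs @ [(b \<odot>\<^bsub>M\<^esub> m, n)]) ([(b \<odot>\<^bsub>M\<^esub> m, n)] @ A a xs)"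
      using p that AL[of xs a] by (intro tensor_eq.commute) auto
    have "tensor_eq K M N ([(a \<odot>\<^bsub>M\<^esub> m, n)] @ (A a xs @ [(b \<odot>\<^bsub>M\<^esub> m, n)]) @ A b xs) ([(a \<odot>\<^bsub>M\<^esub> m, n)] @ ([(b \<odot>\<^bsub>M\<^esub> m, n)] @ A a xs) @ A b xs)"
      using p that AL[of xs b] by (intro tensor_eq.append 1 tensor_eq.refl) auto
    moreover have "tensor_eq K M N (([(a \<odot>\<^bsub>M\<^esub> m, n)] @ [(b \<odot>\<^bsub>M\<^esub> m, n)]) @ (A a xs @ A b xs)) ([((a \<oplus>\<^bsub>K\<^esub> b) \<odot>\<^bsub>M\<^esub> m, n)] @ A (a \<oplus>\<^bsub>K\<^esub> b) xs)"
      using p that Cons.IH by (intro tensor_eq.append) (auto simp: M.smult_l_distr intro!: tensor_eq.sym[OF tensor_eq.add_left])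
    ultimately show ?case
      unfolding p(1) A_def by simp (rule tensor_eq.trans)
  qed
  have A0: "tensor_eq K M N (A \<zero>\<^bsub>K\<^esub> xs) []" if "xs \<in> ?L" for xs
    using that
  proof (induction xs)
    case (Cons p xs)
    then obtain m n where p: "p = (m, n)" "m \<in> carrier M" "n \<in> carrier N" "xs \<in> ?L" by auto
    have "tensor_eq K M N ([(\<zero>\<^bsub>M\<^esub>, n)] @ A \<zero>\<^bsub>K\<^esub> xs) ([] @ [])"
      using p Cons by (intro tensor_eq.append) auto
    then show ?case using p by (simp add: A_def M.smult_l_null)
  qed (auto simp: A_def)
  have A1: "A \<one>\<^bsub>K\<^esub> xs = xs" if "xs \<in> ?L" for xs
    using that by (induction xs) (auto simp: A_def)
  have ag: "abelian_group (M \<boxtimes>\<^bsub>K\<^esub> N)"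
  proof (rule abelian_groupI)
    fix x assume "x \<in> carrier (M \<boxtimes>\<^bsub>K\<^esub> N)"
    then obtain xs where xs: "xs \<in> ?L" "x = tensor_class K M N xs" by (auto simp: car)
    have one: "\<one>\<^bsub>K\<^esub> \<in> carrier K" "\<ominus>\<^bsub>K\<^esub> \<one>\<^bsub>K\<^esub> \<in> carrier K" "\<ominus>\<^bsub>K\<^esub> \<one>\<^bsub>K\<^esub> \<oplus>\<^bsub>K\<^esub> \<one>\<^bsub>K\<^esub> = \<zero>\<^bsub>K\<^esub>"
      by (simp_all add: M.R.l_neg)
    have "tensor_eq K M N (Ng @ xs) []" if "Ng = A (\<ominus>\<^bsub>K\<^esub> \<one>\<^bsub>K\<^esub>) xs" for Ng
      using neg[OF xs(1) one(2,1)] A0[OF xs(1)]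
      unfolding that one(3) A1[OF xs(1)] by (rule tensor_eq.trans)
    then show "\<exists>y\<in>carrier (M \<boxtimes>\<^bsub>K\<^esub> N). y \<oplus>\<^bsub>M \<boxtimes>\<^bsub>K\<^esub> N\<^esub> x = \<zero>\<^bsub>M \<boxtimes>\<^bsub>K\<^esub> N\<^esub>"
      using xs AL[OF xs(1) one(2)] unfolding car ze xs(2)
      by (intro bexI[of _ "tensor_class K M N (A (\<ominus>\<^bsub>K\<^esub> \<one>\<^bsub>K\<^esub>) xs)"]) (simp_all only: add cls, blast)
  next
    fix x y assume "x \<in> carrier (M \<boxtimes>\<^bsub>K\<^esub> N)" "y \<in> carrier (M \<boxtimes>\<^bsub>K\<^esub> N)"
    then obtain xs ys where xs: "xs \<in> ?L" "x = tensor_class K M N xs"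
      and ys: "ys \<in> ?L" "y = tensor_class K M N ys" by (auto simp: car)
    have "xs @ ys \<in> ?L" using xs ys by auto
    then show "x \<oplus>\<^bsub>M \<boxtimes>\<^bsub>K\<^esub> N\<^esub> y \<in> carrier (M \<boxtimes>\<^bsub>K\<^esub> N)"
      unfolding xs(2) ys(2) add[OF xs(1) ys(1)] car by (rule imageI)
    show "x \<oplus>\<^bsub>M \<boxtimes>\<^bsub>K\<^esub> N\<^esub> y = y \<oplus>\<^bsub>M \<boxtimes>\<^bsub>K\<^esub> N\<^esub> x"
      unfolding xs(2) ys(2) add[OF xs(1) ys(1)] add[OF ys(1) xs(1)]
      using xs ys by (intro cls tensor_eq.commute) auto
  next
    fix x y z
    assume "x \<in> carrier (M \<boxtimes>\<^bsub>K\<^esub> N)" "y \<in> carrier (M \<boxtimes>\<^bsub>K\<^esub> N)" "z \<in> carrier (M \<boxtimes>\<^bsub>K\<^esub> N)"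
    then obtain xs ys zs where xs: "xs \<in> ?L" "x = tensor_class K M N xs"
      and ys: "ys \<in> ?L" "y = tensor_class K M N ys"
      and zs: "zs \<in> ?L" "z = tensor_class K M N zs" by (auto simp: car)
    have "xs @ ys \<in> ?L" "ys @ zs \<in> ?L" using xs ys zs by auto
    then show "x \<oplus>\<^bsub>M \<boxtimes>\<^bsub>K\<^esub> N\<^esub> y \<oplus>\<^bsub>M \<boxtimes>\<^bsub>K\<^esub> N\<^esub> z = x \<oplus>\<^bsub>M \<boxtimes>\<^bsub>K\<^esub> N\<^esub> (y \<oplus>\<^bsub>M \<boxtimes>\<^bsub>K\<^esub> N\<^esub> z)"
      using xs ys zs by (simp only: add append_assoc)
  next
    show "\<zero>\<^bsub>M \<boxtimes>\<^bsub>K\<^esub> N\<^esub> \<in> carrier (M \<boxtimes>\<^bsub>K\<^esub> N)" unfolding car ze by (rule imageI) simp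
    fix x assume "x \<in> carrier (M \<boxtimes>\<^bsub>K\<^esub> N)"
    then obtain xs where xs: "xs \<in> ?L" "x = tensor_class K M N xs" by (auto simp: car)
    then show "\<zero>\<^bsub>M \<boxtimes>\<^bsub>K\<^esub> N\<^esub> \<oplus>\<^bsub>M \<boxtimes>\<^bsub>K\<^esub> N\<^esub> x = x"
      using add[of "[]" xs] by (simp add: ze)
  qed
  show ?thesis
  proof (rule moduleI)
    show "cring K" by (rule M.is_cring)
    show "abelian_group (M \<boxtimes>\<^bsub>K\<^esub> N)" by (rule ag)
  next
    fix a x assume a: "a \<in> carrier K" and "x \<in> carrier (M \<boxtimes>\<^bsub>K\<^esub> N)"
    then obtain xs where xs: "xs \<in> ?L" "x = tensor_class K M N xs" by (auto simp: car)
    show "a \<odot>\<^bsub>M \<boxtimes>\<^bsub>K\<^esub> N\<^esub> x \<in> carrier (M \<boxtimes>\<^bsub>K\<^esub> N)"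
      unfolding xs(2) sm[OF xs(1) a] car by (rule imageI) (rule AL[OF xs(1) a])
  next
    fix a b x assume ab: "a \<in> carrier K" "b \<in> carrier K" and "x \<in> carrier (M \<boxtimes>\<^bsub>K\<^esub> N)"
    then obtain xs where xs: "xs \<in> ?L" "x = tensor_class K M N xs" by (auto simp: car)
    have ab': "a \<oplus>\<^bsub>K\<^esub> b \<in> carrier K" "a \<otimes>\<^bsub>K\<^esub> b \<in> carrier K" using ab by simp_all
    note Axs = AL[OF xs(1) ab(1)] AL[OF xs(1) ab(2)]
    show "(a \<oplus>\<^bsub>K\<^esub> b) \<odot>\<^bsub>M \<boxtimes>\<^bsub>K\<^esub> N\<^esub> x = a \<odot>\<^bsub>M \<boxtimes>\<^bsub>K\<^esub> N\<^esub> x \<oplus>\<^bsub>M \<boxtimes>\<^bsub>K\<^esub> N\<^esub> b \<odot>\<^bsub>M \<boxtimes>\<^bsub>K\<^esub> N\<^esub> x"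
      unfolding xs(2) sm[OF xs(1) ab(1)] sm[OF xs(1) ab(2)] sm[OF xs(1) ab'(1)] add[OF Axs]
      by (rule cls[OF neg[OF xs(1) ab], symmetric])
    have "A (a \<otimes>\<^bsub>K\<^esub> b) xs = A a (A b xs)"
      using xs(1) ab by (auto simp: A_def M.smult_assoc1)
    then show "(a \<otimes>\<^bsub>K\<^esub> b) \<odot>\<^bsub>M \<boxtimes>\<^bsub>K\<^esub> N\<^esub> x = a \<odot>\<^bsub>M \<boxtimes>\<^bsub>K\<^esub> N\<^esub> (b \<odot>\<^bsub>M \<boxtimes>\<^bsub>K\<^esub> N\<^esub> x)"
      unfolding xs(2) sm[OF xs(1) ab(2)] sm[OF Axs(2) ab(1)] sm[OF xs(1) ab'(2)] by (rule arg_cong)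
  next
    fix a x y
    assume a: "a \<in> carrier K" and "x \<in> carrier (M \<boxtimes>\<^bsub>K\<^esub> N)" "y \<in> carrier (M \<boxtimes>\<^bsub>K\<^esub> N)"
    then obtain xs ys where xs: "xs \<in> ?L" "x = tensor_class K M N xs"
      and ys: "ys \<in> ?L" "y = tensor_class K M N ys" by (auto simp: car)
    have app: "xs @ ys \<in> ?L" using xs ys by auto
    have "A a (xs @ ys) = A a xs @ A a ys" by (simp add: A_def)
    then show "a \<odot>\<^bsub>M \<boxtimes>\<^bsub>K\<^esub> N\<^esub> (x \<oplus>\<^bsub>M \<boxtimes>\<^bsub>K\<^esub> N\<^esub> y) = a \<odot>\<^bsub>M \<boxtimes>\<^bsub>K\<^esub> N\<^esub> x \<oplus>\<^bsub>M \<boxtimes>\<^bsub>K\<^esub> N\<^esub> a \<odot>\<^bsub>M \<boxtimes>\<^bsub>K\<^esub> N\<^esub> y"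
      unfolding xs(2) ys(2) sm[OF xs(1) a] sm[OF ys(1) a] add[OF xs(1) ys(1)] sm[OF app a]
        add[OF AL[OF xs(1) a] AL[OF ys(1) a]] by (rule arg_cong)
  next
    fix x assume "x \<in> carrier (M \<boxtimes>\<^bsub>K\<^esub> N)"
    then obtain xs where xs: "xs \<in> ?L" "x = tensor_class K M N xs" by (auto simp: car)
    show "\<one>\<^bsub>K\<^esub> \<odot>\<^bsub>M \<boxtimes>\<^bsub>K\<^esub> N\<^esub> x = x"
      unfolding xs(2) sm[OF xs(1) M.R.one_closed] A1[OF xs(1)] by (rule HOL.refl)
  qed
qed

text \<open>
  Linear maps are taken to be extensional (\<^const>\<open>undefined\<close> outside the carrier of the
  domain), so that equality of HOL functions is equality of linear maps.
\<close>

definition linear_maps ::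
  "('k, 'r) ring_scheme \<Rightarrow> ('k, 'b) module \<Rightarrow> ('k, 'c) module \<Rightarrow> ('b \<Rightarrow> 'c) set" where
  "linear_maps K M N =
    {f \<in> carrier M \<rightarrow>\<^sub>E carrier N.
      (\<forall>x\<in>carrier M. \<forall>y\<in>carrier M. f (x \<oplus>\<^bsub>M\<^esub> y) = f x \<oplus>\<^bsub>N\<^esub> f y) \<and>
      (\<forall>a\<in>carrier K. \<forall>x\<in>carrier M. f (a \<odot>\<^bsub>M\<^esub> x) = a \<odot>\<^bsub>N\<^esub> f x)}"

definition self_module :: "('k, 'r) ring_scheme \<Rightarrow> ('k, 'k) module" where
  "self_module K =
    \<lparr>carrier = carrier K, monoid.mult = monoid.mult K, one = one K,
     zero = zero K, add = add K, smult = monoid.mult K\<rparr>"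

definition tensor_map ::
  "('k, 'r) ring_scheme \<Rightarrow> ('k, 'a univ) module \<Rightarrow> ('k, 'a univ) module \<Rightarrow>
   ('k, 'a univ) module \<Rightarrow> ('k, 'a univ) module \<Rightarrow>
   ('a univ \<Rightarrow> 'a univ) \<Rightarrow> ('a univ \<Rightarrow> 'a univ) \<Rightarrow> 'a univ \<Rightarrow> 'a univ" where
  "tensor_map K M N M' N' f g =
    (\<lambda>t\<in>carrier (M \<boxtimes>\<^bsub>K\<^esub> N). sweedler (M' \<boxtimes>\<^bsub>K\<^esub> N') t (\<lambda>m n. f m \<otimes>\<^bsub>M' \<boxtimes>\<^bsub>K\<^esub> N'\<^esub> g n))"


section \<open>Hom-bialgebras\<close>

record ('k, 'a) hom_bialg =
  hsp :: "('k, 'a univ) module"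
  hmu :: "'a univ \<Rightarrow> 'a univ"
  hdelta :: "'a univ \<Rightarrow> 'a univ"
  halpha :: "'a univ \<Rightarrow> 'a univ"

definition hprod ::
  "('k, 'r) ring_scheme \<Rightarrow> ('k, 'a) hom_bialg \<Rightarrow> 'a univ \<Rightarrow> 'a univ \<Rightarrow> 'a univ" where
  "hprod K H x y = hmu H (x \<otimes>\<^bsub>hsp H \<boxtimes>\<^bsub>K\<^esub> hsp H\<^esub> y)"

definition halpha_inv :: "('k, 'a) hom_bialg \<Rightarrow> 'a univ \<Rightarrow> 'a univ" where
  "halpha_inv H = inv_into (carrier (hsp H)) (halpha H)"

text \<open>
  In Hom-coassociativity, both sides are read in \<open>H \<otimes> (H \<otimes> H)\<close>; the element
  \<open>\<Delta>(h\<^sub>1) \<otimes> \<alpha>(h\<^sub>2)\<close> of \<open>(H \<otimes> H) \<otimes> H\<close> is transferred by the canonical identification.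
  The same applies to the comodule axiom further below.
\<close>

definition hom_bialgebra :: "('k, 'r) ring_scheme \<Rightarrow> ('k, 'a) hom_bialg \<Rightarrow> bool" where
  "hom_bialgebra K H \<longleftrightarrow>
    (let V = hsp H; VV = V \<boxtimes>\<^bsub>K\<^esub> V; VVV = V \<boxtimes>\<^bsub>K\<^esub> VV;
         \<mu> = hprod K H; \<Delta> = hdelta H; \<alpha> = halpha H
     in Module.module K V \<and>
        hmu H \<in> linear_maps K VV V \<and>
        \<Delta> \<in> linear_maps K V VV \<and>
        \<alpha> \<in> linear_maps K V V \<and>
        (\<forall>h\<in>carrier V. \<forall>h'\<in>carrier V. \<alpha> (\<mu> h h') = \<mu> (\<alpha> h) (\<alpha> h')) \<and>
        (\<forall>h\<in>carrier V. \<forall>h'\<in>carrier V. \<forall>h''\<in>carrier V.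
          \<mu> (\<alpha> h) (\<mu> h' h'') = \<mu> (\<mu> h h') (\<alpha> h'')) \<and>
        (\<forall>h\<in>carrier V.
          sweedler VVV (\<Delta> h) (\<lambda>h1 h2. sweedler VVV (\<Delta> h1) (\<lambda>h11 h12.
            h11 \<otimes>\<^bsub>VVV\<^esub> (h12 \<otimes>\<^bsub>VV\<^esub> \<alpha> h2))) =
          sweedler VVV (\<Delta> h) (\<lambda>h1 h2. \<alpha> h1 \<otimes>\<^bsub>VVV\<^esub> \<Delta> h2)) \<and>
        (\<forall>h\<in>carrier V. \<forall>h'\<in>carrier V.
          \<Delta> (\<mu> h h') =
          sweedler VV (\<Delta> h) (\<lambda>h1 h2. sweedler VV (\<Delta> h') (\<lambda>h1' h2'.
            \<mu> h1 h1' \<otimes>\<^bsub>VV\<^esub> \<mu> h2 h2'))) \<and>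
        (\<forall>h\<in>carrier V. \<Delta> (\<alpha> h) = sweedler VV (\<Delta> h) (\<lambda>h1 h2. \<alpha> h1 \<otimes>\<^bsub>VV\<^esub> \<alpha> h2)))"

definition coquasitriangular ::
  "('k, 'r) ring_scheme \<Rightarrow> ('k, 'a) hom_bialg \<Rightarrow> ('a univ \<Rightarrow> 'k) \<Rightarrow> bool" where
  "coquasitriangular K H \<sigma> \<longleftrightarrow>
    (let V = hsp H; VV = V \<boxtimes>\<^bsub>K\<^esub> V; \<mu> = hprod K H; \<Delta> = hdelta H; \<alpha> = halpha H
     in \<sigma> \<in> linear_maps K VV (self_module K) \<and>
        (\<forall>x\<in>carrier V. \<forall>y\<in>carrier V. \<forall>z\<in>carrier V.
          \<sigma> (\<mu> x y \<otimes>\<^bsub>VV\<^esub> \<alpha> z) =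
          sweedler K (\<Delta> z) (\<lambda>z1 z2. \<sigma> (\<alpha> x \<otimes>\<^bsub>VV\<^esub> z1) \<otimes>\<^bsub>K\<^esub> \<sigma> (\<alpha> y \<otimes>\<^bsub>VV\<^esub> z2))) \<and>
        (\<forall>x\<in>carrier V. \<forall>y\<in>carrier V. \<forall>z\<in>carrier V.
          \<sigma> (\<alpha> x \<otimes>\<^bsub>VV\<^esub> \<mu> y z) =
          sweedler K (\<Delta> x) (\<lambda>x1 x2. \<sigma> (x1 \<otimes>\<^bsub>VV\<^esub> \<alpha> z) \<otimes>\<^bsub>K\<^esub> \<sigma> (x2 \<otimes>\<^bsub>VV\<^esub> \<alpha> y))) \<and>
        (\<forall>x\<in>carrier V. \<forall>y\<in>carrier V.
          sweedler V (\<Delta> x) (\<lambda>x1 x2. sweedler V (\<Delta> y) (\<lambda>y1 y2.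
            \<sigma> (x2 \<otimes>\<^bsub>VV\<^esub> y2) \<odot>\<^bsub>V\<^esub> \<mu> y1 x1)) =
          sweedler V (\<Delta> x) (\<lambda>x1 x2. sweedler V (\<Delta> y) (\<lambda>y1 y2.
            \<sigma> (x1 \<otimes>\<^bsub>VV\<^esub> y1) \<odot>\<^bsub>V\<^esub> \<mu> x2 y2))))"


section \<open>Comodules and Yetter-Drinfeld modules\<close>

record ('k, 'a) hom_comod =
  msp :: "('k, 'a univ) module"
  malpha :: "'a univ \<Rightarrow> 'a univ"
  mcoact :: "'a univ \<Rightarrow> 'a univ"

record ('k, 'a) hom_yd = "('k, 'a) hom_comod" +
  mact :: "'a univ \<Rightarrow> 'a univ"

definition act ::
  "('k, 'r) ring_scheme \<Rightarrow> ('k, 'a) hom_bialg \<Rightarrow> ('k, 'a) hom_yd \<Rightarrow>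
   'a univ \<Rightarrow> 'a univ \<Rightarrow> 'a univ" where
  "act K H M h m = mact M (h \<otimes>\<^bsub>hsp H \<boxtimes>\<^bsub>K\<^esub> msp M\<^esub> m)"

definition malpha_inv :: "('k, 'a, 'z) hom_comod_scheme \<Rightarrow> 'a univ \<Rightarrow> 'a univ" where
  "malpha_inv M = inv_into (carrier (msp M)) (malpha M)"

definition left_module ::
  "('k, 'r) ring_scheme \<Rightarrow> ('k, 'a) hom_bialg \<Rightarrow> ('k, 'a) hom_yd \<Rightarrow> bool" where
  "left_module K H M \<longleftrightarrow>
    Module.module K (msp M) \<and>
    malpha M \<in> linear_maps K (msp M) (msp M) \<and>
    mact M \<in> linear_maps K (hsp H \<boxtimes>\<^bsub>K\<^esub> msp M) (msp M) \<and>
    (\<forall>h\<in>carrier (hsp H). \<forall>m\<in>carrier (msp M).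
      malpha M (act K H M h m) = act K H M (halpha H h) (malpha M m)) \<and>
    (\<forall>h\<in>carrier (hsp H). \<forall>h'\<in>carrier (hsp H). \<forall>m\<in>carrier (msp M).
      act K H M (halpha H h) (act K H M h' m) = act K H M (hprod K H h h') (malpha M m))"

definition left_comodule ::
  "('k, 'r) ring_scheme \<Rightarrow> ('k, 'a) hom_bialg \<Rightarrow> ('k, 'a, 'z) hom_comod_scheme \<Rightarrow> bool" where
  "left_comodule K H M \<longleftrightarrow>
    (let V = hsp H; VM = V \<boxtimes>\<^bsub>K\<^esub> msp M; VVM = V \<boxtimes>\<^bsub>K\<^esub> VM
     in Module.module K (msp M) \<and>
        malpha M \<in> linear_maps K (msp M) (msp M) \<and>
        mcoact M \<in> linear_maps K (msp M) VM \<and>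
        (\<forall>m\<in>carrier (msp M).
          tensor_map K V (msp M) V (msp M) (halpha H) (malpha M) (mcoact M m) =
          mcoact M (malpha M m)) \<and>
        (\<forall>m\<in>carrier (msp M).
          sweedler VVM (mcoact M m) (\<lambda>u m0. sweedler VVM (hdelta H u) (\<lambda>u1 u2.
            u1 \<otimes>\<^bsub>VVM\<^esub> (u2 \<otimes>\<^bsub>VM\<^esub> malpha M m0))) =
          sweedler VVM (mcoact M m) (\<lambda>u m0. halpha H u \<otimes>\<^bsub>VVM\<^esub> mcoact M m0)))"

definition yetter_drinfeld ::
  "('k, 'r) ring_scheme \<Rightarrow> ('k, 'a) hom_bialg \<Rightarrow> ('k, 'a) hom_yd \<Rightarrow> bool" where
  "yetter_drinfeld K H M \<longleftrightarrow>
    left_module K H M \<and> left_comodule K H M \<and>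
    (let VM = hsp H \<boxtimes>\<^bsub>K\<^esub> msp M; \<alpha> = halpha H; \<Delta> = hdelta H
     in \<forall>h\<in>carrier (hsp H). \<forall>m\<in>carrier (msp M).
        sweedler VM (\<Delta> h) (\<lambda>h1 h2. sweedler VM (mcoact M (act K H M h1 m)) (\<lambda>u n.
          hprod K H u (\<alpha> (\<alpha> h2)) \<otimes>\<^bsub>VM\<^esub> n)) =
        sweedler VM (\<Delta> h) (\<lambda>h1 h2. sweedler VM (mcoact M m) (\<lambda>u m0.
          hprod K H (\<alpha> (\<alpha> h1)) (\<alpha> u) \<otimes>\<^bsub>VM\<^esub> act K H M (\<alpha> h2) m0)))"

definition module_morphism ::
  "('k, 'r) ring_scheme \<Rightarrow> ('k, 'a) hom_bialg \<Rightarrow> ('k, 'a) hom_yd \<Rightarrow> ('k, 'a) hom_yd \<Rightarrow>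
   ('a univ \<Rightarrow> 'a univ) \<Rightarrow> bool" where
  "module_morphism K H M N f \<longleftrightarrow>
    f \<in> linear_maps K (msp M) (msp N) \<and>
    (\<forall>m\<in>carrier (msp M). malpha N (f m) = f (malpha M m)) \<and>
    (\<forall>h\<in>carrier (hsp H). \<forall>m\<in>carrier (msp M). f (act K H M h m) = act K H N h (f m))"

definition comodule_morphism ::
  "('k, 'r) ring_scheme \<Rightarrow> ('k, 'a) hom_bialg \<Rightarrow>
   ('k, 'a, 'z) hom_comod_scheme \<Rightarrow> ('k, 'a, 'z) hom_comod_scheme \<Rightarrow>
   ('a univ \<Rightarrow> 'a univ) \<Rightarrow> bool" where
  "comodule_morphism K H M N f \<longleftrightarrow>
    f \<in> linear_maps K (msp M) (msp N) \<and>
    (\<forall>m\<in>carrier (msp M). malpha N (f m) = f (malpha M m)) \<and>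
    (\<forall>m\<in>carrier (msp M).
      tensor_map K (hsp H) (msp M) (hsp H) (msp N) (\<lambda>h\<in>carrier (hsp H). h) f (mcoact M m) =
      mcoact N (f m))"


section \<open>Quasi-braided pre-tensor categories\<close>

record ('o, 'm) cat =
  obj :: "'o set"
  arr :: "'m set"
  dom :: "'m \<Rightarrow> 'o"
  cod :: "'m \<Rightarrow> 'o"
  ident :: "'o \<Rightarrow> 'm"
  comp :: "'m \<Rightarrow> 'm \<Rightarrow> 'm"  (infixl "\<cdot>\<index>" 65)

record ('o, 'm) qbcat = "('o, 'm) cat" +
  tobj :: "'o \<Rightarrow> 'o \<Rightarrow> 'o"  (infixl "\<star>\<index>" 75)
  tarr :: "'m \<Rightarrow> 'm \<Rightarrow> 'm"  (infixl "\<star>\<star>\<index>" 75)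
  assoc :: "'o \<Rightarrow> 'o \<Rightarrow> 'o \<Rightarrow> 'm"
  braid :: "'o \<Rightarrow> 'o \<Rightarrow> 'm"

definition hom_set :: "('o, 'm, 'z) cat_scheme \<Rightarrow> 'o \<Rightarrow> 'o \<Rightarrow> 'm set" where
  "hom_set C A B = {f \<in> arr C. dom C f = A \<and> cod C f = B}"

definition category :: "('o, 'm, 'z) cat_scheme \<Rightarrow> bool" where
  "category C \<longleftrightarrow>
    (\<forall>f\<in>arr C. dom C f \<in> obj C \<and> cod C f \<in> obj C) \<and>
    (\<forall>A\<in>obj C. ident C A \<in> hom_set C A A) \<and>
    (\<forall>f\<in>arr C. \<forall>g\<in>arr C. cod C f = dom C g \<longrightarrow>
      g \<cdot>\<^bsub>C\<^esub> f \<in> hom_set C (dom C f) (cod C g)) \<and>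
    (\<forall>f\<in>arr C. f \<cdot>\<^bsub>C\<^esub> ident C (dom C f) = f \<and> ident C (cod C f) \<cdot>\<^bsub>C\<^esub> f = f) \<and>
    (\<forall>f\<in>arr C. \<forall>g\<in>arr C. \<forall>h\<in>arr C. cod C f = dom C g \<longrightarrow> cod C g = dom C h \<longrightarrow>
      h \<cdot>\<^bsub>C\<^esub> (g \<cdot>\<^bsub>C\<^esub> f) = (h \<cdot>\<^bsub>C\<^esub> g) \<cdot>\<^bsub>C\<^esub> f)"

definition inverse_arrow :: "('o, 'm, 'z) cat_scheme \<Rightarrow> 'm \<Rightarrow> 'm \<Rightarrow> bool" where
  "inverse_arrow C f g \<longleftrightarrow>
    g \<in> hom_set C (cod C f) (dom C f) \<and>
    g \<cdot>\<^bsub>C\<^esub> f = ident C (dom C f) \<and> f \<cdot>\<^bsub>C\<^esub> g = ident C (cod C f)"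

definition inv_arrow :: "('o, 'm, 'z) cat_scheme \<Rightarrow> 'm \<Rightarrow> 'm" where
  "inv_arrow C f = (THE g. inverse_arrow C f g)"

definition pre_tensor_category :: "('o, 'm, 'z) qbcat_scheme \<Rightarrow> bool" where
  "pre_tensor_category C \<longleftrightarrow>
    category C \<and>
    (\<forall>A\<in>obj C. \<forall>B\<in>obj C. A \<star>\<^bsub>C\<^esub> B \<in> obj C) \<and>
    (\<forall>f\<in>arr C. \<forall>g\<in>arr C.
      f \<star>\<star>\<^bsub>C\<^esub> g \<in> hom_set C (dom C f \<star>\<^bsub>C\<^esub> dom C g) (cod C f \<star>\<^bsub>C\<^esub> cod C g)) \<and>
    (\<forall>A\<in>obj C. \<forall>B\<in>obj C. ident C A \<star>\<star>\<^bsub>C\<^esub> ident C B = ident C (A \<star>\<^bsub>C\<^esub> B)) \<and>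
    (\<forall>f\<in>arr C. \<forall>f'\<in>arr C. \<forall>g\<in>arr C. \<forall>g'\<in>arr C.
      cod C f = dom C f' \<longrightarrow> cod C g = dom C g' \<longrightarrow>
      (f' \<cdot>\<^bsub>C\<^esub> f) \<star>\<star>\<^bsub>C\<^esub> (g' \<cdot>\<^bsub>C\<^esub> g) = (f' \<star>\<star>\<^bsub>C\<^esub> g') \<cdot>\<^bsub>C\<^esub> (f \<star>\<star>\<^bsub>C\<^esub> g)) \<and>
    (\<forall>A\<in>obj C. \<forall>B\<in>obj C. \<forall>D\<in>obj C.
      assoc C A B D \<in> hom_set C ((A \<star>\<^bsub>C\<^esub> B) \<star>\<^bsub>C\<^esub> D) (A \<star>\<^bsub>C\<^esub> (B \<star>\<^bsub>C\<^esub> D)) \<and>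
      (\<exists>g. inverse_arrow C (assoc C A B D) g)) \<and>
    (\<forall>f\<in>arr C. \<forall>g\<in>arr C. \<forall>h\<in>arr C.
      assoc C (cod C f) (cod C g) (cod C h) \<cdot>\<^bsub>C\<^esub> ((f \<star>\<star>\<^bsub>C\<^esub> g) \<star>\<star>\<^bsub>C\<^esub> h) =
      (f \<star>\<star>\<^bsub>C\<^esub> (g \<star>\<star>\<^bsub>C\<^esub> h)) \<cdot>\<^bsub>C\<^esub> assoc C (dom C f) (dom C g) (dom C h)) \<and>
    (\<forall>A\<in>obj C. \<forall>B\<in>obj C. \<forall>D\<in>obj C. \<forall>E\<in>obj C.
      assoc C A B (D \<star>\<^bsub>C\<^esub> E) \<cdot>\<^bsub>C\<^esub> assoc C (A \<star>\<^bsub>C\<^esub> B) D E =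
      (ident C A \<star>\<star>\<^bsub>C\<^esub> assoc C B D E) \<cdot>\<^bsub>C\<^esub> assoc C A (B \<star>\<^bsub>C\<^esub> D) E \<cdot>\<^bsub>C\<^esub>
        (assoc C A B D \<star>\<star>\<^bsub>C\<^esub> ident C E))"

definition quasi_braided_pre_tensor_category :: "('o, 'm, 'z) qbcat_scheme \<Rightarrow> bool" where
  "quasi_braided_pre_tensor_category C \<longleftrightarrow>
    pre_tensor_category C \<and>
    (\<forall>V\<in>obj C. \<forall>W\<in>obj C. braid C V W \<in> hom_set C (V \<star>\<^bsub>C\<^esub> W) (W \<star>\<^bsub>C\<^esub> V)) \<and>
    (\<forall>f\<in>arr C. \<forall>g\<in>arr C.
      braid C (cod C f) (cod C g) \<cdot>\<^bsub>C\<^esub> (f \<star>\<star>\<^bsub>C\<^esub> g) =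
      (g \<star>\<star>\<^bsub>C\<^esub> f) \<cdot>\<^bsub>C\<^esub> braid C (dom C f) (dom C g)) \<and>
    (\<forall>U\<in>obj C. \<forall>V\<in>obj C. \<forall>W\<in>obj C.
      assoc C V W U \<cdot>\<^bsub>C\<^esub> braid C U (V \<star>\<^bsub>C\<^esub> W) \<cdot>\<^bsub>C\<^esub> assoc C U V W =
      (ident C V \<star>\<star>\<^bsub>C\<^esub> braid C U W) \<cdot>\<^bsub>C\<^esub> assoc C V U W \<cdot>\<^bsub>C\<^esub>
        (braid C U V \<star>\<star>\<^bsub>C\<^esub> ident C W)) \<and>
    (\<forall>U\<in>obj C. \<forall>V\<in>obj C. \<forall>W\<in>obj C.
      inv_arrow C (assoc C W U V) \<cdot>\<^bsub>C\<^esub> braid C (U \<star>\<^bsub>C\<^esub> V) W \<cdot>\<^bsub>C\<^esub>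
        inv_arrow C (assoc C U V W) =
      (braid C U W \<star>\<star>\<^bsub>C\<^esub> ident C V) \<cdot>\<^bsub>C\<^esub> inv_arrow C (assoc C U W V) \<cdot>\<^bsub>C\<^esub>
        (ident C U \<star>\<star>\<^bsub>C\<^esub> braid C V W))"

text \<open>
  \<open>C\<close>, regarded as a part of \<open>D\<close> via the injections \<open>F\<close> on objects and \<open>G\<close> on arrows, is a
  quasi-braided pre-tensor subcategory of \<open>D\<close>. Injections are used instead of
  inclusions because objects of \<open>C\<close> may become objects of \<open>D\<close> only after being equipped with
  further structure.
\<close>

definition quasi_braided_pre_tensor_subcategory ::
  "('o \<Rightarrow> 'p) \<Rightarrow> ('m \<Rightarrow> 'n) \<Rightarrow> ('o, 'm, 'y) qbcat_scheme \<Rightarrow> ('p, 'n, 'z) qbcat_scheme \<Rightarrow> bool"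
where
  "quasi_braided_pre_tensor_subcategory F G C D \<longleftrightarrow>
    quasi_braided_pre_tensor_category D \<and>
    quasi_braided_pre_tensor_category C \<and>
    F \<in> obj C \<rightarrow> obj D \<and> inj_on F (obj C) \<and>
    G \<in> arr C \<rightarrow> arr D \<and> inj_on G (arr C) \<and>
    (\<forall>f\<in>arr C. dom D (G f) = F (dom C f) \<and> cod D (G f) = F (cod C f)) \<and>
    (\<forall>A\<in>obj C. G (ident C A) = ident D (F A)) \<and>
    (\<forall>f\<in>arr C. \<forall>g\<in>arr C. cod C f = dom C g \<longrightarrow> G (g \<cdot>\<^bsub>C\<^esub> f) = G g \<cdot>\<^bsub>D\<^esub> G f) \<and>
    (\<forall>A\<in>obj C. \<forall>B\<in>obj C. F (A \<star>\<^bsub>C\<^esub> B) = F A \<star>\<^bsub>D\<^esub> F B) \<and>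
    (\<forall>f\<in>arr C. \<forall>g\<in>arr C. G (f \<star>\<star>\<^bsub>C\<^esub> g) = G f \<star>\<star>\<^bsub>D\<^esub> G g) \<and>
    (\<forall>A\<in>obj C. \<forall>B\<in>obj C. \<forall>E\<in>obj C. G (assoc C A B E) = assoc D (F A) (F B) (F E)) \<and>
    (\<forall>A\<in>obj C. \<forall>B\<in>obj C. G (braid C A B) = braid D (F A) (F B))"


section \<open>The categories of comodules and of Yetter-Drinfeld modules\<close>

definition tensor_alpha ::
  "('k, 'r) ring_scheme \<Rightarrow> ('k, 'a, 'z) hom_comod_scheme \<Rightarrow> ('k, 'a, 'z) hom_comod_scheme \<Rightarrow>
   'a univ \<Rightarrow> 'a univ" where
  "tensor_alpha K M N = tensor_map K (msp M) (msp N) (msp M) (msp N) (malpha M) (malpha N)"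

definition tensor_coact ::
  "('k, 'r) ring_scheme \<Rightarrow> ('k, 'a) hom_bialg \<Rightarrow>
   ('k, 'a, 'z) hom_comod_scheme \<Rightarrow> ('k, 'a, 'z) hom_comod_scheme \<Rightarrow> 'a univ \<Rightarrow> 'a univ" where
  "tensor_coact K H M N =
    (let MN = msp M \<boxtimes>\<^bsub>K\<^esub> msp N; VMN = hsp H \<boxtimes>\<^bsub>K\<^esub> MN
     in (\<lambda>x\<in>carrier MN.
        sweedler VMN x (\<lambda>m n. sweedler VMN (mcoact M m) (\<lambda>u m0. sweedler VMN (mcoact N n) (\<lambda>v n0.
          hprod K H u v \<otimes>\<^bsub>VMN\<^esub> (m0 \<otimes>\<^bsub>MN\<^esub> n0))))))"

definition tensor_act ::
  "('k, 'r) ring_scheme \<Rightarrow> ('k, 'a) hom_bialg \<Rightarrow> ('k, 'a) hom_yd \<Rightarrow> ('k, 'a) hom_yd \<Rightarrow>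
   'a univ \<Rightarrow> 'a univ" where
  "tensor_act K H M N =
    (let MN = msp M \<boxtimes>\<^bsub>K\<^esub> msp N; \<beta> = (\<lambda>h. halpha_inv H (halpha_inv H h))
     in (\<lambda>t\<in>carrier (hsp H \<boxtimes>\<^bsub>K\<^esub> MN).
        sweedler MN t (\<lambda>h x. sweedler MN x (\<lambda>m n. sweedler MN (hdelta H h) (\<lambda>h1 h2.
          act K H M (\<beta> h1) m \<otimes>\<^bsub>MN\<^esub> act K H N (\<beta> h2) n)))))"

definition comod_tensor ::
  "('k, 'r) ring_scheme \<Rightarrow> ('k, 'a) hom_bialg \<Rightarrow>
   ('k, 'a) hom_comod \<Rightarrow> ('k, 'a) hom_comod \<Rightarrow> ('k, 'a) hom_comod" where
  "comod_tensor K H M N =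
    \<lparr>msp = msp M \<boxtimes>\<^bsub>K\<^esub> msp N, malpha = tensor_alpha K M N, mcoact = tensor_coact K H M N\<rparr>"

definition yd_tensor ::
  "('k, 'r) ring_scheme \<Rightarrow> ('k, 'a) hom_bialg \<Rightarrow>
   ('k, 'a) hom_yd \<Rightarrow> ('k, 'a) hom_yd \<Rightarrow> ('k, 'a) hom_yd" where
  "yd_tensor K H M N =
    \<lparr>msp = msp M \<boxtimes>\<^bsub>K\<^esub> msp N, malpha = tensor_alpha K M N, mcoact = tensor_coact K H M N,
     mact = tensor_act K H M N\<rparr>"

definition assoc_map ::
  "('k, 'r) ring_scheme \<Rightarrow> ('k, 'a, 'z) hom_comod_scheme \<Rightarrow> ('k, 'a, 'z) hom_comod_scheme \<Rightarrow>
   ('k, 'a, 'z) hom_comod_scheme \<Rightarrow> 'a univ \<Rightarrow> 'a univ" where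
  "assoc_map K M N P =
    (let NP = msp N \<boxtimes>\<^bsub>K\<^esub> msp P; MNP = msp M \<boxtimes>\<^bsub>K\<^esub> NP
     in (\<lambda>x\<in>carrier ((msp M \<boxtimes>\<^bsub>K\<^esub> msp N) \<boxtimes>\<^bsub>K\<^esub> msp P).
        sweedler MNP x (\<lambda>y p. sweedler MNP y (\<lambda>m n.
          malpha M m \<otimes>\<^bsub>MNP\<^esub> (n \<otimes>\<^bsub>NP\<^esub> malpha_inv P p)))))"

definition yd_braid_map ::
  "('k, 'r) ring_scheme \<Rightarrow> ('k, 'a) hom_bialg \<Rightarrow> ('k, 'a) hom_yd \<Rightarrow> ('k, 'a) hom_yd \<Rightarrow>
   'a univ \<Rightarrow> 'a univ" where
  "yd_braid_map K H M N =
    (let NM = msp N \<boxtimes>\<^bsub>K\<^esub> msp M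
     in (\<lambda>x\<in>carrier (msp M \<boxtimes>\<^bsub>K\<^esub> msp N).
        sweedler NM x (\<lambda>m n. sweedler NM (mcoact M m) (\<lambda>u m0.
          malpha_inv N (act K H N (halpha_inv H u) n) \<otimes>\<^bsub>NM\<^esub> malpha_inv M m0))))"

definition comod_braid_map ::
  "('k, 'r) ring_scheme \<Rightarrow> ('k, 'a) hom_bialg \<Rightarrow> ('a univ \<Rightarrow> 'k) \<Rightarrow>
   ('k, 'a) hom_comod \<Rightarrow> ('k, 'a) hom_comod \<Rightarrow> 'a univ \<Rightarrow> 'a univ" where
  "comod_braid_map K H \<sigma> M N =
    (let NM = msp N \<boxtimes>\<^bsub>K\<^esub> msp M
     in (\<lambda>x\<in>carrier (msp M \<boxtimes>\<^bsub>K\<^esub> msp N).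
        sweedler NM x (\<lambda>m n. sweedler NM (mcoact M m) (\<lambda>u m0. sweedler NM (mcoact N n) (\<lambda>v n0.
          \<sigma> (v \<otimes>\<^bsub>hsp H \<boxtimes>\<^bsub>K\<^esub> hsp H\<^esub> u) \<odot>\<^bsub>NM\<^esub> (malpha_inv N n0 \<otimes>\<^bsub>NM\<^esub> malpha_inv M m0))))))"

definition comod_category ::
  "('k, 'r) ring_scheme \<Rightarrow> ('k, 'a) hom_bialg \<Rightarrow> ('a univ \<Rightarrow> 'k) \<Rightarrow>
   (('k, 'a) hom_comod, ('k, 'a) hom_comod \<times> ('a univ \<Rightarrow> 'a univ) \<times> ('k, 'a) hom_comod) qbcat"
where
  "comod_category K H \<sigma> =
    (let Obs = {M. left_comodule K H M \<and> bij_betw (malpha M) (carrier (msp M)) (carrier (msp M))}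
     in \<lparr>obj = Obs,
         arr = {(M, f, N). M \<in> Obs \<and> N \<in> Obs \<and> comodule_morphism K H M N f},
         dom = (\<lambda>(M, f, N). M),
         cod = (\<lambda>(M, f, N). N),
         ident = (\<lambda>M. (M, \<lambda>m\<in>carrier (msp M). m, M)),
         comp = (\<lambda>(M', g, N') (M, f, N). (M, compose (carrier (msp M)) g f, N')),
         tobj = comod_tensor K H,
         tarr = (\<lambda>(M, f, N) (M', f', N').
           (comod_tensor K H M M', tensor_map K (msp M) (msp M') (msp N) (msp N') f f',
            comod_tensor K H N N')),
         assoc = (\<lambda>M N P.
           (comod_tensor K H (comod_tensor K H M N) P, assoc_map K M N P,
            comod_tensor K H M (comod_tensor K H N P))),
         braid = (\<lambda>M N. (comod_tensor K H M N, comod_braid_map K H \<sigma> M N, comod_tensor K H N M))\<rparr>)"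

definition yd_category ::
  "('k, 'r) ring_scheme \<Rightarrow> ('k, 'a) hom_bialg \<Rightarrow>
   (('k, 'a) hom_yd, ('k, 'a) hom_yd \<times> ('a univ \<Rightarrow> 'a univ) \<times> ('k, 'a) hom_yd) qbcat"
where
  "yd_category K H =
    (let Obs = {M. yetter_drinfeld K H M \<and> bij_betw (malpha M) (carrier (msp M)) (carrier (msp M))}
     in \<lparr>obj = Obs,
         arr = {(M, f, N). M \<in> Obs \<and> N \<in> Obs \<and> module_morphism K H M N f \<and> comodule_morphism K H M N f},
         dom = (\<lambda>(M, f, N). M),
         cod = (\<lambda>(M, f, N). N),
         ident = (\<lambda>M. (M, \<lambda>m\<in>carrier (msp M). m, M)),
         comp = (\<lambda>(M', g, N') (M, f, N). (M, compose (carrier (msp M)) g f, N')),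
         tobj = yd_tensor K H,
         tarr = (\<lambda>(M, f, N) (M', f', N').
           (yd_tensor K H M M', tensor_map K (msp M) (msp M') (msp N) (msp N') f f',
            yd_tensor K H N N')),
         assoc = (\<lambda>M N P.
           (yd_tensor K H (yd_tensor K H M N) P, assoc_map K M N P,
            yd_tensor K H M (yd_tensor K H N P))),
         braid = (\<lambda>M N. (yd_tensor K H M N, yd_braid_map K H M N, yd_tensor K H N M))\<rparr>)"

definition comod_to_yd ::
  "('k, 'r) ring_scheme \<Rightarrow> ('k, 'a) hom_bialg \<Rightarrow> ('a univ \<Rightarrow> 'k) \<Rightarrow>
   ('k, 'a) hom_comod \<Rightarrow> ('k, 'a) hom_yd" where
  "comod_to_yd K H \<sigma> M =
    \<lparr>msp = msp M, malpha = malpha M, mcoact = mcoact M,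
     mact = (\<lambda>t\<in>carrier (hsp H \<boxtimes>\<^bsub>K\<^esub> msp M).
       sweedler (msp M) t (\<lambda>h m. sweedler (msp M) (mcoact M m) (\<lambda>u m0.
         \<sigma> (u \<otimes>\<^bsub>hsp H \<boxtimes>\<^bsub>K\<^esub> hsp H\<^esub> halpha H h) \<odot>\<^bsub>msp M\<^esub> m0)))\<rparr>"

end

theory Submission
  imports Defs
begin

text \<open>
  As \<open>\<alpha>\<^sub>H\<close> and the maps \<open>\<alpha>\<^sub>M\<close> are bijective, all Hom-structures can be untwisted: the product
  \<open>\<beta> (x y)\<close>, the coproduct \<open>\<Delta> (\<beta> h)\<close>, the action \<open>\<alpha>\<^sub>M\<close>-inverse of \<open>h \<cdot> m\<close> and the coaction of the
  \<open>\<alpha>\<^sub>M\<close>-inverse of \<open>m\<close>, where \<open>\<beta>\<close> is the inverse of \<open>\<alpha>\<^sub>H\<close>, make up an ordinary bialgebra with an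
  automorphism and ordinary modules, comodules and Yetter-Drinfeld modules over it. In these terms the
  quasi-braiding is the familiar map sending \<open>m \<otimes> n\<close> to \<open>(u \<cdot> n) \<otimes> m'\<close>, where \<open>u \<otimes> m'\<close> is the coaction
  of \<open>m\<close>, and every axiom becomes a short Sweedler computation on pure tensors.

  For a comodule, the untwisted action is \<open>h \<cdot> m = \<sigma>(u \<otimes> h) m'\<close>. The Yetter-Drinfeld condition is the
  commutation rule for \<open>\<sigma>\<close>; every comodule morphism respects the action; and since \<open>\<sigma>\<close> is invariant
  under \<open>\<alpha>\<^sub>H\<close>, the action is compatible with tensor products. So comodules embed fully and strictly
  into Yetter-Drinfeld modules, and the axioms for comodules are inherited.
\<close>

section \<open>Linear maps and Sweedler sums\<close>

text \<open>Untwisting does not remove every twist. In these terms the tensor product carries the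
  usual codiagonal coaction with an extra \<alpha> on the H-factor, and h acts on it as \<beta> h
  does diagonally. So plain rebracketing is not a morphism, and the associator needs its
  \<open>malpha\<close> and \<open>malpha_inv\<close> on the outer factors. The untwisted laws are
  stated as identities between Sweedler sums with an arbitrary multilinear body, not as equations
  between tensors, since only in that form do they rewrite underneath other sums. Linearity,
  evaluation and flattening of sums are left to the simplifier. Exchanging two independent sums has
  no preferred direction, and such exchanges account for many steps of the longer calculations. The
  categorical axioms are proved once, for Yetter-Drinfeld modules, by comparing maps on pure
  tensors. The second hexagon involves inverses of associators; these lie among the comodule
  morphisms because the embedding is full.\<close>

definition lin :: "('k, 'r) ring_scheme \<Rightarrow> ('k, 'b) module \<Rightarrow> ('k, 'c) module \<Rightarrow> ('b \<Rightarrow> 'c) \<Rightarrow> bool" where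
  "lin K M P f \<longleftrightarrow> (\<forall>x\<in>carrier M. f x \<in> carrier P) \<and>
    (\<forall>x\<in>carrier M. \<forall>y\<in>carrier M. f (x \<oplus>\<^bsub>M\<^esub> y) = f x \<oplus>\<^bsub>P\<^esub> f y) \<and>
    (\<forall>a\<in>carrier K. \<forall>x\<in>carrier M. f (a \<odot>\<^bsub>M\<^esub> x) = a \<odot>\<^bsub>P\<^esub> f x)"

text \<open>Like \<open>lin\<close>, this omits the extensionality demanded by
  \<open>linear_maps\<close>, so that lambda terms in the bodies of Sweedler sums qualify
  directly.\<close>

definition bilin :: "('k, 'r) ring_scheme \<Rightarrow> ('k, 'b) module \<Rightarrow> ('k, 'c) module \<Rightarrow> ('k, 'd) module \<Rightarrow>
    ('b \<Rightarrow> 'c \<Rightarrow> 'd) \<Rightarrow> bool" where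
  "bilin K M N P f \<longleftrightarrow> (\<forall>n\<in>carrier N. lin K M P (\<lambda>m. f m n)) \<and> (\<forall>m\<in>carrier M. lin K N P (f m))"

text \<open>
  A Sweedler sum that does not depend on \<open>f\<close> when \<open>t\<close> is not a tensor. Unlike \<^const>\<open>sweedler\<close>, it
  therefore admits an unconditional congruence rule for its body.
\<close>

definition sw :: "('k, 'r) ring_scheme \<Rightarrow> ('k, 'p) module \<Rightarrow> ('k, 'a univ) module \<Rightarrow> ('k, 'a univ) module \<Rightarrow>
    'a univ \<Rightarrow> ('a univ \<Rightarrow> 'a univ \<Rightarrow> 'p) \<Rightarrow> 'p" where
  "sw K P M N t f = (if Module.module K M \<and> Module.module K N \<and> t \<in> carrier (M \<boxtimes>\<^bsub>K\<^esub> N) then sweedler P t f else undefined)"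

lemma linI:
  assumes "\<And>x. x \<in> carrier M \<Longrightarrow> f x \<in> carrier P"
    and "\<And>x y. x \<in> carrier M \<Longrightarrow> y \<in> carrier M \<Longrightarrow> f (x \<oplus>\<^bsub>M\<^esub> y) = f x \<oplus>\<^bsub>P\<^esub> f y"
    and "\<And>a x. a \<in> carrier K \<Longrightarrow> x \<in> carrier M \<Longrightarrow> f (a \<odot>\<^bsub>M\<^esub> x) = a \<odot>\<^bsub>P\<^esub> f x"
  shows "lin K M P f"
  using assms by (simp add: lin_def)

lemma lin_closed: "lin K M P f \<Longrightarrow> x \<in> carrier M \<Longrightarrow> f x \<in> carrier P"
  and lin_add: "lin K M P f \<Longrightarrow> x \<in> carrier M \<Longrightarrow> y \<in> carrier M \<Longrightarrow> f (x \<oplus>\<^bsub>M\<^esub> y) = f x \<oplus>\<^bsub>P\<^esub> f y"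
  and lin_smult: "lin K M P f \<Longrightarrow> a \<in> carrier K \<Longrightarrow> x \<in> carrier M \<Longrightarrow> f (a \<odot>\<^bsub>M\<^esub> x) = a \<odot>\<^bsub>P\<^esub> f x"
  by (simp_all add: lin_def)

lemma lin_cong:
  assumes "Module.module K M" "lin K M P g" "\<And>x. x \<in> carrier M \<Longrightarrow> f x = g x"
  shows "lin K M P f"
proof -
  interpret M: Module.module K M by fact
  show ?thesis using assms by (auto simp: lin_def)
qed

lemma lin_comp: "lin K M P g \<Longrightarrow> lin K P Q f \<Longrightarrow> lin K M Q (\<lambda>x. f (g x))"
  by (simp add: lin_def)

lemma lin_id [simp]: "lin K M M (\<lambda>x. x)"
  by (simp add: lin_def)

lemma lin_zero:
  assumes "Module.module K M" "Module.module K P" "lin K M P f"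
  shows "f \<zero>\<^bsub>M\<^esub> = \<zero>\<^bsub>P\<^esub>"
proof -
  interpret M: Module.module K M by fact
  interpret P: Module.module K P by fact
  have "f \<zero>\<^bsub>M\<^esub> = f (\<zero>\<^bsub>K\<^esub> \<odot>\<^bsub>M\<^esub> \<zero>\<^bsub>M\<^esub>)" by (simp add: M.smult_l_null)
  also have "\<dots> = \<zero>\<^bsub>K\<^esub> \<odot>\<^bsub>P\<^esub> f \<zero>\<^bsub>M\<^esub>" by (rule lin_smult[OF assms(3)]) auto
  finally show ?thesis using lin_closed[OF assms(3), of "\<zero>\<^bsub>M\<^esub>"] by (simp add: P.smult_l_null)
qed

lemma bilinI [simp]:
  assumes "\<And>n. n \<in> carrier N \<Longrightarrow> lin K M P (\<lambda>m. f m n)"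
    and "\<And>m. m \<in> carrier M \<Longrightarrow> lin K N P (\<lambda>n. f m n)"
  shows "bilin K M N P f"
  using assms by (simp add: bilin_def)

lemma bilin_left: "bilin K M N P f \<Longrightarrow> lin K X M g \<Longrightarrow> n \<in> carrier N \<Longrightarrow> lin K X P (\<lambda>x. f (g x) n)"
  and bilin_right: "bilin K M N P f \<Longrightarrow> lin K X N h \<Longrightarrow> m \<in> carrier M \<Longrightarrow> lin K X P (\<lambda>x. f m (h x))"
  by (auto simp: bilin_def intro: lin_comp)

lemma bilin_closed: "bilin K M N P f \<Longrightarrow> m \<in> carrier M \<Longrightarrow> n \<in> carrier N \<Longrightarrow> f m n \<in> carrier P"
  by (auto simp: bilin_def intro: lin_closed)

lemma linear_maps_lin: "f \<in> linear_maps K M N \<longleftrightarrow> f \<in> extensional (carrier M) \<and> lin K M N f"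
  by (auto simp: linear_maps_def lin_def PiE_def)

lemma linear_maps_restrict:
  assumes "Module.module K M" "lin K M N f"
  shows "(\<lambda>x\<in>carrier M. f x) \<in> linear_maps K M N"
  unfolding linear_maps_lin using assms by (auto intro!: lin_cong[OF assms])

lemma self_module_simps [simp]:
  "carrier (self_module K) = carrier K" "\<zero>\<^bsub>self_module K\<^esub> = \<zero>\<^bsub>K\<^esub>"
  "add (self_module K) = add K" "smult (self_module K) = monoid.mult K"
  by (simp_all add: self_module_def)

lemma module_self_module [simp]:
  assumes "cring K" shows "Module.module K (self_module K)"
proof -
  interpret cring K by fact
  have "\<exists>y\<in>carrier K. y \<oplus>\<^bsub>K\<^esub> x = \<zero>\<^bsub>K\<^esub>" if "x \<in> carrier K" for x
    using that by (intro bexI[of _ "\<ominus>\<^bsub>K\<^esub> x"]) (simp_all add: l_neg)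
  then have "abelian_group (self_module K)"
    by (intro abelian_groupI) (simp_all add: a_ac)
  then show ?thesis
    by (intro moduleI) (simp_all add: assms l_distr r_distr m_assoc)
qed

section \<open>Arithmetic of the tensor product\<close>

context
  fixes K :: "('k, 'r) ring_scheme" and M N :: "('k, 'a univ) module"
  assumes MN: "Module.module K M" "Module.module K N"
begin

interpretation M: Module.module K M by (rule MN)
interpretation N: Module.module K N by (rule MN)
interpretation T: Module.module K "M \<boxtimes>\<^bsub>K\<^esub> N" by (rule module_tensor_prod[OF MN])

lemma tensor_eq_subset:
  "tensor_eq K M N xs ys \<Longrightarrow> set xs \<subseteq> carrier M \<times> carrier N \<and> set ys \<subseteq> carrier M \<times> carrier N"
  by (induction rule: tensor_eq.induct) auto

text \<open>Equivalent lists satisfy the same predicate \<open>tensor_eq\<close>, so the choice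
  operator picks the same representative for both.\<close>

lemma tensor_class_eqI:
  assumes "tensor_eq K M N xs ys" shows "tensor_class K M N xs = tensor_class K M N ys"
proof -
  have "tensor_eq K M N xs = tensor_eq K M N ys"
    using assms by (intro ext) (meson tensor_eq.sym tensor_eq.trans)
  then show ?thesis by (simp add: tensor_class_def)
qed

lemma tensor_eq_summands:
  assumes "set xs \<subseteq> carrier M \<times> carrier N"
  shows "tensor_eq K M N xs (summands (tensor_class K M N xs))"
  unfolding tensor_class_def summands.simps by (rule someI) (rule tensor_eq.refl[OF assms])

lemma carrier_tensor_prod:
  "carrier (M \<boxtimes>\<^bsub>K\<^esub> N) = tensor_class K M N ` {xs. set xs \<subseteq> carrier M \<times> carrier N}"
  by (simp add: tensor_prod_def)

text \<open>The list stored in a tensor is one of its own representatives, so a tensor can be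
  handled through \<open>summands\<close> without introducing another list.\<close>

lemma summands_carrier:
  assumes "t \<in> carrier (M \<boxtimes>\<^bsub>K\<^esub> N)"
  shows "set (summands t) \<subseteq> carrier M \<times> carrier N" "tensor_class K M N (summands t) = t"
proof -
  obtain xs where xs: "set xs \<subseteq> carrier M \<times> carrier N" "t = tensor_class K M N xs"
    using assms by (auto simp: carrier_tensor_prod)
  note e = tensor_eq_summands[OF xs(1), folded xs(2)]
  show "set (summands t) \<subseteq> carrier M \<times> carrier N" using tensor_eq_subset[OF e] by simp
  show "tensor_class K M N (summands t) = t" using tensor_class_eqI[OF e] xs(2) by simp
qed

lemma tensor_class_append:
  assumes "set xs \<subseteq> carrier M \<times> carrier N" "set ys \<subseteq> carrier M \<times> carrier N"
  shows "tensor_class K M N (xs @ ys) = tensor_class K M N xs \<oplus>\<^bsub>M \<boxtimes>\<^bsub>K\<^esub> N\<^esub> tensor_class K M N ys"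
  using tensor_class_eqI[OF tensor_eq.append[OF tensor_eq_summands[OF assms(1)] tensor_eq_summands[OF assms(2)]]]
  by (simp add: tensor_prod_def)

lemma pure_tensor_class: "m \<otimes>\<^bsub>M \<boxtimes>\<^bsub>K\<^esub> N\<^esub> n = tensor_class K M N [(m, n)]"
  by (simp add: tensor_prod_def)

lemma pure_tensor_closed [simp]:
  "m \<in> carrier M \<Longrightarrow> n \<in> carrier N \<Longrightarrow> m \<otimes>\<^bsub>M \<boxtimes>\<^bsub>K\<^esub> N\<^esub> n \<in> carrier (M \<boxtimes>\<^bsub>K\<^esub> N)"
  by (simp add: tensor_prod_def)

lemma pure_tensor_add_left:
  assumes "m \<in> carrier M" "m' \<in> carrier M" "n \<in> carrier N"
  shows "(m \<oplus>\<^bsub>M\<^esub> m') \<otimes>\<^bsub>M \<boxtimes>\<^bsub>K\<^esub> N\<^esub> n = m \<otimes>\<^bsub>M \<boxtimes>\<^bsub>K\<^esub> N\<^esub> n \<oplus>\<^bsub>M \<boxtimes>\<^bsub>K\<^esub> N\<^esub> m' \<otimes>\<^bsub>M \<boxtimes>\<^bsub>K\<^esub> N\<^esub> n"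
  using tensor_class_eqI[OF tensor_eq.add_left[OF assms]] tensor_class_append[of "[(m,n)]" "[(m',n)]"] assms
  by (simp add: pure_tensor_class)

lemma pure_tensor_add_right:
  assumes "m \<in> carrier M" "n \<in> carrier N" "n' \<in> carrier N"
  shows "m \<otimes>\<^bsub>M \<boxtimes>\<^bsub>K\<^esub> N\<^esub> (n \<oplus>\<^bsub>N\<^esub> n') = m \<otimes>\<^bsub>M \<boxtimes>\<^bsub>K\<^esub> N\<^esub> n \<oplus>\<^bsub>M \<boxtimes>\<^bsub>K\<^esub> N\<^esub> m \<otimes>\<^bsub>M \<boxtimes>\<^bsub>K\<^esub> N\<^esub> n'"
  using tensor_class_eqI[OF tensor_eq.add_right[OF assms]] tensor_class_append[of "[(m,n)]" "[(m,n')]"] assms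
  by (simp add: pure_tensor_class)

lemma pure_tensor_balanced:
  assumes "a \<in> carrier K" "m \<in> carrier M" "n \<in> carrier N"
  shows "(a \<odot>\<^bsub>M\<^esub> m) \<otimes>\<^bsub>M \<boxtimes>\<^bsub>K\<^esub> N\<^esub> n = m \<otimes>\<^bsub>M \<boxtimes>\<^bsub>K\<^esub> N\<^esub> (a \<odot>\<^bsub>N\<^esub> n)"
  using tensor_class_eqI[OF tensor_eq.balanced[OF assms]] by (simp add: pure_tensor_class)

lemma tensor_class_sum:
  assumes "set xs \<subseteq> carrier M \<times> carrier N"
  shows "tensor_class K M N xs =
    foldr (\<lambda>(m, n) s. (m \<otimes>\<^bsub>M \<boxtimes>\<^bsub>K\<^esub> N\<^esub> n) \<oplus>\<^bsub>M \<boxtimes>\<^bsub>K\<^esub> N\<^esub> s) xs \<zero>\<^bsub>M \<boxtimes>\<^bsub>K\<^esub> N\<^esub>"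
  using assms
proof (induction xs)
  case Nil
  show ?case by (simp add: tensor_prod_def)
next
  case (Cons p xs)
  then show ?case using tensor_class_append[of "[p]" xs] by (cases p) (simp add: pure_tensor_class)
qed

text \<open>The scalar acts on the stored representative of the pure tensor, which may differ from
  \<open>[(m, n)]\<close>. The result is therefore read as a Sweedler sum with a bilinear body,
  whose value does not depend on the representative.\<close>

lemma smult_pure_tensor:
  assumes a: "a \<in> carrier K" and mn: "m \<in> carrier M" "n \<in> carrier N"
  shows "a \<odot>\<^bsub>M \<boxtimes>\<^bsub>K\<^esub> N\<^esub> (m \<otimes>\<^bsub>M \<boxtimes>\<^bsub>K\<^esub> N\<^esub> n) = (a \<odot>\<^bsub>M\<^esub> m) \<otimes>\<^bsub>M \<boxtimes>\<^bsub>K\<^esub> N\<^esub> n"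
proof -
  let ?t = "m \<otimes>\<^bsub>M \<boxtimes>\<^bsub>K\<^esub> N\<^esub> n" and ?T = "M \<boxtimes>\<^bsub>K\<^esub> N"
  have t: "?t \<in> carrier ?T" using mn by simp
  have "a \<odot>\<^bsub>?T\<^esub> ?t = tensor_class K M N (map (\<lambda>(m, n). (a \<odot>\<^bsub>M\<^esub> m, n)) (summands ?t))"
    by (simp add: tensor_prod_def)
  also have "\<dots> = foldr (\<lambda>(m, n) s. (m \<otimes>\<^bsub>?T\<^esub> n) \<oplus>\<^bsub>?T\<^esub> s)
      (map (\<lambda>(m, n). (a \<odot>\<^bsub>M\<^esub> m, n)) (summands ?t)) \<zero>\<^bsub>?T\<^esub>"
    using summands_carrier(1)[OF t] a by (intro tensor_class_sum) auto
  also have "\<dots> = sweedler ?T ?t (\<lambda>m n. (a \<odot>\<^bsub>M\<^esub> m) \<otimes>\<^bsub>?T\<^esub> n)"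
    by (simp add: sweedler_def foldr_map o_def split_def)
  also have "\<dots> = foldr (\<lambda>(m, n) s. ((a \<odot>\<^bsub>M\<^esub> m) \<otimes>\<^bsub>?T\<^esub> n) \<oplus>\<^bsub>?T\<^esub> s) [(m, n)] \<zero>\<^bsub>?T\<^esub>"
    unfolding pure_tensor_class[of m n]
  proof (rule sweedler_tensor_class[OF T.abelian_group_axioms MN])
    fix b x y assume "b \<in> carrier K" "x \<in> carrier M" "y \<in> carrier N"
    moreover from this have "a \<odot>\<^bsub>M\<^esub> (b \<odot>\<^bsub>M\<^esub> x) = b \<odot>\<^bsub>M\<^esub> (a \<odot>\<^bsub>M\<^esub> x)"
      using a by (metis M.smult_assoc1 M.m_comm)
    ultimately show "(a \<odot>\<^bsub>M\<^esub> (b \<odot>\<^bsub>M\<^esub> x)) \<otimes>\<^bsub>?T\<^esub> y = (a \<odot>\<^bsub>M\<^esub> x) \<otimes>\<^bsub>?T\<^esub> (b \<odot>\<^bsub>N\<^esub> y)"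
      using a by (simp add: pure_tensor_balanced)
  qed (use a mn in \<open>auto simp: M.smult_r_distr pure_tensor_add_left pure_tensor_add_right\<close>)
  also have "\<dots> = (a \<odot>\<^bsub>M\<^esub> m) \<otimes>\<^bsub>?T\<^esub> n" using a mn by simp
  finally show ?thesis .
qed

lemma bilin_pure_tensor: "bilin K M N (M \<boxtimes>\<^bsub>K\<^esub> N) (monoid.mult (M \<boxtimes>\<^bsub>K\<^esub> N))"
  by (intro bilinI linI)
    (simp_all add: pure_tensor_add_left pure_tensor_add_right smult_pure_tensor pure_tensor_balanced)

lemmas lin_pure_tensor [simp] = bilin_left[OF bilin_pure_tensor] bilin_right[OF bilin_pure_tensor]

end

declare module_tensor_prod [simp]

lemma foldr_pair_cong:
  assumes "\<And>m n. (m, n) \<in> set xs \<Longrightarrow> f m n = g m n"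
  shows "foldr (\<lambda>(m, n) s. f m n \<oplus>\<^bsub>P\<^esub> s) xs z = foldr (\<lambda>(m, n) s. g m n \<oplus>\<^bsub>P\<^esub> s) xs z"
  using assms by (induction xs) auto

text \<open>The summands of a tensor lie in the two carriers, and off tensors both sides are
  \<open>undefined\<close>. As a congruence rule this hands the simplifier the carrier memberships
  of the bound variables at every level of a nested sum.\<close>

lemma sw_cong [cong]:
  assumes "P = P'" "M = M'" "N = N'" "t = t'"
    "\<And>m n. m \<in> carrier M' \<Longrightarrow> n \<in> carrier N' \<Longrightarrow> f m n = g m n"
  shows "sw K P M N t f = sw K P' M' N' t' g"
  using assms(5) summands_carrier(1)[of K M N t]
  unfolding sw_def sweedler_def assms(1-4)[symmetric] by (auto intro!: foldr_pair_cong)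

lemmas sw_body_cong = sw_cong[OF HOL.refl HOL.refl HOL.refl HOL.refl]

section \<open>Calculus of Sweedler sums\<close>

context
  fixes K :: "('k, 'r) ring_scheme" and M N :: "('k, 'a univ) module" and P :: "('k, 'p) module"
  assumes MNP: "Module.module K M" "Module.module K N" "Module.module K P"
begin

interpretation M: Module.module K M by (rule MNP)
interpretation N: Module.module K N by (rule MNP)
interpretation P: Module.module K P by (rule MNP)
interpretation T: Module.module K "M \<boxtimes>\<^bsub>K\<^esub> N" by (rule module_tensor_prod[OF MNP(1,2)])

lemma foldr_pair_closed:
  assumes "set xs \<subseteq> carrier M \<times> carrier N"
    "\<And>m n. m \<in> carrier M \<Longrightarrow> n \<in> carrier N \<Longrightarrow> f m n \<in> carrier P"
  shows "foldr (\<lambda>(m, n) s. f m n \<oplus>\<^bsub>P\<^esub> s) xs \<zero>\<^bsub>P\<^esub> \<in> carrier P"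
  using assms by (induction xs) auto

lemma sw_closed [simp]:
  assumes "t \<in> carrier (M \<boxtimes>\<^bsub>K\<^esub> N)"
    "\<And>m n. m \<in> carrier M \<Longrightarrow> n \<in> carrier N \<Longrightarrow> f m n \<in> carrier P"
  shows "sw K P M N t f \<in> carrier P"
  using assms foldr_pair_closed[OF summands_carrier(1)[OF MNP(1,2) assms(1)]]
  by (simp add: sw_def sweedler_def MNP)

lemma sweedler_eq_sw:
  assumes "t \<in> carrier (M \<boxtimes>\<^bsub>K\<^esub> N)"
  shows "sweedler P t f = sw K P M N t f"
  using assms by (simp add: sw_def MNP)

lemma foldr_pair_add:
  assumes "set xs \<subseteq> carrier M \<times> carrier N"
    "\<And>m n. m \<in> carrier M \<Longrightarrow> n \<in> carrier N \<Longrightarrow> f m n \<in> carrier P"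
    "\<And>m n. m \<in> carrier M \<Longrightarrow> n \<in> carrier N \<Longrightarrow> g m n \<in> carrier P"
  shows "foldr (\<lambda>(m, n) s. (f m n \<oplus>\<^bsub>P\<^esub> g m n) \<oplus>\<^bsub>P\<^esub> s) xs \<zero>\<^bsub>P\<^esub> =
    foldr (\<lambda>(m, n) s. f m n \<oplus>\<^bsub>P\<^esub> s) xs \<zero>\<^bsub>P\<^esub> \<oplus>\<^bsub>P\<^esub> foldr (\<lambda>(m, n) s. g m n \<oplus>\<^bsub>P\<^esub> s) xs \<zero>\<^bsub>P\<^esub>"
  using assms(1)
proof (induction xs)
  case (Cons p xs)
  then show ?case
    using assms(2,3) foldr_pair_closed[of xs f] foldr_pair_closed[of xs g]
    by (cases p) (simp add: P.a_ac)
qed simp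

lemma foldr_pair_lin:
  assumes "set xs \<subseteq> carrier M \<times> carrier N" "Module.module K Q" "lin K P Q g"
    "\<And>m n. m \<in> carrier M \<Longrightarrow> n \<in> carrier N \<Longrightarrow> f m n \<in> carrier P"
  shows "g (foldr (\<lambda>(m, n) s. f m n \<oplus>\<^bsub>P\<^esub> s) xs \<zero>\<^bsub>P\<^esub>) =
    foldr (\<lambda>(m, n) s. g (f m n) \<oplus>\<^bsub>Q\<^esub> s) xs \<zero>\<^bsub>Q\<^esub>"
  using assms(1)
proof (induction xs)
  case Nil
  show ?case using lin_zero[OF MNP(3) assms(2,3)] by simp
next
  case (Cons p xs)
  then show ?case
    using assms(4) foldr_pair_closed[of xs f] lin_add[OF assms(3)] by (cases p) simp
qed

text \<open>Both sides run over the same stored list of summands, so this is additivity of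
  \<open>g\<close> on a finite sum.\<close>

lemma sw_lin:
  assumes "lin K P Q g" "Module.module K Q" "t \<in> carrier (M \<boxtimes>\<^bsub>K\<^esub> N)"
    "\<And>m n. m \<in> carrier M \<Longrightarrow> n \<in> carrier N \<Longrightarrow> f m n \<in> carrier P"
  shows "g (sw K P M N t f) = sw K Q M N t (\<lambda>m n. g (f m n))"
  using assms(3) foldr_pair_lin[OF summands_carrier(1)[OF MNP(1,2) assms(3)] assms(2,1), of f] assms(4)
  by (simp add: sw_def sweedler_def MNP)

lemma sw_tensor_class:
  assumes "bilin K M N P f" "set xs \<subseteq> carrier M \<times> carrier N"
  shows "sw K P M N (tensor_class K M N xs) f = foldr (\<lambda>(m, n) s. f m n \<oplus>\<^bsub>P\<^esub> s) xs \<zero>\<^bsub>P\<^esub>"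
proof -
  have "sweedler P (tensor_class K M N xs) f = foldr (\<lambda>(m, n) s. f m n \<oplus>\<^bsub>P\<^esub> s) xs \<zero>\<^bsub>P\<^esub>"
    using assms by (intro sweedler_tensor_class[OF P.abelian_group_axioms MNP(1,2)])
      (auto simp: bilin_def lin_def)
  then show ?thesis using assms(2) by (simp add: sw_def MNP carrier_tensor_prod)
qed

lemma sw_pure_tensor [simp]:
  assumes "m \<in> carrier M" "n \<in> carrier N" "bilin K M N P f"
  shows "sw K P M N (m \<otimes>\<^bsub>M \<boxtimes>\<^bsub>K\<^esub> N\<^esub> n) f = f m n"
  using sw_tensor_class[OF assms(3), of "[(m, n)]"] assms bilin_closed[OF assms(3)]
  by (simp add: pure_tensor_class[OF MNP(1,2)])

text \<open>Adding or scaling tensors replaces the stored list by a new representative. Bilinearity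
  of \<open>f\<close> guarantees that the sum does not notice this.\<close>

lemma sw_lin_arg:
  assumes "bilin K M N P f"
  shows "lin K (M \<boxtimes>\<^bsub>K\<^esub> N) P (\<lambda>t. sw K P M N t f)"
proof (rule linI)
  show "sw K P M N t f \<in> carrier P" if "t \<in> carrier (M \<boxtimes>\<^bsub>K\<^esub> N)" for t
    using that bilin_closed[OF assms] by simp
next
  fix s t assume st: "s \<in> carrier (M \<boxtimes>\<^bsub>K\<^esub> N)" "t \<in> carrier (M \<boxtimes>\<^bsub>K\<^esub> N)"
  note sub = summands_carrier[OF MNP(1,2) st(1)] summands_carrier[OF MNP(1,2) st(2)]
  have app: "s \<oplus>\<^bsub>M \<boxtimes>\<^bsub>K\<^esub> N\<^esub> t = tensor_class K M N (summands s @ summands t)"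
    using tensor_class_append[OF MNP(1,2) sub(1,3)] sub by simp
  have fa: "foldr (\<lambda>(m, n) s. f m n \<oplus>\<^bsub>P\<^esub> s) xs z =
      foldr (\<lambda>(m, n) s. f m n \<oplus>\<^bsub>P\<^esub> s) xs \<zero>\<^bsub>P\<^esub> \<oplus>\<^bsub>P\<^esub> z"
    if "set xs \<subseteq> carrier M \<times> carrier N" "z \<in> carrier P" for xs z
    using that(1)
  proof (induction xs)
    case (Cons p xs)
    then show ?case using that(2) foldr_pair_closed[of xs f] bilin_closed[OF assms]
      by (cases p) (simp add: P.a_assoc)
  qed (simp add: that)
  have "sw K P M N (s \<oplus>\<^bsub>M \<boxtimes>\<^bsub>K\<^esub> N\<^esub> t) f =
      foldr (\<lambda>(m, n) s. f m n \<oplus>\<^bsub>P\<^esub> s) (summands s @ summands t) \<zero>\<^bsub>P\<^esub>"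
    unfolding app using sub by (intro sw_tensor_class[OF assms]) auto
  also have "\<dots> = sweedler P s f \<oplus>\<^bsub>P\<^esub> sweedler P t f"
    using fa[OF sub(1) foldr_pair_closed[OF sub(3), of f]] foldr_pair_closed[OF sub(3), of f] bilin_closed[OF assms]
    by (simp add: sweedler_def)
  finally show "sw K P M N (s \<oplus>\<^bsub>M \<boxtimes>\<^bsub>K\<^esub> N\<^esub> t) f = sw K P M N s f \<oplus>\<^bsub>P\<^esub> sw K P M N t f"
    using st by (simp add: sw_def MNP)
next
  fix a t assume a: "a \<in> carrier K" and t: "t \<in> carrier (M \<boxtimes>\<^bsub>K\<^esub> N)"
  note sub = summands_carrier[OF MNP(1,2) t]
  have fl: "f (a \<odot>\<^bsub>M\<^esub> m) n = a \<odot>\<^bsub>P\<^esub> f m n" if "m \<in> carrier M" "n \<in> carrier N" for m n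
    using assms a that by (simp add: bilin_def lin_def)
  have la: "lin K P P (\<lambda>x. a \<odot>\<^bsub>P\<^esub> x)"
    using a by (intro linI) (simp_all add: P.smult_r_distr P.smult_assoc1[symmetric] M.m_comm)
  have "a \<odot>\<^bsub>M \<boxtimes>\<^bsub>K\<^esub> N\<^esub> t = tensor_class K M N (map (\<lambda>(m, n). (a \<odot>\<^bsub>M\<^esub> m, n)) (summands t))"
    by (simp add: tensor_prod_def)
  also have "sw K P M N \<dots> f = foldr (\<lambda>(m, n) s. f m n \<oplus>\<^bsub>P\<^esub> s)
      (map (\<lambda>(m, n). (a \<odot>\<^bsub>M\<^esub> m, n)) (summands t)) \<zero>\<^bsub>P\<^esub>"
    using sub(1) a by (intro sw_tensor_class[OF assms]) auto
  also have "\<dots> = foldr (\<lambda>(m, n) s. f (a \<odot>\<^bsub>M\<^esub> m) n \<oplus>\<^bsub>P\<^esub> s) (summands t) \<zero>\<^bsub>P\<^esub>"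
    by (simp add: foldr_map o_def split_def)
  also have "\<dots> = foldr (\<lambda>(m, n) s. (a \<odot>\<^bsub>P\<^esub> f m n) \<oplus>\<^bsub>P\<^esub> s) (summands t) \<zero>\<^bsub>P\<^esub>"
    using sub(1) by (intro foldr_pair_cong fl) auto
  also have "\<dots> = a \<odot>\<^bsub>P\<^esub> sw K P M N t f"
    using foldr_pair_lin[OF sub(1) MNP(3) la, of f] t bilin_closed[OF assms]
    by (simp add: sw_def sweedler_def MNP)
  finally show "sw K P M N (a \<odot>\<^bsub>M \<boxtimes>\<^bsub>K\<^esub> N\<^esub> t) f = a \<odot>\<^bsub>P\<^esub> sw K P M N t f" .
qed

text \<open>A variable enters a Sweedler sum either through the body, as here, or through the
  tensor, as in \<open>sw_lin_comp\<close>. With these two rules linearity of nested sums becomes a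
  simplifier goal.\<close>

lemma sw_lin_body [simp]:
  assumes t: "t \<in> carrier (M \<boxtimes>\<^bsub>K\<^esub> N)"
    and f: "\<And>m n. m \<in> carrier M \<Longrightarrow> n \<in> carrier N \<Longrightarrow> lin K X P (\<lambda>x. f x m n)"
  shows "lin K X P (\<lambda>x. sw K P M N t (f x))"
proof -
  note sub = summands_carrier[OF MNP(1,2) t]
  show ?thesis
  proof (rule linI)
    show "sw K P M N t (f x) \<in> carrier P" if "x \<in> carrier X" for x
      using that lin_closed[OF f] by (simp add: t)
  next
    fix x y assume xy: "x \<in> carrier X" "y \<in> carrier X"
    have "sw K P M N t (f (x \<oplus>\<^bsub>X\<^esub> y)) = sw K P M N t (\<lambda>m n. f x m n \<oplus>\<^bsub>P\<^esub> f y m n)"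
      using xy by (auto intro!: sw_body_cong lin_add[OF f])
    then show "sw K P M N t (f (x \<oplus>\<^bsub>X\<^esub> y)) = sw K P M N t (f x) \<oplus>\<^bsub>P\<^esub> sw K P M N t (f y)"
      using foldr_pair_add[OF sub(1), of "f x" "f y"] xy t lin_closed[OF f]
      by (simp add: sw_def sweedler_def MNP)
  next
    fix a x assume ax: "a \<in> carrier K" "x \<in> carrier X"
    have la: "lin K P P (\<lambda>x. a \<odot>\<^bsub>P\<^esub> x)"
      using ax by (intro linI) (simp_all add: P.smult_r_distr P.smult_assoc1[symmetric] M.m_comm)
    have "sw K P M N t (f (a \<odot>\<^bsub>X\<^esub> x)) = sw K P M N t (\<lambda>m n. a \<odot>\<^bsub>P\<^esub> f x m n)"
      using ax by (auto intro!: sw_body_cong lin_smult[OF f])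
    then show "sw K P M N t (f (a \<odot>\<^bsub>X\<^esub> x)) = a \<odot>\<^bsub>P\<^esub> sw K P M N t (f x)"
      using sw_lin[OF la MNP(3) t, of "f x"] lin_closed[OF f] ax by simp
  qed
qed

lemma sw_lin_comp [simp]:
  assumes "lin K X (M \<boxtimes>\<^bsub>K\<^esub> N) t" "bilin K M N P f"
  shows "lin K X P (\<lambda>x. sw K P M N (t x) f)"
  by (rule lin_comp[OF assms(1) sw_lin_arg[OF assms(2)]])

end

lemma sw_pure_tensors [simp]:
  assumes "Module.module K M" "Module.module K N" "t \<in> carrier (M \<boxtimes>\<^bsub>K\<^esub> N)"
  shows "sw K (M \<boxtimes>\<^bsub>K\<^esub> N) M N t (\<lambda>m n. m \<otimes>\<^bsub>M \<boxtimes>\<^bsub>K\<^esub> N\<^esub> n) = t"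
  using tensor_class_sum[OF assms(1,2) summands_carrier(1)[OF assms]] summands_carrier(2)[OF assms] assms
  by (simp add: sw_def sweedler_def)

section \<open>Reduction to pure tensors, and exchange and flattening of sums\<close>

lemma lin_eq_sw:
  assumes MNP: "Module.module K M" "Module.module K N" "Module.module K P"
    and h: "lin K (M \<boxtimes>\<^bsub>K\<^esub> N) P h" and t: "t \<in> carrier (M \<boxtimes>\<^bsub>K\<^esub> N)"
  shows "h t = sw K P M N t (\<lambda>m n. h (m \<otimes>\<^bsub>M \<boxtimes>\<^bsub>K\<^esub> N\<^esub> n))"
  using sw_lin[OF MNP(1,2) module_tensor_prod[OF MNP(1,2)] h MNP(3) t, of "monoid.mult (M \<boxtimes>\<^bsub>K\<^esub> N)"] MNP t
  by simp

text \<open>Every tensor is the sum of the pure tensors in its stored list. This is how equality of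
  composite structure maps is reduced to a computation with elements.\<close>

lemma tensor_ext:
  assumes "Module.module K M" "Module.module K N" "Module.module K P"
    and "lin K (M \<boxtimes>\<^bsub>K\<^esub> N) P f" "lin K (M \<boxtimes>\<^bsub>K\<^esub> N) P g"
    and "\<And>m n. m \<in> carrier M \<Longrightarrow> n \<in> carrier N \<Longrightarrow>
      f (m \<otimes>\<^bsub>M \<boxtimes>\<^bsub>K\<^esub> N\<^esub> n) = g (m \<otimes>\<^bsub>M \<boxtimes>\<^bsub>K\<^esub> N\<^esub> n)"
  shows "\<forall>t\<in>carrier (M \<boxtimes>\<^bsub>K\<^esub> N). f t = g t"
  using assms(6) lin_eq_sw[OF assms(1-3) assms(4)] lin_eq_sw[OF assms(1-3) assms(5)]
  by (auto intro!: sw_body_cong)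

text \<open>Two finite sums over fixed lists commute. Since the rule would loop as a rewrite rule,
  it is applied explicitly wherever independent Sweedler sums must change places.\<close>

lemma sw_swap:
  fixes P :: "('k, 'p) module"
  assumes MNP: "Module.module K M" "Module.module K N" "Module.module K M'" "Module.module K N'"
      "Module.module K P"
    and t: "t \<in> carrier (M \<boxtimes>\<^bsub>K\<^esub> N)" and s: "s \<in> carrier (M' \<boxtimes>\<^bsub>K\<^esub> N')"
    and f: "\<And>m n u v. m \<in> carrier M \<Longrightarrow> n \<in> carrier N \<Longrightarrow> u \<in> carrier M' \<Longrightarrow> v \<in> carrier N' \<Longrightarrow>
      f m n u v \<in> carrier P"
  shows "sw K P M N t (\<lambda>m n. sw K P M' N' s (f m n)) =
    sw K P M' N' s (\<lambda>u v. sw K P M N t (\<lambda>m n. f m n u v))"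
proof -
  interpret P: Module.module K P by fact
  let ?S = "\<lambda>xs f. foldr (\<lambda>(m, n) s. f m n \<oplus>\<^bsub>P\<^esub> s) xs \<zero>\<^bsub>P\<^esub>"
  note sub = summands_carrier(1)[OF MNP(1,2) t] summands_carrier(1)[OF MNP(3,4) s]
  have zero: "?S ys (\<lambda>u v. \<zero>\<^bsub>P\<^esub>) = \<zero>\<^bsub>P\<^esub>" if "set ys \<subseteq> carrier M' \<times> carrier N'" for ys
    by (induction ys) auto
  have "?S xs (\<lambda>m n. ?S (summands s) (f m n)) = ?S (summands s) (\<lambda>u v. ?S xs (\<lambda>m n. f m n u v))"
    if "set xs \<subseteq> carrier M \<times> carrier N" for xs
    using that
  proof (induction xs)
    case Nil
    show ?case using zero[OF sub(2)] by (simp add: split_def)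
  next
    case (Cons p xs)
    obtain m n where p: "p = (m, n)" by force
    then have mn: "m \<in> carrier M" "n \<in> carrier N" "set xs \<subseteq> carrier M \<times> carrier N"
      using Cons.prems by auto
    show ?case
      using foldr_pair_add[OF MNP(3-5) sub(2), of "f m n" "\<lambda>u v. ?S xs (\<lambda>m n. f m n u v)"]
        Cons.IH mn f foldr_pair_closed[OF MNP(1,2,5) mn(3)]
      by (simp add: p)
  qed
  from this[OF sub(1)] show ?thesis using s t by (simp add: sw_def sweedler_def MNP)
qed

text \<open>A sum over a tensor that is itself a Sweedler sum is flattened; together with
  \<open>sw_pure_tensor\<close> this evaluates iterated coactions and coproducts.\<close>

lemma sw_sw [simp]:
  fixes P :: "('k, 'p) module"
  assumes "Module.module K M" "Module.module K N" "Module.module K A" "Module.module K B" "Module.module K P"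
    "t \<in> carrier (M \<boxtimes>\<^bsub>K\<^esub> N)" "bilin K A B P g"
    "\<And>m n. m \<in> carrier M \<Longrightarrow> n \<in> carrier N \<Longrightarrow> f m n \<in> carrier (A \<boxtimes>\<^bsub>K\<^esub> B)"
  shows "sw K P A B (sw K (A \<boxtimes>\<^bsub>K\<^esub> B) M N t f) g = sw K P M N t (\<lambda>m n. sw K P A B (f m n) g)"
  using assms by (intro sw_lin sw_lin_arg) simp_all

lemma pure_tensor_sw_left [simp]:
  assumes "Module.module K M" "Module.module K N" "Module.module K A" "Module.module K B"
    "t \<in> carrier (M \<boxtimes>\<^bsub>K\<^esub> N)" "b \<in> carrier B"
    "\<And>m n. m \<in> carrier M \<Longrightarrow> n \<in> carrier N \<Longrightarrow> f m n \<in> carrier A"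
  shows "sw K A M N t f \<otimes>\<^bsub>A \<boxtimes>\<^bsub>K\<^esub> B\<^esub> b = sw K (A \<boxtimes>\<^bsub>K\<^esub> B) M N t (\<lambda>m n. f m n \<otimes>\<^bsub>A \<boxtimes>\<^bsub>K\<^esub> B\<^esub> b)"
  using assms by (intro sw_lin[where g = "\<lambda>a. a \<otimes>\<^bsub>A \<boxtimes>\<^bsub>K\<^esub> B\<^esub> b"]) simp_all

lemma pure_tensor_sw_right [simp]:
  assumes "Module.module K M" "Module.module K N" "Module.module K A" "Module.module K B"
    "t \<in> carrier (M \<boxtimes>\<^bsub>K\<^esub> N)" "a \<in> carrier A"
    "\<And>m n. m \<in> carrier M \<Longrightarrow> n \<in> carrier N \<Longrightarrow> f m n \<in> carrier B"
  shows "a \<otimes>\<^bsub>A \<boxtimes>\<^bsub>K\<^esub> B\<^esub> sw K B M N t f = sw K (A \<boxtimes>\<^bsub>K\<^esub> B) M N t (\<lambda>m n. a \<otimes>\<^bsub>A \<boxtimes>\<^bsub>K\<^esub> B\<^esub> f m n)"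
  using assms by (intro sw_lin[where g = "\<lambda>b. a \<otimes>\<^bsub>A \<boxtimes>\<^bsub>K\<^esub> B\<^esub> b"]) simp_all

lemma lin_inv_into:
  assumes "Module.module K M" "lin K M M f" "bij_betw f (carrier M) (carrier M)"
  shows "lin K M M (inv_into (carrier M) f)"
proof -
  interpret M: Module.module K M by fact
  let ?g = "inv_into (carrier M) f"
  have g: "?g x \<in> carrier M" "f (?g x) = x" if "x \<in> carrier M" for x
    using that assms(3) by (auto simp: bij_betw_def inv_into_into f_inv_into_f)
  have gf: "?g (f x) = x" if "x \<in> carrier M" for x
    using that assms(3) by (simp add: bij_betw_def)
  show ?thesis
  proof (rule linI)
    fix x y assume xy: "x \<in> carrier M" "y \<in> carrier M"
    then have "f (?g x \<oplus>\<^bsub>M\<^esub> ?g y) = x \<oplus>\<^bsub>M\<^esub> y" using g lin_add[OF assms(2)] by simp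
    then show "?g (x \<oplus>\<^bsub>M\<^esub> y) = ?g x \<oplus>\<^bsub>M\<^esub> ?g y" using gf[of "?g x \<oplus>\<^bsub>M\<^esub> ?g y"] g xy by simp
  next
    fix a x assume ax: "a \<in> carrier K" "x \<in> carrier M"
    then have "f (a \<odot>\<^bsub>M\<^esub> ?g x) = a \<odot>\<^bsub>M\<^esub> x" using g lin_smult[OF assms(2)] by simp
    then show "?g (a \<odot>\<^bsub>M\<^esub> x) = a \<odot>\<^bsub>M\<^esub> ?g x" using gf[of "a \<odot>\<^bsub>M\<^esub> ?g x"] g ax by simp
  qed (use g in auto)
qed

section \<open>Tensor products and composites of linear maps\<close>

lemma lin_tensor_map:
  assumes "Module.module K M" "Module.module K N" "Module.module K M'" "Module.module K N'"
    and "lin K M M' f" "lin K N N' g"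
  shows "tensor_map K M N M' N' f g \<in> linear_maps K (M \<boxtimes>\<^bsub>K\<^esub> N) (M' \<boxtimes>\<^bsub>K\<^esub> N')"
    and "m \<in> carrier M \<Longrightarrow> n \<in> carrier N \<Longrightarrow>
      tensor_map K M N M' N' f g (m \<otimes>\<^bsub>M \<boxtimes>\<^bsub>K\<^esub> N\<^esub> n) = f m \<otimes>\<^bsub>M' \<boxtimes>\<^bsub>K\<^esub> N'\<^esub> g n"
proof -
  note [simp] = assms lin_closed[OF assms(5)] lin_closed[OF assms(6)]
  have lin: "lin K (M \<boxtimes>\<^bsub>K\<^esub> N) (M' \<boxtimes>\<^bsub>K\<^esub> N')
      (\<lambda>t. sw K (M' \<boxtimes>\<^bsub>K\<^esub> N') M N t (\<lambda>m n. f m \<otimes>\<^bsub>M' \<boxtimes>\<^bsub>K\<^esub> N'\<^esub> g n))"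
    by simp
  have eq: "tensor_map K M N M' N' f g = (\<lambda>t\<in>carrier (M \<boxtimes>\<^bsub>K\<^esub> N).
      sw K (M' \<boxtimes>\<^bsub>K\<^esub> N') M N t (\<lambda>m n. f m \<otimes>\<^bsub>M' \<boxtimes>\<^bsub>K\<^esub> N'\<^esub> g n))"
    unfolding tensor_map_def by (intro restrict_ext) (simp add: sweedler_eq_sw)
  show "tensor_map K M N M' N' f g \<in> linear_maps K (M \<boxtimes>\<^bsub>K\<^esub> N) (M' \<boxtimes>\<^bsub>K\<^esub> N')"
    unfolding eq by (rule linear_maps_restrict[OF _ lin]) simp
  show "tensor_map K M N M' N' f g (m \<otimes>\<^bsub>M \<boxtimes>\<^bsub>K\<^esub> N\<^esub> n) = f m \<otimes>\<^bsub>M' \<boxtimes>\<^bsub>K\<^esub> N'\<^esub> g n"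
    if "m \<in> carrier M" "n \<in> carrier N"
    using that by (simp add: eq)
qed

lemma tensor_map_sw:
  assumes "Module.module K M" "Module.module K N" "Module.module K M'" "Module.module K N'"
    and "t \<in> carrier (M \<boxtimes>\<^bsub>K\<^esub> N)"
  shows "tensor_map K M N M' N' f g t = sw K (M' \<boxtimes>\<^bsub>K\<^esub> N') M N t (\<lambda>m n. f m \<otimes>\<^bsub>M' \<boxtimes>\<^bsub>K\<^esub> N'\<^esub> g n)"
  using assms by (simp add: tensor_map_def sweedler_eq_sw)

lemma compose_linear_maps:
  assumes "Module.module K M" "f \<in> linear_maps K M N" "g \<in> linear_maps K N P"
  shows "compose (carrier M) g f \<in> linear_maps K M P"
  unfolding compose_def
  by (rule linear_maps_restrict[OF assms(1)]) (use assms(2,3) in \<open>auto simp: linear_maps_lin intro: lin_comp\<close>)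

lemma id_linear_maps: "Module.module K M \<Longrightarrow> (\<lambda>m\<in>carrier M. m) \<in> linear_maps K M M"
  by (rule linear_maps_restrict) simp_all

lemma linear_maps_eqI:
  assumes "f \<in> linear_maps K M P" "g \<in> linear_maps K M Q" "\<forall>x\<in>carrier M. f x = g x"
  shows "f = g"
  using assms by (auto simp: linear_maps_lin intro: extensionalityI)

text \<open>Fixing the last factor leaves linear maps on the first two, so \<open>tensor_ext\<close>
  applies twice.\<close>

lemma tensor3_ext:
  assumes [simp]: "Module.module K M" "Module.module K N" "Module.module K Q" "Module.module K P"
    and f: "lin K ((M \<boxtimes>\<^bsub>K\<^esub> N) \<boxtimes>\<^bsub>K\<^esub> Q) P f" and g: "lin K ((M \<boxtimes>\<^bsub>K\<^esub> N) \<boxtimes>\<^bsub>K\<^esub> Q) P g"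
    and eq: "\<And>m n q. m \<in> carrier M \<Longrightarrow> n \<in> carrier N \<Longrightarrow> q \<in> carrier Q \<Longrightarrow>
      f ((m \<otimes>\<^bsub>M \<boxtimes>\<^bsub>K\<^esub> N\<^esub> n) \<otimes>\<^bsub>(M \<boxtimes>\<^bsub>K\<^esub> N) \<boxtimes>\<^bsub>K\<^esub> Q\<^esub> q) =
      g ((m \<otimes>\<^bsub>M \<boxtimes>\<^bsub>K\<^esub> N\<^esub> n) \<otimes>\<^bsub>(M \<boxtimes>\<^bsub>K\<^esub> N) \<boxtimes>\<^bsub>K\<^esub> Q\<^esub> q)"
  shows "\<forall>t\<in>carrier ((M \<boxtimes>\<^bsub>K\<^esub> N) \<boxtimes>\<^bsub>K\<^esub> Q). f t = g t"
proof (rule tensor_ext[OF _ _ _ f g])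
  fix t q assume t: "t \<in> carrier (M \<boxtimes>\<^bsub>K\<^esub> N)" and q [simp]: "q \<in> carrier Q"
  have "\<forall>t\<in>carrier (M \<boxtimes>\<^bsub>K\<^esub> N). f (t \<otimes>\<^bsub>(M \<boxtimes>\<^bsub>K\<^esub> N) \<boxtimes>\<^bsub>K\<^esub> Q\<^esub> q) = g (t \<otimes>\<^bsub>(M \<boxtimes>\<^bsub>K\<^esub> N) \<boxtimes>\<^bsub>K\<^esub> Q\<^esub> q)"
    by (rule tensor_ext[where P = P]) (simp_all add: eq lin_comp[OF _ f] lin_comp[OF _ g])
  then show "f (t \<otimes>\<^bsub>(M \<boxtimes>\<^bsub>K\<^esub> N) \<boxtimes>\<^bsub>K\<^esub> Q\<^esub> q) = g (t \<otimes>\<^bsub>(M \<boxtimes>\<^bsub>K\<^esub> N) \<boxtimes>\<^bsub>K\<^esub> Q\<^esub> q)" using t by blast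
qed simp_all

lemma tensor3_right_ext:
  assumes [simp]: "Module.module K M" "Module.module K N" "Module.module K Q" "Module.module K P"
    and f: "lin K (M \<boxtimes>\<^bsub>K\<^esub> (N \<boxtimes>\<^bsub>K\<^esub> Q)) P f" and g: "lin K (M \<boxtimes>\<^bsub>K\<^esub> (N \<boxtimes>\<^bsub>K\<^esub> Q)) P g"
    and eq: "\<And>m n q. m \<in> carrier M \<Longrightarrow> n \<in> carrier N \<Longrightarrow> q \<in> carrier Q \<Longrightarrow>
      f (m \<otimes>\<^bsub>M \<boxtimes>\<^bsub>K\<^esub> (N \<boxtimes>\<^bsub>K\<^esub> Q)\<^esub> (n \<otimes>\<^bsub>N \<boxtimes>\<^bsub>K\<^esub> Q\<^esub> q)) = g (m \<otimes>\<^bsub>M \<boxtimes>\<^bsub>K\<^esub> (N \<boxtimes>\<^bsub>K\<^esub> Q)\<^esub> (n \<otimes>\<^bsub>N \<boxtimes>\<^bsub>K\<^esub> Q\<^esub> q))"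
  shows "\<forall>t\<in>carrier (M \<boxtimes>\<^bsub>K\<^esub> (N \<boxtimes>\<^bsub>K\<^esub> Q)). f t = g t"
proof (rule tensor_ext[OF _ _ _ f g])
  fix m t assume m [simp]: "m \<in> carrier M" and t: "t \<in> carrier (N \<boxtimes>\<^bsub>K\<^esub> Q)"
  have "\<forall>t\<in>carrier (N \<boxtimes>\<^bsub>K\<^esub> Q). f (m \<otimes>\<^bsub>M \<boxtimes>\<^bsub>K\<^esub> (N \<boxtimes>\<^bsub>K\<^esub> Q)\<^esub> t) = g (m \<otimes>\<^bsub>M \<boxtimes>\<^bsub>K\<^esub> (N \<boxtimes>\<^bsub>K\<^esub> Q)\<^esub> t)"
    by (rule tensor_ext[where P = P]) (simp_all add: eq lin_comp[OF _ f] lin_comp[OF _ g])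
  then show "f (m \<otimes>\<^bsub>M \<boxtimes>\<^bsub>K\<^esub> (N \<boxtimes>\<^bsub>K\<^esub> Q)\<^esub> t) = g (m \<otimes>\<^bsub>M \<boxtimes>\<^bsub>K\<^esub> (N \<boxtimes>\<^bsub>K\<^esub> Q)\<^esub> t)" using t by blast
qed simp_all

lemma tensor4_ext:
  assumes [simp]: "Module.module K M" "Module.module K N" "Module.module K Q" "Module.module K R" "Module.module K P"
    and f: "lin K (((M \<boxtimes>\<^bsub>K\<^esub> N) \<boxtimes>\<^bsub>K\<^esub> Q) \<boxtimes>\<^bsub>K\<^esub> R) P f" and g: "lin K (((M \<boxtimes>\<^bsub>K\<^esub> N) \<boxtimes>\<^bsub>K\<^esub> Q) \<boxtimes>\<^bsub>K\<^esub> R) P g"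
    and eq: "\<And>m n q r. m \<in> carrier M \<Longrightarrow> n \<in> carrier N \<Longrightarrow> q \<in> carrier Q \<Longrightarrow> r \<in> carrier R \<Longrightarrow>
      f (((m \<otimes>\<^bsub>M \<boxtimes>\<^bsub>K\<^esub> N\<^esub> n) \<otimes>\<^bsub>(M \<boxtimes>\<^bsub>K\<^esub> N) \<boxtimes>\<^bsub>K\<^esub> Q\<^esub> q) \<otimes>\<^bsub>((M \<boxtimes>\<^bsub>K\<^esub> N) \<boxtimes>\<^bsub>K\<^esub> Q) \<boxtimes>\<^bsub>K\<^esub> R\<^esub> r) =
      g (((m \<otimes>\<^bsub>M \<boxtimes>\<^bsub>K\<^esub> N\<^esub> n) \<otimes>\<^bsub>(M \<boxtimes>\<^bsub>K\<^esub> N) \<boxtimes>\<^bsub>K\<^esub> Q\<^esub> q) \<otimes>\<^bsub>((M \<boxtimes>\<^bsub>K\<^esub> N) \<boxtimes>\<^bsub>K\<^esub> Q) \<boxtimes>\<^bsub>K\<^esub> R\<^esub> r)"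
  shows "\<forall>t\<in>carrier (((M \<boxtimes>\<^bsub>K\<^esub> N) \<boxtimes>\<^bsub>K\<^esub> Q) \<boxtimes>\<^bsub>K\<^esub> R). f t = g t"
proof (rule tensor_ext[OF _ _ _ f g])
  let ?T = "(M \<boxtimes>\<^bsub>K\<^esub> N) \<boxtimes>\<^bsub>K\<^esub> Q"
  fix t r assume t: "t \<in> carrier ?T" and r [simp]: "r \<in> carrier R"
  have "\<forall>t\<in>carrier ?T. f (t \<otimes>\<^bsub>?T \<boxtimes>\<^bsub>K\<^esub> R\<^esub> r) = g (t \<otimes>\<^bsub>?T \<boxtimes>\<^bsub>K\<^esub> R\<^esub> r)"
    by (rule tensor3_ext[where P = P]) (simp_all add: eq lin_comp[OF _ f] lin_comp[OF _ g])
  then show "f (t \<otimes>\<^bsub>?T \<boxtimes>\<^bsub>K\<^esub> R\<^esub> r) = g (t \<otimes>\<^bsub>?T \<boxtimes>\<^bsub>K\<^esub> R\<^esub> r)" using t by blast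
qed simp_all

lemma linear_maps_sw:
  assumes "f \<in> linear_maps K S T" "Module.module K S" "Module.module K T"
    "Module.module K A" "Module.module K B" "t \<in> carrier (A \<boxtimes>\<^bsub>K\<^esub> B)"
      "\<And>a b. a \<in> carrier A \<Longrightarrow> b \<in> carrier B \<Longrightarrow> F a b \<in> carrier S"
  shows "f (sw K S A B t F) = sw K T A B t (\<lambda>a b. f (F a b))"
  using assms by (intro sw_lin) (simp_all add: linear_maps_lin)

lemma linear_maps_closed: "f \<in> linear_maps K S T \<Longrightarrow> x \<in> carrier S \<Longrightarrow> f x \<in> carrier T"
  by (auto simp: linear_maps_lin intro: lin_closed)

lemma linear_maps_comp: "f \<in> linear_maps K S T \<Longrightarrow> lin K X S g \<Longrightarrow> lin K X T (\<lambda>x. f (g x))"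
  by (auto simp: linear_maps_lin intro: lin_comp)

lemma lin_restrict_id [simp]:
  assumes "Module.module K M"
  shows "lin K M M (\<lambda>m\<in>carrier M. m)"
  using linear_maps_restrict[OF assms lin_id] by (simp add: linear_maps_lin)

lemma compose_apply [simp]: "x \<in> A \<Longrightarrow> compose A g f x = g (f x)"
  by (simp add: compose_def)

lemma compose_eqI: "(\<forall>x\<in>A. g (f x) = g' (f' x)) \<Longrightarrow> compose A g f = compose A g' f'"
  by (auto simp: compose_def)

text \<open>These are the four rules by which a structure map is evaluated automatically: linearity
  in a parameter, closure, value on pure tensors, and passage through a Sweedler sum. The
  associator, its inverse and the braiding receive the same four below.\<close>

lemma tensor_map_simps [simp]:
  assumes "Module.module K M" "Module.module K N" "Module.module K M'" "Module.module K N'"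
    and "lin K M M' f" "lin K N N' g"
  shows "lin K X (M \<boxtimes>\<^bsub>K\<^esub> N) h \<Longrightarrow> lin K X (M' \<boxtimes>\<^bsub>K\<^esub> N') (\<lambda>x. tensor_map K M N M' N' f g (h x))"
    and "x \<in> carrier (M \<boxtimes>\<^bsub>K\<^esub> N) \<Longrightarrow> tensor_map K M N M' N' f g x \<in> carrier (M' \<boxtimes>\<^bsub>K\<^esub> N')"
    and "m \<in> carrier M \<Longrightarrow> n \<in> carrier N \<Longrightarrow>
      tensor_map K M N M' N' f g (m \<otimes>\<^bsub>M \<boxtimes>\<^bsub>K\<^esub> N\<^esub> n) = f m \<otimes>\<^bsub>M' \<boxtimes>\<^bsub>K\<^esub> N'\<^esub> g n"
    and "Module.module K Y \<Longrightarrow> Module.module K Z \<Longrightarrow> s \<in> carrier (Y \<boxtimes>\<^bsub>K\<^esub> Z) \<Longrightarrow>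
      (\<And>a b. a \<in> carrier Y \<Longrightarrow> b \<in> carrier Z \<Longrightarrow> F a b \<in> carrier (M \<boxtimes>\<^bsub>K\<^esub> N)) \<Longrightarrow>
      tensor_map K M N M' N' f g (sw K (M \<boxtimes>\<^bsub>K\<^esub> N) Y Z s F) =
      sw K (M' \<boxtimes>\<^bsub>K\<^esub> N') Y Z s (\<lambda>a b. tensor_map K M N M' N' f g (F a b))"
  using assms lin_tensor_map[OF assms]
  by (simp_all add: linear_maps_closed linear_maps_comp linear_maps_sw)

section \<open>Scalars inside Sweedler sums\<close>

lemma smult_left_commute:
  assumes "Module.module K P" "a \<in> carrier K" "b \<in> carrier K" "p \<in> carrier P"
  shows "a \<odot>\<^bsub>P\<^esub> (b \<odot>\<^bsub>P\<^esub> p) = b \<odot>\<^bsub>P\<^esub> (a \<odot>\<^bsub>P\<^esub> p)"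
proof -
  interpret P: Module.module K P by fact
  show ?thesis using assms(2-4) by (simp add: P.smult_assoc1[symmetric] P.m_comm)
qed

lemma lin_smult_right [simp]:
  assumes P: "Module.module K P" and a: "a \<in> carrier K" and g: "lin K X P g"
  shows "lin K X P (\<lambda>x. a \<odot>\<^bsub>P\<^esub> g x)"
proof -
  interpret P: Module.module K P by fact
  have "lin K P P (\<lambda>x. a \<odot>\<^bsub>P\<^esub> x)"
    using a by (intro linI) (simp_all add: P.smult_r_distr P.smult_assoc1[symmetric] P.m_comm)
  from lin_comp[OF g this] show ?thesis .
qed

lemma lin_smult_left [simp]:
  assumes P: "Module.module K P" and p: "p \<in> carrier P" and g: "lin K X (self_module K) g"
  shows "lin K X P (\<lambda>x. g x \<odot>\<^bsub>P\<^esub> p)"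
proof -
  interpret P: Module.module K P by fact
  have "lin K (self_module K) P (\<lambda>a. a \<odot>\<^bsub>P\<^esub> p)"
    using p by (intro linI) (simp_all add: P.smult_l_distr P.smult_assoc1)
  from lin_comp[OF g this] show ?thesis .
qed

lemma smult_sw [simp]:
  fixes P :: "('k, 'p) module"
  assumes "Module.module K P" "Module.module K A" "Module.module K B" "a \<in> carrier K" "t \<in> carrier (A \<boxtimes>\<^bsub>K\<^esub> B)"
    "\<And>x y. x \<in> carrier A \<Longrightarrow> y \<in> carrier B \<Longrightarrow> f x y \<in> carrier P"
  shows "a \<odot>\<^bsub>P\<^esub> sw K P A B t f = sw K P A B t (\<lambda>x y. a \<odot>\<^bsub>P\<^esub> f x y)"
  using assms by (intro sw_lin[where g = "\<lambda>x. a \<odot>\<^bsub>P\<^esub> x"]) (simp_all add: module.smult_closed)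

lemma sw_smult [simp]:
  fixes P :: "('k, 'p) module"
  assumes "Module.module K P" "Module.module K A" "Module.module K B" "a \<in> carrier K" "t \<in> carrier (A \<boxtimes>\<^bsub>K\<^esub> B)"
    "bilin K A B P f"
  shows "sw K P A B (a \<odot>\<^bsub>A \<boxtimes>\<^bsub>K\<^esub> B\<^esub> t) f = a \<odot>\<^bsub>P\<^esub> sw K P A B t f"
  using assms by (intro lin_smult[OF sw_lin_arg])

lemma smult_pure_tensor_left [simp]:
  assumes "Module.module K A" "Module.module K B" "c \<in> carrier K" "x \<in> carrier A" "y \<in> carrier B"
  shows "(c \<odot>\<^bsub>A\<^esub> x) \<otimes>\<^bsub>A \<boxtimes>\<^bsub>K\<^esub> B\<^esub> y = c \<odot>\<^bsub>A \<boxtimes>\<^bsub>K\<^esub> B\<^esub> (x \<otimes>\<^bsub>A \<boxtimes>\<^bsub>K\<^esub> B\<^esub> y)"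
  using assms by (simp add: smult_pure_tensor)

lemma smult_pure_tensor_right [simp]:
  assumes "Module.module K A" "Module.module K B" "c \<in> carrier K" "x \<in> carrier A" "y \<in> carrier B"
  shows "x \<otimes>\<^bsub>A \<boxtimes>\<^bsub>K\<^esub> B\<^esub> (c \<odot>\<^bsub>B\<^esub> y) = c \<odot>\<^bsub>A \<boxtimes>\<^bsub>K\<^esub> B\<^esub> (x \<otimes>\<^bsub>A \<boxtimes>\<^bsub>K\<^esub> B\<^esub> y)"
  using assms by (simp add: pure_tensor_balanced[symmetric])

lemma sweedler_self_module: "sweedler (self_module K) t f = sweedler K t f"
  by (simp add: sweedler_def)

section \<open>Full embeddings\<close>

text \<open>Two inverses \<open>g\<close> and \<open>g'\<close> of \<open>f\<close> agree by
  evaluating the triple composite of \<open>g\<close>, \<open>f\<close> and \<open>g'\<close> in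
  both bracketings, so the definite description is determined by any inverse at hand.\<close>

lemma inv_arrow_eq:
  assumes C: "category C" and f: "f \<in> arr C" and g: "inverse_arrow C f g"
  shows "inv_arrow C f = g"
  unfolding inv_arrow_def
proof (rule the_equality[where P = "inverse_arrow C f", OF g])
  fix g' assume g': "inverse_arrow C f g'"
  have G: "g \<in> arr C" "dom C g = cod C f" "cod C g = dom C f" "comp C g f = ident C (dom C f)"
    and G': "g' \<in> arr C" "dom C g' = cod C f" "cod C g' = dom C f" "comp C f g' = ident C (cod C f)"
    using g g' by (auto simp: inverse_arrow_def hom_set_def)
  have unit: "\<forall>f\<in>arr C. comp C f (ident C (dom C f)) = f \<and> comp C (ident C (cod C f)) f = f"
    and as: "\<forall>f\<in>arr C. \<forall>g\<in>arr C. \<forall>h\<in>arr C. cod C f = dom C g \<longrightarrow> cod C g = dom C h \<longrightarrow>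
      comp C h (comp C g f) = comp C (comp C h g) f"
    using C unfolding category_def by - (elim conjE, assumption)+
  have "g = comp C g (ident C (dom C g))" using unit G(1) by simp
  also have "\<dots> = comp C g (comp C f g')" using G G' by simp
  also have "\<dots> = comp C (comp C g f) g'" using f G G' by (intro as[rule_format]) simp_all
  also have "\<dots> = comp C (ident C (cod C g')) g'" using G G' by simp
  also have "\<dots> = g'" using unit G' by blast
  finally show "g' = g" by simp
qed

lemma hom_setI: "f \<in> arr C \<Longrightarrow> dom C f = A \<Longrightarrow> cod C f = B \<Longrightarrow> f \<in> hom_set C A B"
  by (simp add: hom_set_def)

lemma hom_setD: "f \<in> hom_set C A B \<Longrightarrow> f \<in> arr C \<and> dom C f = A \<and> cod C f = B"
  by (simp add: hom_set_def)

text \<open>By \<open>arr_C\<close> an arrow of C is recognised by its end objects and its image in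
  D. Closure of C under all operations therefore follows from that of D once \<open>dom\<close>,
  \<open>cod\<close> and \<open>G\<close> of the result are computed, and equations are pulled back
  along the injective \<open>G\<close>. \<open>full\<close> only supplies a candidate arrow, which
  \<open>arr_C\<close> then admits.\<close>

locale full_embedding =
  fixes F :: "'o \<Rightarrow> 'p" and G :: "'m \<Rightarrow> 'n"
    and C :: "('o, 'm, 'y) qbcat_scheme" and D :: "('p, 'n, 'z) qbcat_scheme"
  assumes D: "quasi_braided_pre_tensor_category D"
    and F_obj: "A \<in> obj C \<Longrightarrow> F A \<in> obj D" and F_inj: "inj_on F (obj C)"
    and arr_C: "f \<in> arr C \<longleftrightarrow> dom C f \<in> obj C \<and> cod C f \<in> obj C \<and> G f \<in> arr D"
    and G_inj: "inj_on G (arr C)"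
    and dom_G: "dom D (G f) = F (dom C f)" and cod_G: "cod D (G f) = F (cod C f)"
    and full: "k \<in> hom_set D (F A) (F B) \<Longrightarrow> \<exists>f. dom C f = A \<and> cod C f = B \<and> G f = k"
    and ident_C: "A \<in> obj C \<Longrightarrow> dom C (ident C A) = A \<and> cod C (ident C A) = A \<and> G (ident C A) = ident D (F A)"
    and comp_C: "f \<in> arr C \<Longrightarrow> g \<in> arr C \<Longrightarrow> cod C f = dom C g \<Longrightarrow>
      dom C (comp C g f) = dom C f \<and> cod C (comp C g f) = cod C g \<and> G (comp C g f) = comp D (G g) (G f)"
    and tobj_C: "A \<in> obj C \<Longrightarrow> B \<in> obj C \<Longrightarrow> tobj C A B \<in> obj C \<and> F (tobj C A B) = tobj D (F A) (F B)"
    and tarr_C: "f \<in> arr C \<Longrightarrow> g \<in> arr C \<Longrightarrow>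
      dom C (tarr C f g) = tobj C (dom C f) (dom C g) \<and> cod C (tarr C f g) = tobj C (cod C f) (cod C g) \<and>
      G (tarr C f g) = tarr D (G f) (G g)"
    and assoc_C: "A \<in> obj C \<Longrightarrow> B \<in> obj C \<Longrightarrow> E \<in> obj C \<Longrightarrow>
      dom C (assoc C A B E) = tobj C (tobj C A B) E \<and> cod C (assoc C A B E) = tobj C A (tobj C B E) \<and>
      G (assoc C A B E) = assoc D (F A) (F B) (F E)"
    and braid_C: "A \<in> obj C \<Longrightarrow> B \<in> obj C \<Longrightarrow>
      dom C (braid C A B) = tobj C A B \<and> cod C (braid C A B) = tobj C B A \<and>
      G (braid C A B) = braid D (F A) (F B)"
begin

lemmas D_qb = D[unfolded quasi_braided_pre_tensor_category_def]

lemma D_pre: "pre_tensor_category D"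
  using D_qb by (rule conjunct1)

lemma D_cat: "category D"
  using D_pre unfolding pre_tensor_category_def by (rule conjunct1)

lemma D_category:
  "\<forall>A\<in>obj D. ident D A \<in> hom_set D A A"
  "\<forall>f\<in>arr D. \<forall>g\<in>arr D. cod D f = dom D g \<longrightarrow> g \<cdot>\<^bsub>D\<^esub> f \<in> hom_set D (dom D f) (cod D g)"
  "\<forall>f\<in>arr D. f \<cdot>\<^bsub>D\<^esub> ident D (dom D f) = f \<and> ident D (cod D f) \<cdot>\<^bsub>D\<^esub> f = f"
  "\<forall>f\<in>arr D. \<forall>g\<in>arr D. \<forall>h\<in>arr D. cod D f = dom D g \<longrightarrow> cod D g = dom D h \<longrightarrow>
      h \<cdot>\<^bsub>D\<^esub> (g \<cdot>\<^bsub>D\<^esub> f) = (h \<cdot>\<^bsub>D\<^esub> g) \<cdot>\<^bsub>D\<^esub> f"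
  using D_cat unfolding category_def by - (elim conjE, assumption)+

lemma D_pre_tensor:
  "\<forall>f\<in>arr D. \<forall>g\<in>arr D.
      f \<star>\<star>\<^bsub>D\<^esub> g \<in> hom_set D (dom D f \<star>\<^bsub>D\<^esub> dom D g) (cod D f \<star>\<^bsub>D\<^esub> cod D g)"
  "\<forall>A\<in>obj D. \<forall>B\<in>obj D. ident D A \<star>\<star>\<^bsub>D\<^esub> ident D B = ident D (A \<star>\<^bsub>D\<^esub> B)"
  "\<forall>f\<in>arr D. \<forall>f'\<in>arr D. \<forall>g\<in>arr D. \<forall>g'\<in>arr D.
      cod D f = dom D f' \<longrightarrow> cod D g = dom D g' \<longrightarrow>
      (f' \<cdot>\<^bsub>D\<^esub> f) \<star>\<star>\<^bsub>D\<^esub> (g' \<cdot>\<^bsub>D\<^esub> g) = (f' \<star>\<star>\<^bsub>D\<^esub> g') \<cdot>\<^bsub>D\<^esub> (f \<star>\<star>\<^bsub>D\<^esub> g)"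
  "\<forall>A\<in>obj D. \<forall>B\<in>obj D. \<forall>E\<in>obj D.
      assoc D A B E \<in> hom_set D ((A \<star>\<^bsub>D\<^esub> B) \<star>\<^bsub>D\<^esub> E) (A \<star>\<^bsub>D\<^esub> (B \<star>\<^bsub>D\<^esub> E)) \<and>
      (\<exists>g. inverse_arrow D (assoc D A B E) g)"
  "\<forall>f\<in>arr D. \<forall>g\<in>arr D. \<forall>h\<in>arr D.
      assoc D (cod D f) (cod D g) (cod D h) \<cdot>\<^bsub>D\<^esub> ((f \<star>\<star>\<^bsub>D\<^esub> g) \<star>\<star>\<^bsub>D\<^esub> h) =
      (f \<star>\<star>\<^bsub>D\<^esub> (g \<star>\<star>\<^bsub>D\<^esub> h)) \<cdot>\<^bsub>D\<^esub> assoc D (dom D f) (dom D g) (dom D h)"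
  "\<forall>A\<in>obj D. \<forall>B\<in>obj D. \<forall>E\<in>obj D. \<forall>E'\<in>obj D.
      assoc D A B (E \<star>\<^bsub>D\<^esub> E') \<cdot>\<^bsub>D\<^esub> assoc D (A \<star>\<^bsub>D\<^esub> B) E E' =
      (ident D A \<star>\<star>\<^bsub>D\<^esub> assoc D B E E') \<cdot>\<^bsub>D\<^esub> assoc D A (B \<star>\<^bsub>D\<^esub> E) E' \<cdot>\<^bsub>D\<^esub>
        (assoc D A B E \<star>\<star>\<^bsub>D\<^esub> ident D E')"
  using D_pre unfolding pre_tensor_category_def by - (elim conjE, assumption)+

lemma D_quasi_braided:
  "\<forall>A\<in>obj D. \<forall>B\<in>obj D. braid D A B \<in> hom_set D (A \<star>\<^bsub>D\<^esub> B) (B \<star>\<^bsub>D\<^esub> A)"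
  "\<forall>f\<in>arr D. \<forall>g\<in>arr D.
      braid D (cod D f) (cod D g) \<cdot>\<^bsub>D\<^esub> (f \<star>\<star>\<^bsub>D\<^esub> g) = (g \<star>\<star>\<^bsub>D\<^esub> f) \<cdot>\<^bsub>D\<^esub> braid D (dom D f) (dom D g)"
  "\<forall>U\<in>obj D. \<forall>A\<in>obj D. \<forall>B\<in>obj D.
      assoc D A B U \<cdot>\<^bsub>D\<^esub> braid D U (A \<star>\<^bsub>D\<^esub> B) \<cdot>\<^bsub>D\<^esub> assoc D U A B =
      (ident D A \<star>\<star>\<^bsub>D\<^esub> braid D U B) \<cdot>\<^bsub>D\<^esub> assoc D A U B \<cdot>\<^bsub>D\<^esub> (braid D U A \<star>\<star>\<^bsub>D\<^esub> ident D B)"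
  "\<forall>U\<in>obj D. \<forall>A\<in>obj D. \<forall>B\<in>obj D.
      inv_arrow D (assoc D B U A) \<cdot>\<^bsub>D\<^esub> braid D (U \<star>\<^bsub>D\<^esub> A) B \<cdot>\<^bsub>D\<^esub> inv_arrow D (assoc D U A B) =
      (braid D U B \<star>\<star>\<^bsub>D\<^esub> ident D A) \<cdot>\<^bsub>D\<^esub> inv_arrow D (assoc D U B A) \<cdot>\<^bsub>D\<^esub> (ident D U \<star>\<star>\<^bsub>D\<^esub> braid D A B)"
  using D_qb by - (elim conjE, assumption)+

lemma arrD: "f \<in> arr C \<Longrightarrow> dom C f \<in> obj C" "f \<in> arr C \<Longrightarrow> cod C f \<in> obj C" "f \<in> arr C \<Longrightarrow> G f \<in> arr D"
  using arr_C by blast+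

lemma arr_eqI: "f \<in> arr C \<Longrightarrow> g \<in> arr C \<Longrightarrow> G f = G g \<Longrightarrow> f = g"
  using G_inj by (rule inj_onD) auto

lemma ident_arr:
  assumes "A \<in> obj C"
  shows "ident C A \<in> arr C"
proof -
  have "ident D (F A) \<in> arr D"
    by (rule D_category(1)[rule_format, THEN hom_setD, THEN conjunct1]) (simp add: assms F_obj)
  then show ?thesis using ident_C[OF assms] assms arr_C[of "ident C A"] by simp
qed

lemma comp_arr:
  assumes "f \<in> arr C" "g \<in> arr C" "cod C f = dom C g"
  shows "comp C g f \<in> arr C"
proof -
  have "comp D (G g) (G f) \<in> hom_set D (dom D (G f)) (cod D (G g))"
    using assms by (intro D_category(2)[rule_format]) (simp_all add: arrD dom_G cod_G)
  then show ?thesis using comp_C[OF assms] assms arrD arr_C[of "comp C g f"] by (simp add: hom_set_def)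
qed

lemma tarr_arr:
  assumes "f \<in> arr C" "g \<in> arr C"
  shows "tarr C f g \<in> arr C"
proof -
  have "tarr D (G f) (G g) \<in> arr D"
    by (rule D_pre_tensor(1)[rule_format, THEN hom_setD, THEN conjunct1]) (simp_all add: assms arrD)
  then show ?thesis using tarr_C[OF assms] assms arrD tobj_C arr_C[of "tarr C f g"] by simp
qed

lemma assoc_arr:
  assumes "A \<in> obj C" "B \<in> obj C" "E \<in> obj C"
  shows "assoc C A B E \<in> arr C"
proof -
  have "assoc D (F A) (F B) (F E) \<in> arr D"
    by (rule D_pre_tensor(4)[rule_format, THEN conjunct1, THEN hom_setD, THEN conjunct1])
      (simp_all add: assms F_obj)
  then show ?thesis using assoc_C[OF assms] assms tobj_C arr_C[of "assoc C A B E"] by simp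
qed

lemma braid_arr:
  assumes "A \<in> obj C" "B \<in> obj C"
  shows "braid C A B \<in> arr C"
proof -
  have "braid D (F A) (F B) \<in> arr D"
    by (rule D_quasi_braided(1)[rule_format, THEN hom_setD, THEN conjunct1]) (simp_all add: assms F_obj)
  then show ?thesis using braid_C[OF assms] assms tobj_C arr_C[of "braid C A B"] by simp
qed

lemmas C_arr = ident_arr comp_arr tarr_arr assoc_arr braid_arr arrD
lemmas C_eqs = F_obj ident_C comp_C tobj_C tarr_C assoc_C braid_C dom_G cod_G

lemma category_C: "category C"
  unfolding category_def
proof (intro conjI ballI impI)
  fix f assume f: "f \<in> arr C"
  show "dom C f \<in> obj C" "cod C f \<in> obj C" using f by (simp_all add: arrD)
  have "G f \<cdot>\<^bsub>D\<^esub> ident D (F (dom C f)) = G f" "ident D (F (cod C f)) \<cdot>\<^bsub>D\<^esub> G f = G f"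
    using D_category(3) arrD(3)[OF f] dom_G cod_G by metis+
  then show "f \<cdot>\<^bsub>C\<^esub> ident C (dom C f) = f" "ident C (cod C f) \<cdot>\<^bsub>C\<^esub> f = f"
    using f by (auto intro!: arr_eqI simp: C_arr C_eqs)
  fix g assume g: "g \<in> arr C" "cod C f = dom C g"
  show "g \<cdot>\<^bsub>C\<^esub> f \<in> hom_set C (dom C f) (cod C g)"
    using f g by (intro hom_setI) (simp_all add: C_arr C_eqs)
  fix h assume h: "h \<in> arr C" "cod C g = dom C h"
  have "G h \<cdot>\<^bsub>D\<^esub> (G g \<cdot>\<^bsub>D\<^esub> G f) = (G h \<cdot>\<^bsub>D\<^esub> G g) \<cdot>\<^bsub>D\<^esub> G f"
    using f g h by (intro D_category(4)[rule_format]) (simp_all add: C_arr C_eqs)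
  then show "h \<cdot>\<^bsub>C\<^esub> (g \<cdot>\<^bsub>C\<^esub> f) = (h \<cdot>\<^bsub>C\<^esub> g) \<cdot>\<^bsub>C\<^esub> f"
    using f g h by (intro arr_eqI) (simp_all add: C_arr C_eqs)
next
  fix A assume "A \<in> obj C"
  then show "ident C A \<in> hom_set C A A" by (intro hom_setI) (simp_all add: C_arr C_eqs)
qed

text \<open>The inverse exists in D; fullness gives a preimage, and injectivity of \<open>G\<close>
  makes that preimage an inverse in C.\<close>

lemma inverse_assoc_C:
  assumes ABE: "A \<in> obj C" "B \<in> obj C" "E \<in> obj C"
  obtains g where "inverse_arrow C (assoc C A B E) g" "inverse_arrow D (assoc D (F A) (F B) (F E)) (G g)"
proof -
  let ?a = "assoc C A B E"
  have "\<exists>g'. inverse_arrow D (assoc D (F A) (F B) (F E)) g'"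
    by (rule D_pre_tensor(4)[rule_format, THEN conjunct2]) (simp_all add: ABE F_obj)
  then obtain g' where g': "inverse_arrow D (G ?a) g'"
    using assoc_C[OF ABE] by auto
  then have "g' \<in> hom_set D (F (cod C ?a)) (F (dom C ?a))"
    by (simp add: inverse_arrow_def dom_G cod_G)
  from full[OF this] obtain g where g: "dom C g = cod C ?a" "cod C g = dom C ?a" "G g = g'" by blast
  have a: "?a \<in> arr C" using ABE by (rule assoc_arr)
  have "g' \<in> arr D" using g' by (simp add: inverse_arrow_def hom_set_def)
  then have ga: "g \<in> arr C" using g a by (simp add: arr_C[of g] arrD)
  have i: "ident D (F (dom C ?a)) = comp D g' (G ?a)" "ident D (F (cod C ?a)) = comp D (G ?a) g'"
    using g' by (simp_all add: inverse_arrow_def dom_G cod_G)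
  have "comp C g ?a = ident C (dom C ?a)" "comp C ?a g = ident C (cod C ?a)"
    using a ga g i comp_C[of ?a g] comp_C[of g ?a] ident_C[of "dom C ?a"] ident_C[of "cod C ?a"]
    by (auto intro!: arr_eqI comp_arr ident_arr simp: arrD)
  then have "inverse_arrow C ?a g"
    using ga g by (simp add: inverse_arrow_def hom_set_def)
  then show thesis using that g g' assoc_C[OF ABE] by simp
qed

text \<open>Uniqueness of inverses in both categories identifies the two definite descriptions, as
  needed to transfer the second hexagon.\<close>

lemma inv_arrow_assoc_C:
  assumes "A \<in> obj C" "B \<in> obj C" "E \<in> obj C"
  shows "inv_arrow C (assoc C A B E) \<in> arr C \<and>
    dom C (inv_arrow C (assoc C A B E)) = tobj C A (tobj C B E) \<and>
    cod C (inv_arrow C (assoc C A B E)) = tobj C (tobj C A B) E \<and>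
    G (inv_arrow C (assoc C A B E)) = inv_arrow D (assoc D (F A) (F B) (F E))"
proof -
  obtain g where g: "inverse_arrow C (assoc C A B E) g" "inverse_arrow D (assoc D (F A) (F B) (F E)) (G g)"
    using inverse_assoc_C[OF assms] .
  have a: "assoc C A B E \<in> arr C" using assms by (rule assoc_arr)
  then have "assoc D (F A) (F B) (F E) \<in> arr D" using assoc_C[OF assms] arrD(3)[OF a] by simp
  then have "inv_arrow D (assoc D (F A) (F B) (F E)) = G g" by (rule inv_arrow_eq[OF D_cat _ g(2)])
  moreover have "inv_arrow C (assoc C A B E) = g" by (rule inv_arrow_eq[OF category_C a g(1)])
  ultimately show ?thesis using g(1) assoc_C[OF assms] by (simp add: inverse_arrow_def hom_set_def)
qed

text \<open>Each axiom of D is instantiated at images under \<open>F\<close> and \<open>G\<close>.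
  \<open>C_eqs\<close> rewrites the image of a composite expression as the same expression in the
  images, and \<open>arr_eqI\<close> cancels \<open>G\<close>.\<close>

lemma pre_tensor_category_C: "pre_tensor_category C"
  unfolding pre_tensor_category_def
proof (intro conjI ballI impI category_C)
  fix A B assume AB: "A \<in> obj C" "B \<in> obj C"
  then show "A \<star>\<^bsub>C\<^esub> B \<in> obj C" by (simp add: tobj_C)
  have "ident D (F A) \<star>\<star>\<^bsub>D\<^esub> ident D (F B) = ident D (F A \<star>\<^bsub>D\<^esub> F B)"
    using AB by (intro D_pre_tensor(2)[rule_format] F_obj)
  then show "ident C A \<star>\<star>\<^bsub>C\<^esub> ident C B = ident C (A \<star>\<^bsub>C\<^esub> B)"
    using AB by (intro arr_eqI) (simp_all add: C_arr C_eqs)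
  fix E assume E: "E \<in> obj C"
  show "assoc C A B E \<in> hom_set C ((A \<star>\<^bsub>C\<^esub> B) \<star>\<^bsub>C\<^esub> E) (A \<star>\<^bsub>C\<^esub> (B \<star>\<^bsub>C\<^esub> E))"
    using AB E by (intro hom_setI) (simp_all add: C_arr C_eqs)
  show "\<exists>g. inverse_arrow C (assoc C A B E) g"
    using inverse_assoc_C[OF AB E] by blast
  fix E' assume E': "E' \<in> obj C"
  have "assoc D (F A) (F B) (F E \<star>\<^bsub>D\<^esub> F E') \<cdot>\<^bsub>D\<^esub> assoc D (F A \<star>\<^bsub>D\<^esub> F B) (F E) (F E') =
      (ident D (F A) \<star>\<star>\<^bsub>D\<^esub> assoc D (F B) (F E) (F E')) \<cdot>\<^bsub>D\<^esub> assoc D (F A) (F B \<star>\<^bsub>D\<^esub> F E) (F E') \<cdot>\<^bsub>D\<^esub>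
        (assoc D (F A) (F B) (F E) \<star>\<star>\<^bsub>D\<^esub> ident D (F E'))"
    using AB E E' by (intro D_pre_tensor(6)[rule_format] F_obj)
  then show "assoc C A B (E \<star>\<^bsub>C\<^esub> E') \<cdot>\<^bsub>C\<^esub> assoc C (A \<star>\<^bsub>C\<^esub> B) E E' =
      (ident C A \<star>\<star>\<^bsub>C\<^esub> assoc C B E E') \<cdot>\<^bsub>C\<^esub> assoc C A (B \<star>\<^bsub>C\<^esub> E) E' \<cdot>\<^bsub>C\<^esub>
        (assoc C A B E \<star>\<star>\<^bsub>C\<^esub> ident C E')"
    using AB E E' by (intro arr_eqI) (simp_all add: C_arr C_eqs)
next
  fix f g assume fg: "f \<in> arr C" "g \<in> arr C"
  then show "f \<star>\<star>\<^bsub>C\<^esub> g \<in> hom_set C (dom C f \<star>\<^bsub>C\<^esub> dom C g) (cod C f \<star>\<^bsub>C\<^esub> cod C g)"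
    by (intro hom_setI) (simp_all add: C_arr C_eqs)
  fix h assume h: "h \<in> arr C"
  have "assoc D (cod D (G f)) (cod D (G g)) (cod D (G h)) \<cdot>\<^bsub>D\<^esub> ((G f \<star>\<star>\<^bsub>D\<^esub> G g) \<star>\<star>\<^bsub>D\<^esub> G h) =
      (G f \<star>\<star>\<^bsub>D\<^esub> (G g \<star>\<star>\<^bsub>D\<^esub> G h)) \<cdot>\<^bsub>D\<^esub> assoc D (dom D (G f)) (dom D (G g)) (dom D (G h))"
    using fg h by (intro D_pre_tensor(5)[rule_format] arrD)
  then show "assoc C (cod C f) (cod C g) (cod C h) \<cdot>\<^bsub>C\<^esub> ((f \<star>\<star>\<^bsub>C\<^esub> g) \<star>\<star>\<^bsub>C\<^esub> h) =
      (f \<star>\<star>\<^bsub>C\<^esub> (g \<star>\<star>\<^bsub>C\<^esub> h)) \<cdot>\<^bsub>C\<^esub> assoc C (dom C f) (dom C g) (dom C h)"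
    using fg h by (intro arr_eqI) (simp_all add: C_arr C_eqs)
next
  fix f f' g g' assume arrs: "f \<in> arr C" "f' \<in> arr C" "g \<in> arr C" "g' \<in> arr C"
    "cod C f = dom C f'" "cod C g = dom C g'"
  have "(G f' \<cdot>\<^bsub>D\<^esub> G f) \<star>\<star>\<^bsub>D\<^esub> (G g' \<cdot>\<^bsub>D\<^esub> G g) = (G f' \<star>\<star>\<^bsub>D\<^esub> G g') \<cdot>\<^bsub>D\<^esub> (G f \<star>\<star>\<^bsub>D\<^esub> G g)"
    using arrs by (intro D_pre_tensor(3)[rule_format] arrD) (simp_all add: C_eqs)
  then show "(f' \<cdot>\<^bsub>C\<^esub> f) \<star>\<star>\<^bsub>C\<^esub> (g' \<cdot>\<^bsub>C\<^esub> g) = (f' \<star>\<star>\<^bsub>C\<^esub> g') \<cdot>\<^bsub>C\<^esub> (f \<star>\<star>\<^bsub>C\<^esub> g)"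
    using arrs by (intro arr_eqI) (simp_all add: C_arr C_eqs)
qed

lemma quasi_braided_pre_tensor_category_C: "quasi_braided_pre_tensor_category C"
  unfolding quasi_braided_pre_tensor_category_def
proof (intro conjI ballI pre_tensor_category_C)
  fix A B assume "A \<in> obj C" "B \<in> obj C"
  then show "braid C A B \<in> hom_set C (A \<star>\<^bsub>C\<^esub> B) (B \<star>\<^bsub>C\<^esub> A)"
    by (intro hom_setI) (simp_all add: C_arr C_eqs)
next
  fix f g assume fg: "f \<in> arr C" "g \<in> arr C"
  have "braid D (cod D (G f)) (cod D (G g)) \<cdot>\<^bsub>D\<^esub> (G f \<star>\<star>\<^bsub>D\<^esub> G g) =
      (G g \<star>\<star>\<^bsub>D\<^esub> G f) \<cdot>\<^bsub>D\<^esub> braid D (dom D (G f)) (dom D (G g))"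
    using fg by (intro D_quasi_braided(2)[rule_format] arrD)
  then show "braid C (cod C f) (cod C g) \<cdot>\<^bsub>C\<^esub> (f \<star>\<star>\<^bsub>C\<^esub> g) = (g \<star>\<star>\<^bsub>C\<^esub> f) \<cdot>\<^bsub>C\<^esub> braid C (dom C f) (dom C g)"
    using fg by (intro arr_eqI) (simp_all add: C_arr C_eqs)
next
  fix U A B assume objs: "U \<in> obj C" "A \<in> obj C" "B \<in> obj C"
  have "assoc D (F A) (F B) (F U) \<cdot>\<^bsub>D\<^esub> braid D (F U) (F A \<star>\<^bsub>D\<^esub> F B) \<cdot>\<^bsub>D\<^esub> assoc D (F U) (F A) (F B) =
      (ident D (F A) \<star>\<star>\<^bsub>D\<^esub> braid D (F U) (F B)) \<cdot>\<^bsub>D\<^esub> assoc D (F A) (F U) (F B) \<cdot>\<^bsub>D\<^esub>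
      (braid D (F U) (F A) \<star>\<star>\<^bsub>D\<^esub> ident D (F B))"
    using objs by (intro D_quasi_braided(3)[rule_format] F_obj)
  then show "assoc C A B U \<cdot>\<^bsub>C\<^esub> braid C U (A \<star>\<^bsub>C\<^esub> B) \<cdot>\<^bsub>C\<^esub> assoc C U A B =
      (ident C A \<star>\<star>\<^bsub>C\<^esub> braid C U B) \<cdot>\<^bsub>C\<^esub> assoc C A U B \<cdot>\<^bsub>C\<^esub> (braid C U A \<star>\<star>\<^bsub>C\<^esub> ident C B)"
    using objs by (intro arr_eqI) (simp_all add: C_arr C_eqs)
  have "inv_arrow D (assoc D (F B) (F U) (F A)) \<cdot>\<^bsub>D\<^esub> braid D (F U \<star>\<^bsub>D\<^esub> F A) (F B) \<cdot>\<^bsub>D\<^esub>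
      inv_arrow D (assoc D (F U) (F A) (F B)) =
      (braid D (F U) (F B) \<star>\<star>\<^bsub>D\<^esub> ident D (F A)) \<cdot>\<^bsub>D\<^esub> inv_arrow D (assoc D (F U) (F B) (F A)) \<cdot>\<^bsub>D\<^esub>
      (ident D (F U) \<star>\<star>\<^bsub>D\<^esub> braid D (F A) (F B))"
    using objs by (intro D_quasi_braided(4)[rule_format] F_obj)
  then show "inv_arrow C (assoc C B U A) \<cdot>\<^bsub>C\<^esub> braid C (U \<star>\<^bsub>C\<^esub> A) B \<cdot>\<^bsub>C\<^esub> inv_arrow C (assoc C U A B) =
      (braid C U B \<star>\<star>\<^bsub>C\<^esub> ident C A) \<cdot>\<^bsub>C\<^esub> inv_arrow C (assoc C U B A) \<cdot>\<^bsub>C\<^esub> (ident C U \<star>\<star>\<^bsub>C\<^esub> braid C A B)"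
    using objs by (intro arr_eqI) (simp_all add: C_arr C_eqs inv_arrow_assoc_C)
qed

lemma quasi_braided_pre_tensor_subcategory: "quasi_braided_pre_tensor_subcategory F G C D"
  unfolding quasi_braided_pre_tensor_subcategory_def
  using D quasi_braided_pre_tensor_category_C F_inj G_inj
  by (auto simp: C_eqs arrD)

end

section \<open>The untwisted bialgebra\<close>

locale hom_bialgebra_bij =
  fixes K :: "('k, 'r) ring_scheme" and H :: "('k, 'a) hom_bialg"
  assumes K: "cring K" and H: "hom_bialgebra K H"
    and bij: "bij_betw (halpha H) (carrier (hsp H)) (carrier (hsp H))"
begin

abbreviation (input) tensor_K  (infixr "\<boxtimes>" 70) where
  "M \<boxtimes> N \<equiv> tensor_prod M K N"

abbreviation "V \<equiv> hsp H"
abbreviation "\<alpha> \<equiv> halpha H"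
abbreviation "\<beta> \<equiv> halpha_inv H"

text \<open>
  The structure maps after untwisting: \<open>mul\<close> and \<open>D\<close> for the bialgebra, \<open>L\<close> for the coaction and \<open>pact\<close>
  for the action.
\<close>

definition mul :: "'a univ \<Rightarrow> 'a univ \<Rightarrow> 'a univ" where
  "mul x y = \<beta> (hprod K H x y)"

definition D :: "'a univ \<Rightarrow> 'a univ" where
  "D h = hdelta H (\<beta> h)"

lemmas H_unfolded = H[unfolded hom_bialgebra_def Let_def]

lemma module_V [simp]: "Module.module K V"
  using H_unfolded by blast

lemma module_K [simp]: "Module.module K (self_module K)"
  using K by simp

lemma raw_lin: "lin K (V \<boxtimes> V) V (hmu H)" "lin K V (V \<boxtimes> V) (hdelta H)" "lin K V V \<alpha>"
  using H_unfolded by (simp_all add: linear_maps_lin)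

lemmas H_axioms = H_unfolded[THEN conjunct2, THEN conjunct2, THEN conjunct2, THEN conjunct2]
lemmas raw_alpha_hprod = H_axioms[THEN conjunct1, rule_format]
lemmas raw_hprod_assoc = H_axioms[THEN conjunct2, THEN conjunct1, rule_format]
lemmas raw_hdelta_coassoc = H_axioms[THEN conjunct2, THEN conjunct2, THEN conjunct1, rule_format]
lemmas raw_hdelta_hprod = H_axioms[THEN conjunct2, THEN conjunct2, THEN conjunct2, THEN conjunct1, rule_format]
lemmas raw_hdelta_alpha = H_axioms[THEN conjunct2, THEN conjunct2, THEN conjunct2, THEN conjunct2, rule_format]

lemma beta_lin: "lin K V V \<beta>"
  unfolding halpha_inv_def by (rule lin_inv_into) (simp_all add: raw_lin bij)

lemma D_lin: "lin K V (V \<boxtimes> V) D"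
  unfolding D_def by (rule lin_comp[OF beta_lin raw_lin(2)])

lemmas V_closed [simp] = lin_closed[OF raw_lin(3)] lin_closed[OF beta_lin] lin_closed[OF D_lin]
  lin_closed[OF raw_lin(2)]
text \<open>In composed form these rules peel off one map at a time, until linearity of the identity
  remains.\<close>

lemmas V_lin [simp] = lin_comp[OF _ raw_lin(3)] lin_comp[OF _ beta_lin] lin_comp[OF _ D_lin]

lemma alpha_beta [simp]: "x \<in> carrier V \<Longrightarrow> \<alpha> (\<beta> x) = x"
  and beta_alpha [simp]: "x \<in> carrier V \<Longrightarrow> \<beta> (\<alpha> x) = x"
  using bij by (simp_all add: halpha_inv_def bij_betw_def f_inv_into_f)

lemma hprod_bilin: "bilin K V V V (hprod K H)"
  unfolding hprod_def by (intro bilinI lin_comp[OF _ raw_lin(1)]) simp_all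

lemma mul_bilin: "bilin K V V V mul"
  unfolding mul_def
  by (intro bilinI lin_comp[OF _ beta_lin] bilin_left[OF hprod_bilin] bilin_right[OF hprod_bilin]) simp_all

lemmas mul_closed [simp] = bilin_closed[OF hprod_bilin] bilin_closed[OF mul_bilin]
lemmas mul_lin [simp] = bilin_left[OF hprod_bilin] bilin_right[OF hprod_bilin]
  bilin_left[OF mul_bilin] bilin_right[OF mul_bilin]

text \<open>Together with \<open>hdelta_eq\<close>, \<open>mcoact_eq\<close> and
  \<open>act_eq\<close> this replaces the twisted operations in a raw axiom by untwisted ones,
  leaving explicit twists that the simplifier can cancel.\<close>

lemma hprod_eq: "x \<in> carrier V \<Longrightarrow> y \<in> carrier V \<Longrightarrow> hprod K H x y = \<alpha> (mul x y)"
  by (simp add: mul_def)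

lemma hdelta_eq: "x \<in> carrier V \<Longrightarrow> hdelta H x = D (\<alpha> x)"
  by (simp add: D_def)

lemma alpha_mul [simp]:
  assumes "x \<in> carrier V" "y \<in> carrier V"
  shows "\<alpha> (mul x y) = mul (\<alpha> x) (\<alpha> y)"
proof -
  have "\<alpha> (hprod K H x y) = hprod K H (\<alpha> x) (\<alpha> y)" using assms by (rule raw_alpha_hprod)
  then show ?thesis using assms unfolding mul_def by simp (metis beta_alpha mul_closed(1))
qed

lemma beta_mul [simp]:
  assumes "x \<in> carrier V" "y \<in> carrier V"
  shows "\<beta> (mul x y) = mul (\<beta> x) (\<beta> y)"
  using alpha_mul[of "\<beta> x" "\<beta> y"] assms by (metis V_closed(2) alpha_beta beta_alpha mul_closed(2))

text \<open>Hom-associativity is used at \<beta> applied twice to each argument. A factor of the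
  inner product collects one \<alpha> from each of the two products; the remaining factor gets one
  from the outer product and one from the axiom itself. Both amounts cancel the shift.\<close>

lemma mul_assoc [simp]:
  assumes xyz: "x \<in> carrier V" "y \<in> carrier V" "z \<in> carrier V"
  shows "mul (mul x y) z = mul x (mul y z)"
proof -
  let ?x = "\<beta> (\<beta> x)" and ?y = "\<beta> (\<beta> y)" and ?z = "\<beta> (\<beta> z)"
  have "hprod K H (\<alpha> ?x) (hprod K H ?y ?z) = hprod K H (hprod K H ?x ?y) (\<alpha> ?z)"
    using xyz by (intro raw_hprod_assoc) simp_all
  moreover have "hprod K H (\<alpha> ?x) (hprod K H ?y ?z) = mul x (mul y z)"
    using xyz by (simp add: hprod_eq)
  moreover have "hprod K H (hprod K H ?x ?y) (\<alpha> ?z) = mul (mul x y) z"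
    using xyz by (simp add: hprod_eq)
  ultimately show ?thesis by (simp only:)
qed

lemma sweedler_D:
  assumes "x \<in> carrier V" "Module.module K P"
  shows "sweedler P (D x) f = sw K P V V (D x) f"
  using assms by (simp add: sweedler_eq_sw)

text \<open>Compatibility of \<alpha> with the coproduct, in the form that moves \<alpha> from the
  argument of \<open>D\<close> into the body, where it can meet other twists and cancel.\<close>

lemma sw_D_alpha [simp]:
  fixes P :: "('k, 'p) module"
  assumes x: "x \<in> carrier V" and P: "Module.module K P" and f: "bilin K V V P f"
  shows "sw K P V V (D (\<alpha> x)) f = sw K P V V (D x) (\<lambda>u v. f (\<alpha> u) (\<alpha> v))"
proof -
  note [simp] = P bilin_closed[OF f]
  have "hdelta H (\<alpha> (\<beta> x)) = sweedler (V \<boxtimes> V) (hdelta H (\<beta> x)) (\<lambda>h1 h2. \<alpha> h1 \<otimes>\<^bsub>V \<boxtimes> V\<^esub> \<alpha> h2)"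
    using x by (intro raw_hdelta_alpha) simp_all
  then have "D (\<alpha> x) = sw K (V \<boxtimes> V) V V (D x) (\<lambda>h1 h2. \<alpha> h1 \<otimes>\<^bsub>V \<boxtimes> V\<^esub> \<alpha> h2)"
    using x by (simp add: sweedler_D hdelta_eq)
  then show ?thesis using x f by simp
qed

lemma sw_D_beta [simp]:
  fixes P :: "('k, 'p) module"
  assumes x: "x \<in> carrier V" and P: "Module.module K P" and f: "bilin K V V P f"
  shows "sw K P V V (D (\<beta> x)) f = sw K P V V (D x) (\<lambda>u v. f (\<beta> u) (\<beta> v))"
proof -
  note [simp] = P bilin_closed[OF f]
  have "bilin K V V P (\<lambda>u v. f (\<beta> u) (\<beta> v))"
    by (intro bilinI bilin_left[OF f] bilin_right[OF f]) simp_all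
  then show ?thesis using sw_D_alpha[of "\<beta> x" P "\<lambda>u v. f (\<beta> u) (\<beta> v)"] x by simp
qed

text \<open>Multiplicativity of the coproduct is used at \<beta> applied twice. On the left this
  cancels the \<alpha> of \<open>hprod_eq\<close> and that of \<open>hdelta_eq\<close>; on the right
  the \<beta> left on each leg cancels the \<alpha> of \<open>hprod_eq\<close>.\<close>

lemma sw_D_mul [simp]:
  fixes P :: "('k, 'p) module"
  assumes xy: "x \<in> carrier V" "y \<in> carrier V" and P: "Module.module K P" and f: "bilin K V V P f"
  shows "sw K P V V (D (mul x y)) f =
    sw K P V V (D x) (\<lambda>x1 x2. sw K P V V (D y) (\<lambda>y1 y2. f (mul x1 y1) (mul x2 y2)))"
proof -
  note [simp] = P bilin_closed[OF f]
  note [simp] = bilin_left[OF f] bilin_right[OF f]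
  let ?x = "\<beta> (\<beta> x)" and ?y = "\<beta> (\<beta> y)"
  have "hdelta H (hprod K H ?x ?y) = sweedler (V \<boxtimes> V) (hdelta H ?x) (\<lambda>h1 h2.
      sweedler (V \<boxtimes> V) (hdelta H ?y) (\<lambda>h1' h2'. hprod K H h1 h1' \<otimes>\<^bsub>V \<boxtimes> V\<^esub> hprod K H h2 h2'))"
    using xy by (intro raw_hdelta_hprod) simp_all
  moreover have "hdelta H (hprod K H ?x ?y) = D (mul x y)"
    using xy by (simp add: hdelta_eq hprod_eq)
  moreover have "sweedler (V \<boxtimes> V) (hdelta H ?x) (\<lambda>h1 h2.
      sweedler (V \<boxtimes> V) (hdelta H ?y) (\<lambda>h1' h2'. hprod K H h1 h1' \<otimes>\<^bsub>V \<boxtimes> V\<^esub> hprod K H h2 h2')) =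
    sw K (V \<boxtimes> V) V V (D x) (\<lambda>x1 x2. sw K (V \<boxtimes> V) V V (D y)
      (\<lambda>y1 y2. mul x1 y1 \<otimes>\<^bsub>V \<boxtimes> V\<^esub> mul x2 y2))"
    using xy by (simp add: hdelta_eq hprod_eq sweedler_D)
  ultimately have "D (mul x y) = sw K (V \<boxtimes> V) V V (D x) (\<lambda>x1 x2. sw K (V \<boxtimes> V) V V (D y)
      (\<lambda>y1 y2. mul x1 y1 \<otimes>\<^bsub>V \<boxtimes> V\<^esub> mul x2 y2))"
    by (simp only:)
  then show ?thesis using xy by simp
qed

text \<open>Ordinary coassociativity of \<open>D\<close>, evaluated by an arbitrary trilinear body.
  It comes from Hom-coassociativity at \<beta> h, where \<open>hdelta\<close> becomes
  \<open>D\<close>.\<close>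

lemma D_coassoc:
  fixes P :: "('k, 'p) module"
  assumes h: "h \<in> carrier V" and P: "Module.module K P"
    and f: "\<And>b c. b \<in> carrier V \<Longrightarrow> c \<in> carrier V \<Longrightarrow> lin K V P (\<lambda>a. f a b c)"
      "\<And>a c. a \<in> carrier V \<Longrightarrow> c \<in> carrier V \<Longrightarrow> lin K V P (\<lambda>b. f a b c)"
      "\<And>a b. a \<in> carrier V \<Longrightarrow> b \<in> carrier V \<Longrightarrow> lin K V P (\<lambda>c. f a b c)"
  shows "sw K P V V (D h) (\<lambda>a b. sw K P V V (D b) (f a)) =
    sw K P V V (D h) (\<lambda>a b. sw K P V V (D a) (\<lambda>u v. f u v b))"
proof -
  let ?VV = "V \<boxtimes> V" let ?VVV = "V \<boxtimes> ?VV"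
  note [simp] = P lin_closed[OF f(1)] lin_comp[OF _ f(1)] lin_comp[OF _ f(2)] lin_comp[OF _ f(3)] f
  have "sweedler ?VVV (hdelta H (\<beta> h)) (\<lambda>h1 h2. sweedler ?VVV (hdelta H h1) (\<lambda>h11 h12.
            h11 \<otimes>\<^bsub>?VVV\<^esub> (h12 \<otimes>\<^bsub>?VV\<^esub> \<alpha> h2))) =
          sweedler ?VVV (hdelta H (\<beta> h)) (\<lambda>h1 h2. \<alpha> h1 \<otimes>\<^bsub>?VVV\<^esub> hdelta H h2)"
    using h by (intro raw_hdelta_coassoc) simp_all
  then have *: "sw K ?VVV V V (D h) (\<lambda>h1 h2. sw K ?VVV V V (D h1) (\<lambda>h11 h12.
            \<alpha> h11 \<otimes>\<^bsub>?VVV\<^esub> (\<alpha> h12 \<otimes>\<^bsub>?VV\<^esub> \<alpha> h2))) =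
          sw K ?VVV V V (D h) (\<lambda>h1 h2. \<alpha> h1 \<otimes>\<^bsub>?VVV\<^esub> D (\<alpha> h2))"
    (is "?l = ?r")
    using h by (simp add: sweedler_D hdelta_eq)
  have "sw K P V ?VV ?r
     (\<lambda>a t. sw K P V V t (\<lambda>b c. f (\<beta> a) (\<beta> b) (\<beta> c))) =
     sw K P V V (D h) (\<lambda>a b. sw K P V V (D b) (f a))"
    using h by simp
  moreover have "sw K P V ?VV ?l
     (\<lambda>a t. sw K P V V t (\<lambda>b c. f (\<beta> a) (\<beta> b) (\<beta> c))) =
     sw K P V V (D h) (\<lambda>a b. sw K P V V (D a) (\<lambda>u v. f u v b))"
    using h by simp
  ultimately show ?thesis unfolding * by simp
qed

section \<open>Comodules\<close>

text \<open>Kept polymorphic in the record extension so that plain comodules and Yetter-Drinfeld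
  modules share the facts about coactions.\<close>

definition cobj :: "('k, 'a, 'z) hom_comod_scheme \<Rightarrow> bool" where
  "cobj M \<longleftrightarrow> left_comodule K H M \<and> bij_betw (malpha M) (carrier (msp M)) (carrier (msp M))"

definition L :: "('k, 'a, 'z) hom_comod_scheme \<Rightarrow> 'a univ \<Rightarrow> 'a univ" where
  "L M m = mcoact M (malpha_inv M m)"

lemma cobj_raw:
  assumes "cobj M"
  shows "Module.module K (msp M)"
    and "malpha M \<in> linear_maps K (msp M) (msp M)"
    and "mcoact M \<in> linear_maps K (msp M) (V \<boxtimes> msp M)"
    and "bij_betw (malpha M) (carrier (msp M)) (carrier (msp M))"
    and "\<forall>m\<in>carrier (msp M). tensor_map K V (msp M) V (msp M) \<alpha> (malpha M) (mcoact M m) = mcoact M (malpha M m)"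
    and "\<forall>m\<in>carrier (msp M).
      sweedler (V \<boxtimes> (V \<boxtimes> msp M)) (mcoact M m) (\<lambda>u m0.
        sweedler (V \<boxtimes> (V \<boxtimes> msp M)) (hdelta H u) (\<lambda>u1 u2.
          u1 \<otimes>\<^bsub>V \<boxtimes> (V \<boxtimes> msp M)\<^esub> (u2 \<otimes>\<^bsub>V \<boxtimes> msp M\<^esub> malpha M m0))) =
      sweedler (V \<boxtimes> (V \<boxtimes> msp M)) (mcoact M m) (\<lambda>u m0.
        \<alpha> u \<otimes>\<^bsub>V \<boxtimes> (V \<boxtimes> msp M)\<^esub> mcoact M m0)"
  using assms unfolding cobj_def left_comodule_def Let_def by - (elim conjE, assumption)+

lemmas cobj_module [simp] = cobj_raw(1)

lemma cobj_raw_lin: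
  assumes "cobj M"
  shows "lin K (msp M) (msp M) (malpha M)" "lin K (msp M) (V \<boxtimes> msp M) (mcoact M)"
  using cobj_raw(2,3)[OF assms] by (simp_all add: linear_maps_lin)

lemma malpha_inv_lin: "cobj M \<Longrightarrow> lin K (msp M) (msp M) (malpha_inv M)"
  unfolding malpha_inv_def by (rule lin_inv_into) (simp_all add: cobj_raw_lin cobj_raw(4))

lemma L_lin: "cobj M \<Longrightarrow> lin K (msp M) (V \<boxtimes> msp M) (L M)"
  unfolding L_def by (rule lin_comp[OF malpha_inv_lin cobj_raw_lin(2)])

lemma cobj_lin [simp]:
  assumes "cobj M"
  shows "lin K X (msp M) g \<Longrightarrow> lin K X (msp M) (\<lambda>x. malpha M (g x))"
    and "lin K X (msp M) g \<Longrightarrow> lin K X (msp M) (\<lambda>x. malpha_inv M (g x))"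
    and "lin K X (msp M) g \<Longrightarrow> lin K X (V \<boxtimes> msp M) (\<lambda>x. L M (g x))"
  using assms by (auto intro: lin_comp cobj_raw_lin malpha_inv_lin L_lin)

lemma cobj_closed [simp]:
  assumes "cobj M" "m \<in> carrier (msp M)"
  shows "malpha M m \<in> carrier (msp M)" "malpha_inv M m \<in> carrier (msp M)"
    "L M m \<in> carrier (V \<boxtimes> msp M)" "mcoact M m \<in> carrier (V \<boxtimes> msp M)"
  using assms by (auto intro: lin_closed cobj_raw_lin malpha_inv_lin L_lin)

lemma malpha_malpha_inv [simp]:
  assumes "cobj M" "m \<in> carrier (msp M)"
  shows "malpha M (malpha_inv M m) = m" "malpha_inv M (malpha M m) = m"
  using cobj_raw(4)[OF assms(1)] assms(2) by (simp_all add: malpha_inv_def bij_betw_def f_inv_into_f)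

lemma mcoact_eq: "cobj M \<Longrightarrow> m \<in> carrier (msp M) \<Longrightarrow> mcoact M m = L M (malpha M m)"
  by (simp add: L_def)

lemma sweedler_L:
  assumes "cobj M" "m \<in> carrier (msp M)" "Module.module K P"
  shows "sweedler P (L M m) f = sw K P V (msp M) (L M m) f"
  using assms by (simp add: sweedler_eq_sw)

lemma L_malpha:
  assumes M: "cobj M" and m: "m \<in> carrier (msp M)"
  shows "L M (malpha M m) =
    sw K (V \<boxtimes> msp M) V (msp M) (L M m) (\<lambda>u n. \<alpha> u \<otimes>\<^bsub>V \<boxtimes> msp M\<^esub> malpha M n)"
proof -
  have "tensor_map K V (msp M) V (msp M) \<alpha> (malpha M) (mcoact M (malpha_inv M m)) =
      mcoact M (malpha M (malpha_inv M m))"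
    using cobj_raw(5)[OF M] cobj_closed(2)[OF M m] by (rule bspec)
  then show ?thesis using M m by (simp add: mcoact_eq tensor_map_sw)
qed

lemma sw_L_malpha [simp]:
  fixes P :: "('k, 'p) module"
  assumes M: "cobj M" and m: "m \<in> carrier (msp M)" and P: "Module.module K P" and f: "bilin K V (msp M) P f"
  shows "sw K P V (msp M) (L M (malpha M m)) f = sw K P V (msp M) (L M m) (\<lambda>u n. f (\<alpha> u) (malpha M n))"
  using assms bilin_closed[OF f] by (simp add: L_malpha)

lemma sw_L_malpha_inv [simp]:
  fixes P :: "('k, 'p) module"
  assumes M: "cobj M" and m: "m \<in> carrier (msp M)" and P: "Module.module K P" and f: "bilin K V (msp M) P f"
  shows "sw K P V (msp M) (L M (malpha_inv M m)) f = sw K P V (msp M) (L M m) (\<lambda>u n. f (\<beta> u) (malpha_inv M n))"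
proof -
  have "bilin K V (msp M) P (\<lambda>u v. f (\<beta> u) (malpha_inv M v))"
    by (intro bilinI bilin_left[OF f] bilin_right[OF f]) (simp_all add: M)
  then show ?thesis
    using sw_L_malpha[OF M _ P, of "malpha_inv M m" "\<lambda>u v. f (\<beta> u) (malpha_inv M v)"] M m by simp
qed

text \<open>The argument of \<open>D_coassoc\<close> with the last slot in M: the axiom is taken at
  \<open>malpha_inv M m\<close>, and the surplus twists are removed by \<beta>, \<beta> and
  \<open>malpha_inv M\<close>. As a rewrite rule it turns iterated coactions into
  coproducts.\<close>

lemma L_coassoc:
  fixes P :: "('k, 'p) module"
  assumes M: "cobj M" and m: "m \<in> carrier (msp M)" and P: "Module.module K P"
    and f: "\<And>b c. b \<in> carrier V \<Longrightarrow> c \<in> carrier (msp M) \<Longrightarrow> lin K V P (\<lambda>a. f a b c)"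
      "\<And>a c. a \<in> carrier V \<Longrightarrow> c \<in> carrier (msp M) \<Longrightarrow> lin K V P (\<lambda>b. f a b c)"
      "\<And>a b. a \<in> carrier V \<Longrightarrow> b \<in> carrier V \<Longrightarrow> lin K (msp M) P (\<lambda>c. f a b c)"
  shows "sw K P V (msp M) (L M m) (\<lambda>a b. sw K P V (msp M) (L M b) (f a)) =
    sw K P V (msp M) (L M m) (\<lambda>a b. sw K P V V (D a) (\<lambda>u v. f u v b))"
proof -
  let ?VM = "V \<boxtimes> msp M" let ?VVM = "V \<boxtimes> ?VM"
  note [simp] = P M m lin_closed[OF f(1)] lin_comp[OF _ f(1)] lin_comp[OF _ f(2)] lin_comp[OF _ f(3)] f
  have "sweedler ?VVM (mcoact M (malpha_inv M m)) (\<lambda>u m0. sweedler ?VVM (hdelta H u) (\<lambda>u1 u2.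
            u1 \<otimes>\<^bsub>?VVM\<^esub> (u2 \<otimes>\<^bsub>?VM\<^esub> malpha M m0))) =
          sweedler ?VVM (mcoact M (malpha_inv M m)) (\<lambda>u m0. \<alpha> u \<otimes>\<^bsub>?VVM\<^esub> mcoact M m0)"
    using cobj_raw(6)[OF M] cobj_closed(2)[OF M m] by (rule bspec)
  then have *: "sw K ?VVM V (msp M) (L M m) (\<lambda>u m0. sw K ?VVM V V (D u) (\<lambda>u1 u2.
            \<alpha> u1 \<otimes>\<^bsub>?VVM\<^esub> (\<alpha> u2 \<otimes>\<^bsub>?VM\<^esub> malpha M m0))) =
          sw K ?VVM V (msp M) (L M m) (\<lambda>u m0. \<alpha> u \<otimes>\<^bsub>?VVM\<^esub> L M (malpha M m0))"
    (is "?l = ?r")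
    by (simp add: mcoact_eq sweedler_L sweedler_D hdelta_eq)
  have "sw K P V ?VM ?r
     (\<lambda>a t. sw K P V (msp M) t (\<lambda>b c. f (\<beta> a) (\<beta> b) (malpha_inv M c))) =
     sw K P V (msp M) (L M m) (\<lambda>a b. sw K P V (msp M) (L M b) (f a))"
    by simp
  moreover have "sw K P V ?VM ?l
     (\<lambda>a t. sw K P V (msp M) t (\<lambda>b c. f (\<beta> a) (\<beta> b) (malpha_inv M c))) =
     sw K P V (msp M) (L M m) (\<lambda>a b. sw K P V V (D a) (\<lambda>u v. f u v b))"
    by simp
  ultimately show ?thesis unfolding * by simp
qed

text \<open>The untwisting is reversible, so for a new object it is enough to check the untwisted
  comodule axioms.\<close>

lemma cobjI:
  fixes T :: "('k, 'a, 'z) hom_comod_scheme"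
  assumes T [simp]: "Module.module K (msp T)" and "malpha T \<in> linear_maps K (msp T) (msp T)"
    and bij: "bij_betw (malpha T) (carrier (msp T)) (carrier (msp T))"
    and "mcoact T \<in> linear_maps K (msp T) (V \<boxtimes> msp T)"
    and L_malpha: "\<And>m. m \<in> carrier (msp T) \<Longrightarrow> sw K (V \<boxtimes> msp T) V (msp T) (L T m)
        (\<lambda>u n. \<alpha> u \<otimes>\<^bsub>V \<boxtimes> msp T\<^esub> malpha T n) = L T (malpha T m)"
    and L_coassoc: "\<And>m. m \<in> carrier (msp T) \<Longrightarrow>
      sw K (V \<boxtimes> (V \<boxtimes> msp T)) V (msp T) (L T m) (\<lambda>u m0.
        sw K (V \<boxtimes> (V \<boxtimes> msp T)) V V (D u) (\<lambda>u1 u2.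
          u1 \<otimes>\<^bsub>V \<boxtimes> (V \<boxtimes> msp T)\<^esub> (u2 \<otimes>\<^bsub>V \<boxtimes> msp T\<^esub> m0))) =
      sw K (V \<boxtimes> (V \<boxtimes> msp T)) V (msp T) (L T m) (\<lambda>u m0. u \<otimes>\<^bsub>V \<boxtimes> (V \<boxtimes> msp T)\<^esub> L T m0)"
  shows "cobj T"
proof -
  let ?T = "msp T" let ?VT = "V \<boxtimes> ?T" let ?VVT = "V \<boxtimes> ?VT"
  have al: "lin K ?T ?T (malpha T)" and co: "lin K ?T ?VT (mcoact T)"
    using assms by (simp_all add: linear_maps_lin)
  have inv: "lin K ?T ?T (malpha_inv T)"
    unfolding malpha_inv_def by (rule lin_inv_into[OF T al bij])
  have L: "lin K ?T ?VT (L T)" unfolding L_def by (rule lin_comp[OF inv co])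
  note [simp] = lin_comp[OF _ al] lin_comp[OF _ inv] lin_comp[OF _ L]
    lin_closed[OF al] lin_closed[OF inv] lin_closed[OF co] lin_closed[OF L]
  have [simp]: "malpha T (malpha_inv T m) = m" "malpha_inv T (malpha T m) = m" if "m \<in> carrier ?T" for m
    using bij that by (simp_all add: malpha_inv_def bij_betw_def f_inv_into_f)
  have co_eq: "mcoact T m = L T (malpha T m)" if "m \<in> carrier ?T" for m
    using that by (simp add: L_def)
  have sweedler_LT: "sweedler P (L T m) f = sw K P V ?T (L T m) f" if "m \<in> carrier ?T" "Module.module K P"
    for P :: "('k, 'a univ) module" and m f
    using that by (simp add: sweedler_eq_sw)
  have [simp]: "sw K P V ?T (L T (malpha T m)) f = sw K P V ?T (L T m) (\<lambda>u n. f (\<alpha> u) (malpha T n))"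
    if "m \<in> carrier ?T" "Module.module K P" "bilin K V ?T P f" for P :: "('k, 'a univ) module" and m f
    using that bilin_closed[OF that(3)] by (simp add: L_malpha[symmetric])
  have "sweedler ?VVT (mcoact T m) (\<lambda>u m0. sweedler ?VVT (hdelta H u) (\<lambda>u1 u2.
            u1 \<otimes>\<^bsub>?VVT\<^esub> (u2 \<otimes>\<^bsub>?VT\<^esub> malpha T m0))) =
          sweedler ?VVT (mcoact T m) (\<lambda>u m0. \<alpha> u \<otimes>\<^bsub>?VVT\<^esub> mcoact T m0)" if m: "m \<in> carrier ?T" for m
  proof -
    \<comment> \<open>Expressed through \<open>D\<close> and \<open>L\<close>, both sides of the
      Hom-axiom carry two twists in each of the three slots. \<open>?G\<close> inserts exactly
      these, so it maps the untwisted identity to the twisted one.\<close>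
    let ?G = "\<lambda>x. sw K ?VVT V ?VT x (\<lambda>a t. sw K ?VVT V ?T t (\<lambda>b c.
      \<alpha> (\<alpha> a) \<otimes>\<^bsub>?VVT\<^esub> (\<alpha> (\<alpha> b) \<otimes>\<^bsub>?VT\<^esub> malpha T (malpha T c))))"
    have 1: "sweedler ?VVT (mcoact T m) (\<lambda>u m0. sweedler ?VVT (hdelta H u) (\<lambda>u1 u2.
            u1 \<otimes>\<^bsub>?VVT\<^esub> (u2 \<otimes>\<^bsub>?VT\<^esub> malpha T m0))) = ?G (sw K ?VVT V ?T (L T m) (\<lambda>u m0.
         sw K ?VVT V V (D u) (\<lambda>u1 u2. u1 \<otimes>\<^bsub>?VVT\<^esub> (u2 \<otimes>\<^bsub>?VT\<^esub> m0))))"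
      using m by (simp add: co_eq sweedler_LT sweedler_D hdelta_eq)
    have 2: "sweedler ?VVT (mcoact T m) (\<lambda>u m0. \<alpha> u \<otimes>\<^bsub>?VVT\<^esub> mcoact T m0) =
      sw K ?VVT V ?T (L T m) (\<lambda>u m0. \<alpha> (\<alpha> u) \<otimes>\<^bsub>?VVT\<^esub> L T (malpha T (malpha T m0)))"
      using m by (simp add: co_eq sweedler_LT)
    have 3: "L T (malpha T (malpha T m0)) =
       sw K ?VT V ?T (L T m0) (\<lambda>u n. \<alpha> (\<alpha> u) \<otimes>\<^bsub>?VT\<^esub> malpha T (malpha T n))" if "m0 \<in> carrier ?T" for m0
      using that by (simp add: L_malpha[symmetric])
    have 4: "sw K ?VVT V ?T (L T m) (\<lambda>u m0. \<alpha> (\<alpha> u) \<otimes>\<^bsub>?VVT\<^esub> L T (malpha T (malpha T m0))) =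
       ?G (sw K ?VVT V ?T (L T m) (\<lambda>u m0. u \<otimes>\<^bsub>?VVT\<^esub> L T m0))"
      using m by (simp add: 3)
    show ?thesis unfolding 1 2 4 L_coassoc[OF m] ..
  qed
  moreover have "tensor_map K V ?T V ?T \<alpha> (malpha T) (mcoact T m) = mcoact T (malpha T m)"
    if "m \<in> carrier ?T" for m
    using that L_malpha[of "malpha T m"] by (simp add: co_eq tensor_map_sw)
  ultimately show ?thesis
    using assms(1-4) unfolding cobj_def left_comodule_def Let_def by (intro conjI ballI)
qed

section \<open>Yetter-Drinfeld modules\<close>

definition yobj :: "('k, 'a) hom_yd \<Rightarrow> bool" where
  "yobj M \<longleftrightarrow> yetter_drinfeld K H M \<and> bij_betw (malpha M) (carrier (msp M)) (carrier (msp M))"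

definition pact :: "('k, 'a) hom_yd \<Rightarrow> 'a univ \<Rightarrow> 'a univ \<Rightarrow> 'a univ" where
  "pact M h m = malpha_inv M (act K H M h m)"

lemma yobj_cobj [simp]: "yobj M \<Longrightarrow> cobj M"
  by (simp only: yobj_def cobj_def yetter_drinfeld_def)

lemma yobj_raw:
  assumes "yobj M"
  shows "mact M \<in> linear_maps K (V \<boxtimes> msp M) (msp M)"
    and "\<forall>h\<in>carrier V. \<forall>m\<in>carrier (msp M). malpha M (act K H M h m) = act K H M (\<alpha> h) (malpha M m)"
    and "\<forall>h\<in>carrier V. \<forall>h'\<in>carrier V. \<forall>m\<in>carrier (msp M).
      act K H M (\<alpha> h) (act K H M h' m) = act K H M (hprod K H h h') (malpha M m)"
    and "\<forall>h\<in>carrier V. \<forall>m\<in>carrier (msp M).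
        sweedler (V \<boxtimes> msp M) (hdelta H h) (\<lambda>h1 h2. sweedler (V \<boxtimes> msp M) (mcoact M (act K H M h1 m)) (\<lambda>u n.
          hprod K H u (\<alpha> (\<alpha> h2)) \<otimes>\<^bsub>V \<boxtimes> msp M\<^esub> n)) =
        sweedler (V \<boxtimes> msp M) (hdelta H h) (\<lambda>h1 h2. sweedler (V \<boxtimes> msp M) (mcoact M m) (\<lambda>u m0.
          hprod K H (\<alpha> (\<alpha> h1)) (\<alpha> u) \<otimes>\<^bsub>V \<boxtimes> msp M\<^esub> act K H M (\<alpha> h2) m0))"
  using assms unfolding yobj_def yetter_drinfeld_def left_module_def Let_def by - (elim conjE, assumption)+

lemma act_bilin:
  assumes "yobj M"
  shows "bilin K V (msp M) (msp M) (act K H M)"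
proof -
  have "lin K (V \<boxtimes> msp M) (msp M) (mact M)"
    using yobj_raw(1)[OF assms] by (simp add: linear_maps_lin)
  then show ?thesis using assms unfolding act_def by (simp add: lin_comp[OF _ \<open>lin K _ _ (mact M)\<close>])
qed

lemma pact_bilin:
  assumes "yobj M"
  shows "bilin K V (msp M) (msp M) (pact M)"
  using assms unfolding pact_def
  by (simp add: bilin_left[OF act_bilin] bilin_right[OF act_bilin])

lemma pact_closed [simp]:
  assumes "yobj M" "h \<in> carrier V" "m \<in> carrier (msp M)"
  shows "act K H M h m \<in> carrier (msp M)" "pact M h m \<in> carrier (msp M)"
  using bilin_closed[OF act_bilin] bilin_closed[OF pact_bilin] assms by auto

lemma pact_lin [simp]:
  assumes "yobj M"
  shows "lin K X V g \<Longrightarrow> m \<in> carrier (msp M) \<Longrightarrow> lin K X (msp M) (\<lambda>x. pact M (g x) m)"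
    and "lin K X (msp M) g' \<Longrightarrow> h \<in> carrier V \<Longrightarrow> lin K X (msp M) (\<lambda>x. pact M h (g' x))"
  using bilin_left[OF pact_bilin] bilin_right[OF pact_bilin] assms by auto

lemma act_eq:
  assumes "yobj M" "h \<in> carrier V" "m \<in> carrier (msp M)"
  shows "act K H M h m = malpha M (pact M h m)"
  using assms by (simp add: pact_def)

lemma malpha_pact [simp]:
  assumes M: "yobj M" and hm: "h \<in> carrier V" "m \<in> carrier (msp M)"
  shows "malpha M (pact M h m) = pact M (\<alpha> h) (malpha M m)"
proof -
  have "malpha M (act K H M h m) = act K H M (\<alpha> h) (malpha M m)"
    using yobj_raw(2)[OF M] hm by (elim ballE) auto
  then show ?thesis using M hm unfolding pact_def by (metis malpha_malpha_inv pact_closed(1) yobj_cobj)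
qed

lemma malpha_inv_pact [simp]:
  assumes M: "yobj M" and hm: "h \<in> carrier V" "m \<in> carrier (msp M)"
  shows "malpha_inv M (pact M h m) = pact M (\<beta> h) (malpha_inv M m)"
proof -
  have "pact M h m = malpha M (pact M (\<beta> h) (malpha_inv M m))" using M hm by simp
  then show ?thesis using M hm by (simp del: malpha_pact)
qed

text \<open>Shifting every variable back by two twists makes the twists of the axiom cancel, as in
  \<open>mul_assoc\<close>. The orientation collapses iterated actions into the action of one
  product.\<close>

lemma pact_pact [simp]:
  assumes M: "yobj M" and hm: "h \<in> carrier V" "k \<in> carrier V" "m \<in> carrier (msp M)"
  shows "pact M h (pact M k m) = pact M (mul h k) m"
proof -
  let ?m = "malpha_inv M (malpha_inv M m)"
  have "act K H M (\<alpha> (\<beta> (\<beta> h))) (act K H M (\<beta> (\<beta> k)) ?m) =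
      act K H M (hprod K H (\<beta> (\<beta> h)) (\<beta> (\<beta> k))) (malpha M ?m)"
    by (rule yobj_raw(3)[rule_format, OF M]) (simp_all add: hm M)
  moreover have "act K H M (\<alpha> (\<beta> (\<beta> h))) (act K H M (\<beta> (\<beta> k)) ?m) = pact M h (pact M k m)"
    using hm M by (simp add: act_eq)
  moreover have "act K H M (hprod K H (\<beta> (\<beta> h)) (\<beta> (\<beta> k))) (malpha M ?m) = pact M (mul h k) m"
    using hm M by (simp add: act_eq hprod_eq)
  ultimately show ?thesis by (simp only:)
qed

text \<open>The classical compatibility between action and coaction, with an arbitrary bilinear
  body, so that it can be applied to two adjacent sums inside a longer expression.\<close>

lemma sw_yd:
  fixes P :: "('k, 'p) module"
  assumes M: "yobj M" and hm: "h \<in> carrier V" "m \<in> carrier (msp M)"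
    and P: "Module.module K P" and f: "bilin K V (msp M) P f"
  shows "sw K P V V (D h) (\<lambda>h1 h2. sw K P V (msp M) (L M (pact M h1 m)) (\<lambda>u n. f (mul u h2) n)) =
    sw K P V V (D h) (\<lambda>h1 h2. sw K P V (msp M) (L M m) (\<lambda>u n. f (mul h1 u) (pact M h2 n)))"
proof -
  \<comment> \<open>With these shifts all twists cancel, except for one \<alpha> on the H-factor of
    both sides. Evaluation with \<open>f (\<beta> u) n\<close> removes it at the end.\<close>
  let ?h = "\<beta> (\<beta> (\<beta> h))" and ?m = "malpha_inv M (malpha_inv M m)" and ?VM = "V \<boxtimes> msp M"
  note [simp] = P M bilin_left[OF f] bilin_right[OF f] bilin_closed[OF f]
  have "sweedler ?VM (hdelta H ?h) (\<lambda>h1 h2. sweedler ?VM (mcoact M (act K H M h1 ?m)) (\<lambda>u n.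
          hprod K H u (\<alpha> (\<alpha> h2)) \<otimes>\<^bsub>?VM\<^esub> n)) =
        sweedler ?VM (hdelta H ?h) (\<lambda>h1 h2. sweedler ?VM (mcoact M ?m) (\<lambda>u m0.
          hprod K H (\<alpha> (\<alpha> h1)) (\<alpha> u) \<otimes>\<^bsub>?VM\<^esub> act K H M (\<alpha> h2) m0))"
    by (rule yobj_raw(4)[rule_format, OF M]) (simp_all add: hm)
  moreover have "sweedler ?VM (hdelta H ?h) (\<lambda>h1 h2. sweedler ?VM (mcoact M (act K H M h1 ?m)) (\<lambda>u n.
          hprod K H u (\<alpha> (\<alpha> h2)) \<otimes>\<^bsub>?VM\<^esub> n)) =
      sw K ?VM V V (D h) (\<lambda>h1 h2. sw K ?VM V (msp M) (L M (pact M h1 m)) (\<lambda>u n. mul (\<alpha> u) (\<alpha> h2) \<otimes>\<^bsub>?VM\<^esub> n))"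
    (is "_ = ?l") using hm by (simp add: act_eq hprod_eq hdelta_eq mcoact_eq sweedler_D sweedler_L)
  moreover have "sweedler ?VM (hdelta H ?h) (\<lambda>h1 h2. sweedler ?VM (mcoact M ?m) (\<lambda>u m0.
          hprod K H (\<alpha> (\<alpha> h1)) (\<alpha> u) \<otimes>\<^bsub>?VM\<^esub> act K H M (\<alpha> h2) m0)) =
      sw K ?VM V V (D h) (\<lambda>h1 h2. sw K ?VM V (msp M) (L M m) (\<lambda>u n. mul (\<alpha> h1) (\<alpha> u) \<otimes>\<^bsub>?VM\<^esub> pact M h2 n))"
    (is "_ = ?r") using hm by (simp add: act_eq hprod_eq hdelta_eq mcoact_eq sweedler_D sweedler_L)
  ultimately have *: "?l = ?r"
    by (simp only:)
  have "sw K P V (msp M) ?l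
      (\<lambda>u n. f (\<beta> u) n) =
    sw K P V V (D h) (\<lambda>h1 h2. sw K P V (msp M) (L M (pact M h1 m)) (\<lambda>u n. f (mul u h2) n))"
    using hm by simp
  then show ?thesis unfolding * using hm by simp
qed

lemma yobjI:
  assumes T [simp]: "cobj T" and mact: "mact T \<in> linear_maps K (V \<boxtimes> msp T) (msp T)"
    and mp: "\<And>h m. h \<in> carrier V \<Longrightarrow> m \<in> carrier (msp T) \<Longrightarrow> malpha T (pact T h m) = pact T (\<alpha> h) (malpha T m)"
    and pp: "\<And>h k m. h \<in> carrier V \<Longrightarrow> k \<in> carrier V \<Longrightarrow> m \<in> carrier (msp T) \<Longrightarrow>
      pact T h (pact T k m) = pact T (mul h k) m"
    and yd: "\<And>h m. h \<in> carrier V \<Longrightarrow> m \<in> carrier (msp T) \<Longrightarrow>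
      sw K (V \<boxtimes> msp T) V V (D h) (\<lambda>h1 h2. sw K (V \<boxtimes> msp T) V (msp T) (L T (pact T h1 m))
        (\<lambda>u n. mul u h2 \<otimes>\<^bsub>V \<boxtimes> msp T\<^esub> n)) =
      sw K (V \<boxtimes> msp T) V V (D h) (\<lambda>h1 h2. sw K (V \<boxtimes> msp T) V (msp T) (L T m)
        (\<lambda>u n. mul h1 u \<otimes>\<^bsub>V \<boxtimes> msp T\<^esub> pact T h2 n))"
  shows "yobj T"
proof -
  let ?T = "msp T" let ?VT = "V \<boxtimes> ?T"
  have al: "lin K ?VT ?T (mact T)" using mact by (simp add: linear_maps_lin)
  have ab: "bilin K V ?T ?T (act K H T)"
    unfolding act_def by (simp add: lin_comp[OF _ al])
  note [simp] = bilin_closed[OF ab]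
  have pb: "bilin K V ?T ?T (pact T)"
    unfolding pact_def by (simp add: bilin_left[OF ab] bilin_right[OF ab])
  note [simp] = bilin_closed[OF pb] bilin_left[OF pb] bilin_right[OF pb] mp pp
  have act_eq: "act K H T h m = malpha T (pact T h m)" if "h \<in> carrier V" "m \<in> carrier ?T" for h m
    using that by (simp add: pact_def del: mp)
  have "malpha T (act K H T h m) = act K H T (\<alpha> h) (malpha T m)"
    if "h \<in> carrier V" "m \<in> carrier ?T" for h m
    using that by (simp add: act_eq)
  moreover have "act K H T (\<alpha> h) (act K H T h' m) = act K H T (hprod K H h h') (malpha T m)"
    if "h \<in> carrier V" "h' \<in> carrier V" "m \<in> carrier ?T" for h h' m
    using that by (simp add: act_eq hprod_eq)
  moreover have "sweedler ?VT (hdelta H h) (\<lambda>h1 h2. sweedler ?VT (mcoact T (act K H T h1 m)) (\<lambda>u n.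
          hprod K H u (\<alpha> (\<alpha> h2)) \<otimes>\<^bsub>?VT\<^esub> n)) =
        sweedler ?VT (hdelta H h) (\<lambda>h1 h2. sweedler ?VT (mcoact T m) (\<lambda>u m0.
          hprod K H (\<alpha> (\<alpha> h1)) (\<alpha> u) \<otimes>\<^bsub>?VT\<^esub> act K H T (\<alpha> h2) m0))"
    if h: "h \<in> carrier V" and m: "m \<in> carrier ?T" for h m
  proof -
    \<comment> \<open>These undo the shifts of \<open>sw_yd\<close>, and \<open>?G\<close> restores
      the \<alpha> on the H-factor that was removed there.\<close>
    let ?h = "\<alpha> (\<alpha> (\<alpha> h))" and ?m = "malpha T (malpha T m)"
    let ?G = "\<lambda>x. sw K ?VT V ?T x (\<lambda>u n. \<alpha> u \<otimes>\<^bsub>?VT\<^esub> n)"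
    have 1: "sweedler ?VT (hdelta H h) (\<lambda>h1 h2. sweedler ?VT (mcoact T (act K H T h1 m)) (\<lambda>u n.
          hprod K H u (\<alpha> (\<alpha> h2)) \<otimes>\<^bsub>?VT\<^esub> n)) =
      ?G (sw K ?VT V V (D ?h) (\<lambda>h1 h2. sw K ?VT V ?T (L T (pact T h1 ?m))
        (\<lambda>u n. mul u h2 \<otimes>\<^bsub>?VT\<^esub> n)))"
      using h m by (simp add: act_eq hprod_eq hdelta_eq mcoact_eq sweedler_D sweedler_L)
    have 2: "sweedler ?VT (hdelta H h) (\<lambda>h1 h2. sweedler ?VT (mcoact T m) (\<lambda>u m0.
          hprod K H (\<alpha> (\<alpha> h1)) (\<alpha> u) \<otimes>\<^bsub>?VT\<^esub> act K H T (\<alpha> h2) m0)) =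
      ?G (sw K ?VT V V (D ?h) (\<lambda>h1 h2. sw K ?VT V ?T (L T ?m)
        (\<lambda>u n. mul h1 u \<otimes>\<^bsub>?VT\<^esub> pact T h2 n)))"
      using h m by (simp add: act_eq hprod_eq hdelta_eq mcoact_eq sweedler_D sweedler_L)
    show ?thesis unfolding 1 2 by (subst yd) (use h m in simp_all)
  qed
  ultimately show ?thesis
    using T mact cobj_raw(1,2,4)[OF T]
    unfolding yobj_def yetter_drinfeld_def left_module_def Let_def cobj_def
    by (intro conjI ballI) (elim conjE, assumption | blast)+
qed

section \<open>Tensor products of Yetter-Drinfeld modules\<close>

lemma yd_tensor_sel [simp]:
  "msp (yd_tensor K H M N) = msp M \<boxtimes> msp N"
  "malpha (yd_tensor K H M N) = tensor_alpha K M N"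
  "mcoact (yd_tensor K H M N) = tensor_coact K H M N"
  "mact (yd_tensor K H M N) = tensor_act K H M N"
  by (simp_all add: yd_tensor_def)

context
  fixes M N :: "('k, 'a) hom_yd"
  assumes M [simp]: "yobj M" and N [simp]: "yobj N"
begin

private abbreviation (input) "T \<equiv> yd_tensor K H M N"
private abbreviation (input) "MN \<equiv> msp M \<boxtimes> msp N"

lemma tensor_alpha_linear:
  "tensor_alpha K M N \<in> linear_maps K MN MN"
  unfolding tensor_alpha_def by (rule lin_tensor_map) simp_all

lemma tensor_alpha_pure [simp]:
  "m \<in> carrier (msp M) \<Longrightarrow> n \<in> carrier (msp N) \<Longrightarrow>
    tensor_alpha K M N (m \<otimes>\<^bsub>MN\<^esub> n) = malpha M m \<otimes>\<^bsub>MN\<^esub> malpha N n"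
  unfolding tensor_alpha_def by (rule lin_tensor_map) simp_all

lemma tensor_alpha_inv:
  defines "g \<equiv> tensor_map K (msp M) (msp N) (msp M) (msp N) (malpha_inv M) (malpha_inv N)"
  shows "bij_betw (tensor_alpha K M N) (carrier MN) (carrier MN)"
    and "x \<in> carrier MN \<Longrightarrow> malpha_inv T x = g x"
proof -
  have g: "lin K MN MN g" "\<And>m n. m \<in> carrier (msp M) \<Longrightarrow> n \<in> carrier (msp N) \<Longrightarrow>
      g (m \<otimes>\<^bsub>MN\<^esub> n) = malpha_inv M m \<otimes>\<^bsub>MN\<^esub> malpha_inv N n"
    using lin_tensor_map[of K "msp M" "msp N" "msp M" "msp N" "malpha_inv M" "malpha_inv N"]
    unfolding g_def linear_maps_lin by simp_all
  have a: "lin K MN MN (tensor_alpha K M N)" using tensor_alpha_linear by (simp add: linear_maps_lin)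
  note [simp] = lin_comp[OF _ a] lin_comp[OF _ g(1)] g(2) lin_closed[OF a] lin_closed[OF g(1)]
  have 1: "\<forall>x\<in>carrier MN. tensor_alpha K M N (g x) = x"
    by (rule tensor_ext[where P = MN]) simp_all
  have 2: "\<forall>x\<in>carrier MN. g (tensor_alpha K M N x) = x"
    by (rule tensor_ext[where P = MN]) simp_all
  show bij: "bij_betw (tensor_alpha K M N) (carrier MN) (carrier MN)"
    using 1 2 by (intro bij_betw_byWitness[where f' = g]) auto
  show "malpha_inv T x = g x" if "x \<in> carrier MN"
    using bij 1 that unfolding malpha_inv_def
    by (intro inv_into_f_eq) (auto simp: bij_betw_def)
qed

lemma malpha_inv_tensor_pure [simp]:
  assumes "m \<in> carrier (msp M)" "n \<in> carrier (msp N)"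
  shows "malpha_inv T (m \<otimes>\<^bsub>MN\<^esub> n) = malpha_inv M m \<otimes>\<^bsub>MN\<^esub> malpha_inv N n"
  using assms lin_tensor_map(2)[of K "msp M" "msp N" "msp M" "msp N" "malpha_inv M" "malpha_inv N" m n]
  by (simp add: tensor_alpha_inv(2))

lemma tensor_coact_eq:
  "tensor_coact K H M N = (\<lambda>x\<in>carrier MN. sw K (V \<boxtimes> MN) (msp M) (msp N) x (\<lambda>m n.
     sw K (V \<boxtimes> MN) V (msp M) (L M m) (\<lambda>u m0. sw K (V \<boxtimes> MN) V (msp N) (L N n) (\<lambda>v n0.
       hprod K H (\<alpha> u) (\<alpha> v) \<otimes>\<^bsub>V \<boxtimes> MN\<^esub> (malpha M m0 \<otimes>\<^bsub>MN\<^esub> malpha N n0)))))"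
  unfolding tensor_coact_def Let_def
  by (rule restrict_ext) (simp add: sweedler_eq_sw[of K "msp M" "msp N"] sweedler_L mcoact_eq)

lemma tensor_coact_linear: "tensor_coact K H M N \<in> linear_maps K MN (V \<boxtimes> MN)"
  unfolding tensor_coact_eq by (rule linear_maps_restrict) simp_all

text \<open>The usual codiagonal coaction except for an \<alpha> on the H-factor: passing to
  \<open>L\<close> absorbs the twists of M and N, but the two legs are multiplied by
  \<open>hprod\<close>, which is \<alpha> of \<open>mul\<close>.\<close>

lemma L_tensor_pure:
  assumes "m \<in> carrier (msp M)" "n \<in> carrier (msp N)"
  shows "L T (m \<otimes>\<^bsub>MN\<^esub> n) = sw K (V \<boxtimes> MN) V (msp M) (L M m) (\<lambda>u m0.
    sw K (V \<boxtimes> MN) V (msp N) (L N n) (\<lambda>v n0.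
       mul (\<alpha> u) (\<alpha> v) \<otimes>\<^bsub>V \<boxtimes> MN\<^esub> (m0 \<otimes>\<^bsub>MN\<^esub> n0)))"
  unfolding L_def[of T] using assms by (simp add: tensor_coact_eq hprod_eq)

lemma tensor_lin:
  "lin K MN MN (tensor_alpha K M N)" "lin K MN MN (malpha_inv T)" "lin K MN (V \<boxtimes> MN) (L T)"
proof -
  show a: "lin K MN MN (tensor_alpha K M N)" using tensor_alpha_linear by (simp add: linear_maps_lin)
  show i: "lin K MN MN (malpha_inv T)"
    using lin_inv_into[of K "msp T" "malpha T"] a tensor_alpha_inv(1) unfolding malpha_inv_def yd_tensor_sel by simp
  show "lin K MN (V \<boxtimes> MN) (L T)"
    unfolding L_def yd_tensor_sel using lin_comp[OF i, of _ "tensor_coact K H M N"] tensor_coact_linear by (simp add: linear_maps_lin)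
qed

lemma cobj_yd_tensor [simp]: "cobj T"
proof -
  note [simp] = lin_comp[OF _ tensor_lin(1)] lin_comp[OF _ tensor_lin(3)] lin_closed[OF tensor_lin(1)] lin_closed[OF tensor_lin(3)]
     L_tensor_pure
  have 1: "\<forall>x\<in>carrier MN. sw K (V \<boxtimes> MN) V MN (L T x) (\<lambda>u n. \<alpha> u \<otimes>\<^bsub>V \<boxtimes> MN\<^esub> tensor_alpha K M N n) =
      L T (tensor_alpha K M N x)"
    by (rule tensor_ext[where P = "V \<boxtimes> MN"]) simp_all
  have 2: "\<forall>x\<in>carrier MN. sw K (V \<boxtimes> (V \<boxtimes> MN)) V MN (L T x) (\<lambda>u m0.
        sw K (V \<boxtimes> (V \<boxtimes> MN)) V V (D u) (\<lambda>u1 u2.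
          u1 \<otimes>\<^bsub>V \<boxtimes> (V \<boxtimes> MN)\<^esub> (u2 \<otimes>\<^bsub>V \<boxtimes> MN\<^esub> m0))) =
      sw K (V \<boxtimes> (V \<boxtimes> MN)) V MN (L T x) (\<lambda>u m0. u \<otimes>\<^bsub>V \<boxtimes> (V \<boxtimes> MN)\<^esub> L T m0)"
    (is "\<forall>x\<in>_. ?l x = ?r x")
  \<comment> \<open>By \<open>sw_D_mul\<close> the coproduct of a product splits into coproducts of
    both legs. Exchanging sums places each coproduct next to its own coaction,
    \<open>L_coassoc\<close> is applied in M and in N, and a second exchange restores the
    order.\<close>
  proof (rule tensor_ext[where P = "V \<boxtimes> (V \<boxtimes> MN)"])
    fix m n assume [simp]: "m \<in> carrier (msp M)" "n \<in> carrier (msp N)"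
    let ?P = "V \<boxtimes> (V \<boxtimes> MN)"
    let ?F = "\<lambda>u u' v v' m n. mul (\<alpha> u) (\<alpha> v) \<otimes>\<^bsub>?P\<^esub> (mul (\<alpha> u') (\<alpha> v') \<otimes>\<^bsub>V \<boxtimes> MN\<^esub> (m \<otimes>\<^bsub>MN\<^esub> n))"
    have "?l (m \<otimes>\<^bsub>MN\<^esub> n) =
      sw K ?P V (msp M) (L M m) (\<lambda>u m0. sw K ?P V (msp N) (L N n) (\<lambda>v n0.
        sw K ?P V V (D u) (\<lambda>u1 u2. sw K ?P V V (D v) (\<lambda>v1 v2. ?F u1 u2 v1 v2 m0 n0))))"
      by simp
    also have "\<dots> = sw K ?P V (msp M) (L M m) (\<lambda>u m0. sw K ?P V V (D u) (\<lambda>u1 u2.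
        sw K ?P V (msp N) (L N n) (\<lambda>v n0. sw K ?P V V (D v) (\<lambda>v1 v2. ?F u1 u2 v1 v2 m0 n0))))"
      by (rule sw_body_cong, rule sw_swap) simp_all
    also have "\<dots> = sw K ?P V (msp M) (L M m) (\<lambda>u m0. sw K ?P V (msp M) (L M m0) (\<lambda>u' m00.
        sw K ?P V (msp N) (L N n) (\<lambda>v n0. sw K ?P V (msp N) (L N n0) (\<lambda>v' n00. ?F u u' v v' m00 n00))))"
      by (simp add: L_coassoc)
    also have "\<dots> = sw K ?P V (msp M) (L M m) (\<lambda>u m0. sw K ?P V (msp N) (L N n) (\<lambda>v n0.
        sw K ?P V (msp M) (L M m0) (\<lambda>u' m00. sw K ?P V (msp N) (L N n0) (\<lambda>v' n00. ?F u u' v v' m00 n00))))"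
      by (rule sw_body_cong, rule sw_swap) simp_all
    also have "\<dots> = ?r (m \<otimes>\<^bsub>MN\<^esub> n)"
      by simp
    finally show "?l (m \<otimes>\<^bsub>MN\<^esub> n) = ?r (m \<otimes>\<^bsub>MN\<^esub> n)" .
  qed simp_all
  show ?thesis
    by (rule cobjI) (use 1 2 tensor_coact_linear tensor_alpha_linear tensor_alpha_inv(1) in simp_all)
qed

lemma tensor_act_eq:
  "tensor_act K H M N = (\<lambda>t\<in>carrier (V \<boxtimes> MN). sw K MN V MN t (\<lambda>h x. sw K MN (msp M) (msp N) x (\<lambda>m n.
     sw K MN V V (D h) (\<lambda>h1 h2. malpha M (pact M (\<beta> h1) m) \<otimes>\<^bsub>MN\<^esub> malpha N (pact N (\<beta> h2) n)))))"
  unfolding tensor_act_def Let_def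
  by (rule restrict_ext) (simp add: sweedler_eq_sw[of K V MN] sweedler_eq_sw[of K "msp M" "msp N"] hdelta_eq sweedler_D act_eq)

lemma tensor_act_linear: "tensor_act K H M N \<in> linear_maps K (V \<boxtimes> MN) MN"
  unfolding tensor_act_eq by (rule linear_maps_restrict) simp_all

text \<open>In the definition each leg is hit by \<beta> twice, while \<open>hdelta_eq\<close>
  contributes one \<alpha>; so one \<beta> survives on each leg of \<open>D h\<close>.\<close>

lemma pact_tensor_pure [simp]:
  assumes "h \<in> carrier V" "m \<in> carrier (msp M)" "n \<in> carrier (msp N)"
  shows "pact T h (m \<otimes>\<^bsub>MN\<^esub> n) = sw K MN V V (D h) (\<lambda>h1 h2. pact M (\<beta> h1) m \<otimes>\<^bsub>MN\<^esub> pact N (\<beta> h2) n)"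
proof -
  have "act K H T h (m \<otimes>\<^bsub>MN\<^esub> n) = sw K MN V V (D h) (\<lambda>h1 h2.
      malpha M (pact M (\<beta> h1) m) \<otimes>\<^bsub>MN\<^esub> malpha N (pact N (\<beta> h2) n))"
    unfolding act_def by (simp add: assms tensor_act_eq)
  moreover have "malpha_inv T (sw K MN V V (D h) (\<lambda>h1 h2. malpha M (pact M (\<beta> h1) m) \<otimes>\<^bsub>MN\<^esub> malpha N (pact N (\<beta> h2) n)))
     = sw K MN V V (D h) (\<lambda>h1 h2. malpha_inv T (malpha M (pact M (\<beta> h1) m) \<otimes>\<^bsub>MN\<^esub> malpha N (pact N (\<beta> h2) n)))"
    by (rule sw_lin[where g = "malpha_inv T"])
      (use assms tensor_lin(2) in simp_all)
  ultimately show ?thesis unfolding pact_def[of T] using assms by (simp del: malpha_pact)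
qed

lemma tensor_act_bilin: "bilin K V MN MN (act K H T)" "bilin K V MN MN (pact T)"
proof -
  have al: "lin K (V \<boxtimes> MN) MN (tensor_act K H M N)"
    using tensor_act_linear by (simp add: linear_maps_lin)
  show ab: "bilin K V MN MN (act K H T)"
    unfolding act_def yd_tensor_sel by (simp add: lin_comp[OF _ al])
  show "bilin K V MN MN (pact T)"
    unfolding pact_def
    by (simp add: lin_comp[OF bilin_left[OF ab] tensor_lin(2)] lin_comp[OF bilin_right[OF ab] tensor_lin(2)])
qed

lemma yobj_yd_tensor: "yobj T"
proof -
  note pb = tensor_act_bilin(2)
  note a = tensor_lin(1) and L = tensor_lin(3)
  note [simp] = lin_comp[OF _ a] lin_comp[OF _ L] lin_closed[OF a] lin_closed[OF L]
     L_tensor_pure bilin_left[OF pb] bilin_right[OF pb] bilin_closed[OF pb]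
  have pull [simp]: "pact T h (sw K MN A B t f) = sw K MN A B t (\<lambda>a b. pact T h (f a b))"
    if "h \<in> carrier V" "Module.module K A" "Module.module K B" "t \<in> carrier (A \<boxtimes> B)"
      "\<And>a b. a \<in> carrier A \<Longrightarrow> b \<in> carrier B \<Longrightarrow> f a b \<in> carrier MN" for h A B t f
    by (rule sw_lin[where g = "pact T h"]) (use that in simp_all)
  have [simp]: "tensor_alpha K M N (sw K MN A B t f) = sw K MN A B t (\<lambda>a b. tensor_alpha K M N (f a b))"
    if "Module.module K A" "Module.module K B" "t \<in> carrier (A \<boxtimes> B)"
      "\<And>a b. a \<in> carrier A \<Longrightarrow> b \<in> carrier B \<Longrightarrow> f a b \<in> carrier MN" for A B t f
    by (rule sw_lin[OF _ _ _ a]) (use that in simp_all)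
  have [simp]: "L T (sw K MN A B t f) = sw K (V \<boxtimes> MN) A B t (\<lambda>a b. L T (f a b))"
    if "Module.module K A" "Module.module K B" "t \<in> carrier (A \<boxtimes> B)"
      "\<And>a b. a \<in> carrier A \<Longrightarrow> b \<in> carrier B \<Longrightarrow> f a b \<in> carrier MN" for A B t f
    by (rule sw_lin[OF _ _ _ L]) (use that in simp_all)
  have 1: "\<forall>x\<in>carrier MN. tensor_alpha K M N (pact T h x) = pact T (\<alpha> h) (tensor_alpha K M N x)"
    if [simp]: "h \<in> carrier V" for h
    by (rule tensor_ext[where P = MN]) simp_all
  have 2: "\<forall>x\<in>carrier MN. pact T h (pact T k x) = pact T (mul h k) x"
    if [simp]: "h \<in> carrier V" "k \<in> carrier V" for h k
    by (rule tensor_ext[where P = MN]) (simp_all, rule sw_swap, simp_all)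
  have 3: "\<forall>x\<in>carrier MN. sw K (V \<boxtimes> MN) V V (D h) (\<lambda>h1 h2. sw K (V \<boxtimes> MN) V MN (L T (pact T h1 x))
        (\<lambda>u n. mul u h2 \<otimes>\<^bsub>V \<boxtimes> MN\<^esub> n)) =
      sw K (V \<boxtimes> MN) V V (D h) (\<lambda>h1 h2. sw K (V \<boxtimes> MN) V MN (L T x)
        (\<lambda>u n. mul h1 u \<otimes>\<^bsub>V \<boxtimes> MN\<^esub> pact T h2 n))"
    (is "\<forall>x\<in>_. ?l x = ?r x") if "h \<in> carrier V" for h
  proof (rule tensor_ext[where P = "V \<boxtimes> MN"])
    fix m n assume mn [simp]: "m \<in> carrier (msp M)" "n \<in> carrier (msp N)"
    let ?P = "V \<boxtimes> MN"
    \<comment> \<open>Writing h as \<alpha> k puts an \<alpha> on each leg of the coproduct, which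
      cancels the \<beta> in the diagonal action.\<close>
    define k where "k = \<beta> h"
    have k [simp]: "k \<in> carrier V" and h: "h = \<alpha> k" using that by (simp_all add: k_def)
    \<comment> \<open>The iterated coproduct of k has three legs a, b, c. The condition for N is
      applied to b, c, and then the condition for M to a, b. In between, coassociativity regroups
      the legs and sums are exchanged, so that each time the relevant coproduct and coaction are
      adjacent.\<close>
    have "?l (m \<otimes>\<^bsub>MN\<^esub> n) =
       sw K ?P V V (D k) (\<lambda>k1 c. sw K ?P V V (D k1) (\<lambda>a b. sw K ?P V (msp M) (L M (pact M a m)) (\<lambda>u m0.
         sw K ?P V (msp N) (L N (pact N b n)) (\<lambda>v n0. mul (\<alpha> u) (mul (\<alpha> v) (\<alpha> c)) \<otimes>\<^bsub>?P\<^esub> (m0 \<otimes>\<^bsub>MN\<^esub> n0)))))"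
      unfolding h by simp
    also have "\<dots> = sw K ?P V V (D k) (\<lambda>a k2. sw K ?P V V (D k2) (\<lambda>b c. sw K ?P V (msp M) (L M (pact M a m)) (\<lambda>u m0.
         sw K ?P V (msp N) (L N (pact N b n)) (\<lambda>v n0. mul (\<alpha> u) (mul (\<alpha> v) (\<alpha> c)) \<otimes>\<^bsub>?P\<^esub> (m0 \<otimes>\<^bsub>MN\<^esub> n0)))))"
      by (rule D_coassoc[symmetric]) simp_all
    also have "\<dots> = sw K ?P V V (D k) (\<lambda>a k2. sw K ?P V (msp M) (L M (pact M a m)) (\<lambda>u m0. sw K ?P V V (D k2) (\<lambda>b c.
         sw K ?P V (msp N) (L N (pact N b n)) (\<lambda>v n0. mul (\<alpha> u) (mul (\<alpha> v) (\<alpha> c)) \<otimes>\<^bsub>?P\<^esub> (m0 \<otimes>\<^bsub>MN\<^esub> n0)))))"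
      by (rule sw_body_cong, rule sw_swap) simp_all
    also have "\<dots> = sw K ?P V V (D k) (\<lambda>a k2. sw K ?P V (msp M) (L M (pact M a m)) (\<lambda>u m0. sw K ?P V V (D k2) (\<lambda>b c.
         sw K ?P V (msp N) (L N n) (\<lambda>v n0. mul (\<alpha> u) (mul (\<alpha> b) (\<alpha> v)) \<otimes>\<^bsub>?P\<^esub> (m0 \<otimes>\<^bsub>MN\<^esub> pact N c n0)))))"
    proof (rule sw_body_cong, rule sw_body_cong)
      fix a k2 u m0 assume [simp]: "a \<in> carrier V" "k2 \<in> carrier V" "u \<in> carrier V" "m0 \<in> carrier (msp M)"
      show "sw K ?P V V (D k2) (\<lambda>b c. sw K ?P V (msp N) (L N (pact N b n)) (\<lambda>v n0.
              mul (\<alpha> u) (mul (\<alpha> v) (\<alpha> c)) \<otimes>\<^bsub>?P\<^esub> (m0 \<otimes>\<^bsub>MN\<^esub> n0))) =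
            sw K ?P V V (D k2) (\<lambda>b c. sw K ?P V (msp N) (L N n) (\<lambda>v n0.
              mul (\<alpha> u) (mul (\<alpha> b) (\<alpha> v)) \<otimes>\<^bsub>?P\<^esub> (m0 \<otimes>\<^bsub>MN\<^esub> pact N c n0)))"
        using sw_yd[OF N, of k2 n ?P "\<lambda>x n0. mul (\<alpha> u) (\<alpha> x) \<otimes>\<^bsub>?P\<^esub> (m0 \<otimes>\<^bsub>MN\<^esub> n0)"] by simp
    qed
    also have "\<dots> = sw K ?P V V (D k) (\<lambda>a k2. sw K ?P V V (D k2) (\<lambda>b c. sw K ?P V (msp M) (L M (pact M a m)) (\<lambda>u m0.
         sw K ?P V (msp N) (L N n) (\<lambda>v n0. mul (\<alpha> u) (mul (\<alpha> b) (\<alpha> v)) \<otimes>\<^bsub>?P\<^esub> (m0 \<otimes>\<^bsub>MN\<^esub> pact N c n0)))))"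
      by (rule sw_body_cong, rule sw_swap) simp_all
    also have "\<dots> = sw K ?P V V (D k) (\<lambda>k1 c. sw K ?P V V (D k1) (\<lambda>a b. sw K ?P V (msp M) (L M (pact M a m)) (\<lambda>u m0.
         sw K ?P V (msp N) (L N n) (\<lambda>v n0. mul (\<alpha> u) (mul (\<alpha> b) (\<alpha> v)) \<otimes>\<^bsub>?P\<^esub> (m0 \<otimes>\<^bsub>MN\<^esub> pact N c n0)))))"
      by (rule D_coassoc) simp_all
    also have "\<dots> = sw K ?P V V (D k) (\<lambda>k1 c. sw K ?P V V (D k1) (\<lambda>a b. sw K ?P V (msp M) (L M m) (\<lambda>u m0.
         sw K ?P V (msp N) (L N n) (\<lambda>v n0. mul (\<alpha> a) (mul (\<alpha> u) (\<alpha> v)) \<otimes>\<^bsub>?P\<^esub> (pact M b m0 \<otimes>\<^bsub>MN\<^esub> pact N c n0)))))"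
    proof (rule sw_body_cong)
      fix k1 c assume [simp]: "k1 \<in> carrier V" "c \<in> carrier V"
      show "sw K ?P V V (D k1) (\<lambda>a b. sw K ?P V (msp M) (L M (pact M a m)) (\<lambda>u m0.
         sw K ?P V (msp N) (L N n) (\<lambda>v n0. mul (\<alpha> u) (mul (\<alpha> b) (\<alpha> v)) \<otimes>\<^bsub>?P\<^esub> (m0 \<otimes>\<^bsub>MN\<^esub> pact N c n0)))) =
         sw K ?P V V (D k1) (\<lambda>a b. sw K ?P V (msp M) (L M m) (\<lambda>u m0.
         sw K ?P V (msp N) (L N n) (\<lambda>v n0. mul (\<alpha> a) (mul (\<alpha> u) (\<alpha> v)) \<otimes>\<^bsub>?P\<^esub> (pact M b m0 \<otimes>\<^bsub>MN\<^esub> pact N c n0))))"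
        using sw_yd[OF M, of k1 m ?P "\<lambda>x m0. sw K ?P V (msp N) (L N n) (\<lambda>v n0. mul (\<alpha> x) (\<alpha> v) \<otimes>\<^bsub>?P\<^esub> (m0 \<otimes>\<^bsub>MN\<^esub> pact N c n0))"]
        by simp
    qed
    also have "\<dots> = sw K ?P V V (D k) (\<lambda>a k2. sw K ?P V V (D k2) (\<lambda>b c. sw K ?P V (msp M) (L M m) (\<lambda>u m0.
         sw K ?P V (msp N) (L N n) (\<lambda>v n0. mul (\<alpha> a) (mul (\<alpha> u) (\<alpha> v)) \<otimes>\<^bsub>?P\<^esub> (pact M b m0 \<otimes>\<^bsub>MN\<^esub> pact N c n0)))))"
      by (rule D_coassoc[symmetric]) simp_all
    also have "\<dots> = sw K ?P V V (D k) (\<lambda>a k2. sw K ?P V (msp M) (L M m) (\<lambda>u m0. sw K ?P V V (D k2) (\<lambda>b c.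
         sw K ?P V (msp N) (L N n) (\<lambda>v n0. mul (\<alpha> a) (mul (\<alpha> u) (\<alpha> v)) \<otimes>\<^bsub>?P\<^esub> (pact M b m0 \<otimes>\<^bsub>MN\<^esub> pact N c n0)))))"
      by (rule sw_body_cong, rule sw_swap) simp_all
    also have "\<dots> = sw K ?P V V (D k) (\<lambda>a k2. sw K ?P V (msp M) (L M m) (\<lambda>u m0. sw K ?P V (msp N) (L N n) (\<lambda>v n0.
         sw K ?P V V (D k2) (\<lambda>b c. mul (\<alpha> a) (mul (\<alpha> u) (\<alpha> v)) \<otimes>\<^bsub>?P\<^esub> (pact M b m0 \<otimes>\<^bsub>MN\<^esub> pact N c n0)))))"
      by (rule sw_body_cong, rule sw_body_cong, rule sw_swap) simp_all
    also have "\<dots> = ?r (m \<otimes>\<^bsub>MN\<^esub> n)"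
      unfolding h by simp
    finally show "?l (m \<otimes>\<^bsub>MN\<^esub> n) = ?r (m \<otimes>\<^bsub>MN\<^esub> n)" .
  qed (use that in simp_all)
  show ?thesis
    by (rule yobjI) (use 1 2 3 tensor_act_linear in simp_all)
qed

end

section \<open>Morphisms\<close>

declare yobj_yd_tensor [simp]

text \<open>
  The rules below mention the carrier space of an object only through an equation such as
  \<open>A = msp M\<close>, so that they also match when \<open>M\<close> is itself a tensor product and \<open>msp M\<close> has been
  rewritten.
\<close>

lemma yobj_lin [simp]:
  assumes "yobj M" "A = msp M"
  shows "lin K X A g \<Longrightarrow> lin K X A (\<lambda>x. malpha M (g x))"
    and "lin K X A g \<Longrightarrow> lin K X A (\<lambda>x. malpha_inv M (g x))"
    and "lin K X A g \<Longrightarrow> lin K X (V \<boxtimes> A) (\<lambda>x. L M (g x))"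
    and "lin K X A g \<Longrightarrow> h \<in> carrier V \<Longrightarrow> lin K X A (\<lambda>x. pact M h (g x))"
    and "lin K X V g' \<Longrightarrow> m \<in> carrier A \<Longrightarrow> lin K X A (\<lambda>x. pact M (g' x) m)"
  using assms by simp_all

lemma tensor_alpha_simps [simp]:
  assumes "yobj M" "yobj N" "A = msp M" "B = msp N"
  shows "lin K X (A \<boxtimes> B) g \<Longrightarrow> lin K X (A \<boxtimes> B) (\<lambda>x. tensor_alpha K M N (g x))"
    and "x \<in> carrier (A \<boxtimes> B) \<Longrightarrow> tensor_alpha K M N x \<in> carrier (A \<boxtimes> B)"
    and "m \<in> carrier A \<Longrightarrow> n \<in> carrier B \<Longrightarrow>
      tensor_alpha K M N (m \<otimes>\<^bsub>A \<boxtimes> B\<^esub> n) = malpha M m \<otimes>\<^bsub>A \<boxtimes> B\<^esub> malpha N n"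
  using assms lin_comp[OF _ tensor_lin(1)] lin_closed[OF tensor_lin(1)] by (simp_all add: tensor_alpha_pure)

lemma yd_tensor_simps [simp]:
  assumes "yobj M" "yobj N" "A = msp M" "B = msp N" "m \<in> carrier A" "n \<in> carrier B"
  shows "malpha_inv (yd_tensor K H M N) (m \<otimes>\<^bsub>A \<boxtimes> B\<^esub> n) = malpha_inv M m \<otimes>\<^bsub>A \<boxtimes> B\<^esub> malpha_inv N n"
    and "L (yd_tensor K H M N) (m \<otimes>\<^bsub>A \<boxtimes> B\<^esub> n) = sw K (V \<boxtimes> (A \<boxtimes> B)) V A (L M m) (\<lambda>u m0.
      sw K (V \<boxtimes> (A \<boxtimes> B)) V B (L N n) (\<lambda>v n0.
       mul (\<alpha> u) (\<alpha> v) \<otimes>\<^bsub>V \<boxtimes> (A \<boxtimes> B)\<^esub> (m0 \<otimes>\<^bsub>A \<boxtimes> B\<^esub> n0)))"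
    and "h \<in> carrier V \<Longrightarrow> pact (yd_tensor K H M N) h (m \<otimes>\<^bsub>A \<boxtimes> B\<^esub> n) =
      sw K (A \<boxtimes> B) V V (D h) (\<lambda>h1 h2. pact M (\<beta> h1) m \<otimes>\<^bsub>A \<boxtimes> B\<^esub> pact N (\<beta> h2) n)"
  using assms by (simp_all add: malpha_inv_tensor_pure L_tensor_pure pact_tensor_pure)

lemma yobj_pull [simp]:
  assumes "yobj M" "Q = msp M" "Module.module K A" "Module.module K B" "t \<in> carrier (A \<boxtimes> B)"
    "\<And>a b. a \<in> carrier A \<Longrightarrow> b \<in> carrier B \<Longrightarrow> f a b \<in> carrier Q"
  shows "malpha M (sw K Q A B t f) = sw K Q A B t (\<lambda>a b. malpha M (f a b))"
    and "malpha_inv M (sw K Q A B t f) = sw K Q A B t (\<lambda>a b. malpha_inv M (f a b))"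
    and "L M (sw K Q A B t f) = sw K (V \<boxtimes> Q) A B t (\<lambda>a b. L M (f a b))"
    and "h \<in> carrier V \<Longrightarrow> pact M h (sw K Q A B t f) = sw K Q A B t (\<lambda>a b. pact M h (f a b))"
  using assms by (auto intro!: sw_lin)

lemma tensor_alpha_pull [simp]:
  assumes "yobj M" "yobj N" "Q = msp M \<boxtimes> msp N" "Module.module K A" "Module.module K B" "t \<in> carrier (A \<boxtimes> B)"
    "\<And>a b. a \<in> carrier A \<Longrightarrow> b \<in> carrier B \<Longrightarrow> f a b \<in> carrier Q"
  shows "tensor_alpha K M N (sw K Q A B t f) = sw K Q A B t (\<lambda>a b. tensor_alpha K M N (f a b))"
  using yobj_pull(1)[of "yd_tensor K H M N" Q A B t f] assms by simp

definition ymor :: "('k, 'a) hom_yd \<Rightarrow> ('k, 'a) hom_yd \<Rightarrow> ('a univ \<Rightarrow> 'a univ) \<Rightarrow> bool" where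
  "ymor M N f \<longleftrightarrow> module_morphism K H M N f \<and> comodule_morphism K H M N f"

lemma ymor_linear_maps: "ymor M N f \<Longrightarrow> f \<in> linear_maps K (msp M) (msp N)"
  by (simp add: ymor_def module_morphism_def)

lemma comodule_morphism_L:
  fixes M N :: "('k, 'a, 'z) hom_comod_scheme"
  assumes M: "cobj M" and N: "cobj N" and f: "comodule_morphism K H M N f" and m: "m \<in> carrier (msp M)"
  shows "f \<in> linear_maps K (msp M) (msp N)" "lin K (msp M) (msp N) f" "f m \<in> carrier (msp N)"
    "f (malpha M m) = malpha N (f m)" "f (malpha_inv M m) = malpha_inv N (f m)"
    "L N (f m) = sw K (V \<boxtimes> msp N) V (msp M) (L M m) (\<lambda>u x. u \<otimes>\<^bsub>V \<boxtimes> msp N\<^esub> f x)"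
proof -
  show 0: "f \<in> linear_maps K (msp M) (msp N)" using f by (simp add: comodule_morphism_def)
  then show 1: "lin K (msp M) (msp N) f" by (simp add: linear_maps_lin)
  note [simp] = lin_comp[OF _ 1] lin_closed[OF 1] M N m
  show "f m \<in> carrier (msp N)" by simp
  have 2: "f (malpha M m) = malpha N (f m)" if "m \<in> carrier (msp M)" for m
    using f that by (simp add: comodule_morphism_def)
  show "f (malpha M m) = malpha N (f m)" by (rule 2[OF m])
  show 3: "f (malpha_inv M m) = malpha_inv N (f m)"
    using 2[of "malpha_inv M m"] malpha_malpha_inv(2)[OF N, of "f (malpha_inv M m)"] by simp
  have "tensor_map K V (msp M) V (msp N) (\<lambda>h\<in>carrier V. h) f (mcoact M (malpha_inv M m)) =
      mcoact N (f (malpha_inv M m))"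
    using f M m by (simp add: comodule_morphism_def)
  then show "L N (f m) = sw K (V \<boxtimes> msp N) V (msp M) (L M m) (\<lambda>u x. u \<otimes>\<^bsub>V \<boxtimes> msp N\<^esub> f x)"
    by (simp add: 3 mcoact_eq tensor_map_sw)
qed

lemma ymorD:
  assumes M: "yobj M" and N: "yobj N" and f: "ymor M N f"
  shows "f \<in> linear_maps K (msp M) (msp N)" "lin K (msp M) (msp N) f"
    "lin K X (msp M) g \<Longrightarrow> lin K X (msp N) (\<lambda>x. f (g x))"
    "m \<in> carrier (msp M) \<Longrightarrow> f m \<in> carrier (msp N)"
    "m \<in> carrier (msp M) \<Longrightarrow> f (malpha M m) = malpha N (f m)"
    "m \<in> carrier (msp M) \<Longrightarrow> f (malpha_inv M m) = malpha_inv N (f m)"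
    "h \<in> carrier V \<Longrightarrow> m \<in> carrier (msp M) \<Longrightarrow> f (pact M h m) = pact N h (f m)"
    "m \<in> carrier (msp M) \<Longrightarrow>
      L N (f m) = sw K (V \<boxtimes> msp N) V (msp M) (L M m) (\<lambda>u x. u \<otimes>\<^bsub>V \<boxtimes> msp N\<^esub> f x)"
    "Module.module K A \<Longrightarrow> Module.module K B \<Longrightarrow> t \<in> carrier (A \<boxtimes> B) \<Longrightarrow>
      (\<And>a b. a \<in> carrier A \<Longrightarrow> b \<in> carrier B \<Longrightarrow> F a b \<in> carrier (msp M)) \<Longrightarrow>
      f (sw K (msp M) A B t F) = sw K (msp N) A B t (\<lambda>a b. f (F a b))"
proof -
  have c: "comodule_morphism K H M N f" using f by (simp add: ymor_def)
  note L = comodule_morphism_L[OF yobj_cobj[OF M] yobj_cobj[OF N] c]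
  show 0: "f \<in> linear_maps K (msp M) (msp N)" by (rule ymor_linear_maps[OF f])
  then show 1: "lin K (msp M) (msp N) f" by (simp add: linear_maps_lin)
  show "lin K X (msp M) g \<Longrightarrow> lin K X (msp N) (\<lambda>x. f (g x))" by (rule lin_comp[OF _ 1])
  show "m \<in> carrier (msp M) \<Longrightarrow> f m \<in> carrier (msp N)" by (rule L)
  show "m \<in> carrier (msp M) \<Longrightarrow> f (malpha M m) = malpha N (f m)" by (rule L)
  show "m \<in> carrier (msp M) \<Longrightarrow> f (malpha_inv M m) = malpha_inv N (f m)" by (rule L)
  show "h \<in> carrier V \<Longrightarrow> m \<in> carrier (msp M) \<Longrightarrow> f (pact M h m) = pact N h (f m)"
    using f M L(5) by (simp add: pact_def ymor_def module_morphism_def)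
  show "m \<in> carrier (msp M) \<Longrightarrow>
      L N (f m) = sw K (V \<boxtimes> msp N) V (msp M) (L M m) (\<lambda>u x. u \<otimes>\<^bsub>V \<boxtimes> msp N\<^esub> f x)"
    by (rule L)
  show "Module.module K A \<Longrightarrow> Module.module K B \<Longrightarrow> t \<in> carrier (A \<boxtimes> B) \<Longrightarrow>
      (\<And>a b. a \<in> carrier A \<Longrightarrow> b \<in> carrier B \<Longrightarrow> F a b \<in> carrier (msp M)) \<Longrightarrow>
      f (sw K (msp M) A B t F) = sw K (msp N) A B t (\<lambda>a b. f (F a b))"
    by (rule sw_lin[OF _ _ _ 1]) (use M N in simp_all)
qed

lemma comodule_morphismI:
  fixes M N :: "('k, 'a, 'z) hom_comod_scheme"
  assumes M [simp]: "cobj M" and N [simp]: "cobj N" and f: "f \<in> linear_maps K (msp M) (msp N)"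
    and al: "\<forall>m\<in>carrier (msp M). f (malpha M m) = malpha N (f m)"
    and L: "\<forall>m\<in>carrier (msp M). sw K (V \<boxtimes> msp N) V (msp M) (L M m) (\<lambda>u x. u \<otimes>\<^bsub>V \<boxtimes> msp N\<^esub> f x) = L N (f m)"
  shows "comodule_morphism K H M N f"
proof -
  have 1: "lin K (msp M) (msp N) f" using f by (simp add: linear_maps_lin)
  note [simp] = lin_comp[OF _ 1] lin_closed[OF 1]
  \<comment> \<open>The definition of a comodule morphism speaks of \<open>mcoact M m\<close>, which
    is \<open>L M\<close> at \<open>malpha M m\<close>; the hypothesis on \<open>L\<close> is
    therefore needed at that element.\<close>
  have L': "sw K (V \<boxtimes> msp N) V (msp M) (L M (malpha M m)) (\<lambda>u x. u \<otimes>\<^bsub>V \<boxtimes> msp N\<^esub> f x) = L N (malpha N (f m))"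
    if "m \<in> carrier (msp M)" for m
    using L al that cobj_closed(1)[OF M that] by metis
  have "tensor_map K V (msp M) V (msp N) (\<lambda>h\<in>carrier V. h) f (mcoact M m) = mcoact N (f m)"
    if "m \<in> carrier (msp M)" for m
    using that by (simp add: mcoact_eq tensor_map_sw L'[symmetric] del: sw_L_malpha)
  then show ?thesis using f al unfolding comodule_morphism_def by metis
qed

lemma ymorI:
  assumes M [simp]: "yobj M" and N [simp]: "yobj N" and f: "f \<in> linear_maps K (msp M) (msp N)"
    and al: "\<forall>m\<in>carrier (msp M). f (malpha M m) = malpha N (f m)"
    and p: "\<And>h. h \<in> carrier V \<Longrightarrow> \<forall>m\<in>carrier (msp M). f (pact M h m) = pact N h (f m)"
    and L: "\<forall>m\<in>carrier (msp M). sw K (V \<boxtimes> msp N) V (msp M) (L M m) (\<lambda>u x. u \<otimes>\<^bsub>V \<boxtimes> msp N\<^esub> f x) = L N (f m)"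
  shows "ymor M N f"
proof -
  have 1: "lin K (msp M) (msp N) f" using f by (simp add: linear_maps_lin)
  note [simp] = lin_comp[OF _ 1] lin_closed[OF 1]
  have "comodule_morphism K H M N f" by (rule comodule_morphismI) (use assms in simp_all)
  moreover have "f (act K H M h m) = act K H N h (f m)" if "h \<in> carrier V" "m \<in> carrier (msp M)" for h m
    using that p al by (simp add: act_eq del: malpha_pact)
  ultimately show ?thesis using f al unfolding ymor_def module_morphism_def by metis
qed

lemma ymor_id: "yobj M \<Longrightarrow> ymor M M (\<lambda>m\<in>carrier (msp M). m)"
  by (rule ymorI) (simp_all add: id_linear_maps)

lemma ymor_compose:
  assumes [simp]: "yobj M" "yobj N" "yobj P" and f: "ymor M N f" and g: "ymor N P g"
  shows "ymor M P (compose (carrier (msp M)) g f)"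
proof -
  note [simp] = ymorD[OF _ _ f] ymorD[OF _ _ g]
  show ?thesis
    by (rule ymorI) (use compose_linear_maps[OF _ ymorD(1)[OF _ _ f] ymorD(1)[OF _ _ g]] in
      \<open>simp_all add: compose_def\<close>)
qed

lemma ymor_tensor:
  assumes [simp]: "yobj M" "yobj M'" "yobj N" "yobj N'" and f: "ymor M N f" and g: "ymor M' N' g"
  shows "ymor (yd_tensor K H M M') (yd_tensor K H N N') (tensor_map K (msp M) (msp M') (msp N) (msp N') f g)"
proof -
  note [simp] = ymorD[OF _ _ f] ymorD[OF _ _ g]
  let ?t = "tensor_map K (msp M) (msp M') (msp N) (msp N') f g"
  let ?M = "msp M \<boxtimes> msp M'" and ?N = "msp N \<boxtimes> msp N'"
  have t: "?t \<in> linear_maps K ?M ?N" by (rule lin_tensor_map(1)) simp_all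
  then have tl: "lin K ?M ?N ?t" by (simp add: linear_maps_lin)
  note [simp] = lin_comp[OF _ tl] lin_closed[OF tl] lin_tensor_map(2)
  have [simp]: "?t (sw K ?M A B t F) = sw K ?N A B t (\<lambda>a b. ?t (F a b))"
    if "Module.module K A" "Module.module K B" "t \<in> carrier (A \<boxtimes> B)"
      "\<And>a b. a \<in> carrier A \<Longrightarrow> b \<in> carrier B \<Longrightarrow> F a b \<in> carrier ?M" for A B t F
    by (rule sw_lin[OF _ _ _ tl]) (use that in simp_all)
  show ?thesis
  proof (rule ymorI)
    show "\<forall>m\<in>carrier (msp (yd_tensor K H M M')). ?t (malpha (yd_tensor K H M M') m) = malpha (yd_tensor K H N N') (?t m)"
      unfolding yd_tensor_sel by (rule tensor_ext[where P = ?N]) simp_all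
    show "\<forall>m\<in>carrier (msp (yd_tensor K H M M')). ?t (pact (yd_tensor K H M M') h m) = pact (yd_tensor K H N N') h (?t m)"
      if "h \<in> carrier V" for h
      unfolding yd_tensor_sel by (rule tensor_ext[where P = ?N]) (use that in simp_all)
    show "\<forall>m\<in>carrier (msp (yd_tensor K H M M')). sw K (V \<boxtimes> msp (yd_tensor K H N N')) V (msp (yd_tensor K H M M'))
       (L (yd_tensor K H M M') m) (\<lambda>u x. u \<otimes>\<^bsub>V \<boxtimes> msp (yd_tensor K H N N')\<^esub> ?t x) = L (yd_tensor K H N N') (?t m)"
      unfolding yd_tensor_sel by (rule tensor_ext[where P = "V \<boxtimes> ?N"]) simp_all
  qed (use t in simp_all)
qed

section \<open>Associativity constraint\<close>

definition assoc_inv_map where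
  "assoc_inv_map M N P =
    (\<lambda>x\<in>carrier (msp M \<boxtimes> (msp N \<boxtimes> msp P)).
       sw K ((msp M \<boxtimes> msp N) \<boxtimes> msp P) (msp M) (msp N \<boxtimes> msp P) x (\<lambda>m y.
         sw K ((msp M \<boxtimes> msp N) \<boxtimes> msp P) (msp N) (msp P) y (\<lambda>n p.
           (malpha_inv M m \<otimes>\<^bsub>msp M \<boxtimes> msp N\<^esub> n) \<otimes>\<^bsub>(msp M \<boxtimes> msp N) \<boxtimes> msp P\<^esub> malpha P p)))"

lemma assoc_map_eq:
  fixes M N P :: "('k, 'a, 'z) hom_comod_scheme"
  assumes "cobj M" "cobj N" "cobj P"
  shows "assoc_map K M N P = (\<lambda>x\<in>carrier ((msp M \<boxtimes> msp N) \<boxtimes> msp P).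
       sw K (msp M \<boxtimes> (msp N \<boxtimes> msp P)) (msp M \<boxtimes> msp N) (msp P) x (\<lambda>y p.
         sw K (msp M \<boxtimes> (msp N \<boxtimes> msp P)) (msp M) (msp N) y (\<lambda>m n.
           malpha M m \<otimes>\<^bsub>msp M \<boxtimes> (msp N \<boxtimes> msp P)\<^esub> (n \<otimes>\<^bsub>msp N \<boxtimes> msp P\<^esub> malpha_inv P p))))"
  unfolding assoc_map_def Let_def
  by (rule restrict_ext) (simp add: assms sweedler_eq_sw[of K "msp M \<boxtimes> msp N" "msp P"] sweedler_eq_sw[of K "msp M" "msp N"])

lemma assoc_map_yd:
  assumes [simp]: "yobj M" "yobj N" "yobj P"
  shows "assoc_map K M N P \<in> linear_maps K ((msp M \<boxtimes> msp N) \<boxtimes> msp P) (msp M \<boxtimes> (msp N \<boxtimes> msp P))"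
    and "m \<in> carrier (msp M) \<Longrightarrow> n \<in> carrier (msp N) \<Longrightarrow> p \<in> carrier (msp P) \<Longrightarrow>
      assoc_map K M N P ((m \<otimes>\<^bsub>msp M \<boxtimes> msp N\<^esub> n) \<otimes>\<^bsub>(msp M \<boxtimes> msp N) \<boxtimes> msp P\<^esub> p) =
      malpha M m \<otimes>\<^bsub>msp M \<boxtimes> (msp N \<boxtimes> msp P)\<^esub> (n \<otimes>\<^bsub>msp N \<boxtimes> msp P\<^esub> malpha_inv P p)"
proof -
  show "assoc_map K M N P \<in> linear_maps K ((msp M \<boxtimes> msp N) \<boxtimes> msp P) (msp M \<boxtimes> (msp N \<boxtimes> msp P))"
    by (subst assoc_map_eq, simp_all) (rule linear_maps_restrict, simp_all)
qed (simp add: assoc_map_eq)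

lemma assoc_inv_map_yd:
  assumes [simp]: "yobj M" "yobj N" "yobj P"
  shows "assoc_inv_map M N P \<in> linear_maps K (msp M \<boxtimes> (msp N \<boxtimes> msp P)) ((msp M \<boxtimes> msp N) \<boxtimes> msp P)"
    and "m \<in> carrier (msp M) \<Longrightarrow> n \<in> carrier (msp N) \<Longrightarrow> p \<in> carrier (msp P) \<Longrightarrow>
      assoc_inv_map M N P (m \<otimes>\<^bsub>msp M \<boxtimes> (msp N \<boxtimes> msp P)\<^esub> (n \<otimes>\<^bsub>msp N \<boxtimes> msp P\<^esub> p)) =
      (malpha_inv M m \<otimes>\<^bsub>msp M \<boxtimes> msp N\<^esub> n) \<otimes>\<^bsub>(msp M \<boxtimes> msp N) \<boxtimes> msp P\<^esub> malpha P p"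
proof -
  show "assoc_inv_map M N P \<in> linear_maps K (msp M \<boxtimes> (msp N \<boxtimes> msp P)) ((msp M \<boxtimes> msp N) \<boxtimes> msp P)"
    unfolding assoc_inv_map_def by (rule linear_maps_restrict) simp_all
qed (simp add: assoc_inv_map_def)

section \<open>Evaluation of the quasi-braiding and of the associators\<close>

lemma braid_map_eq:
  assumes [simp]: "yobj M" "yobj N"
  shows "yd_braid_map K H M N = (\<lambda>x\<in>carrier (msp M \<boxtimes> msp N).
     sw K (msp N \<boxtimes> msp M) (msp M) (msp N) x (\<lambda>m n.
       sw K (msp N \<boxtimes> msp M) V (msp M) (L M m) (\<lambda>u m0. pact N u n \<otimes>\<^bsub>msp N \<boxtimes> msp M\<^esub> m0)))"
  \<comment> \<open>Replacing \<open>mcoact\<close> by \<open>L\<close> puts \<alpha> and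
    \<open>malpha\<close> on the two legs. They cancel the \<beta> and the \<open>malpha_inv\<close>
    on the coaction legs in the definition, while the other \<open>malpha_inv\<close> turns
    \<open>act\<close> into \<open>pact\<close>.\<close>
  unfolding yd_braid_map_def Let_def
  by (rule restrict_ext) (simp add: sweedler_eq_sw[of K "msp M" "msp N"] sweedler_L mcoact_eq pact_def[symmetric])

lemma braid_map_yd:
  assumes [simp]: "yobj M" "yobj N"
  shows "yd_braid_map K H M N \<in> linear_maps K (msp M \<boxtimes> msp N) (msp N \<boxtimes> msp M)"
    and "m \<in> carrier (msp M) \<Longrightarrow> n \<in> carrier (msp N) \<Longrightarrow>
      yd_braid_map K H M N (m \<otimes>\<^bsub>msp M \<boxtimes> msp N\<^esub> n) =
      sw K (msp N \<boxtimes> msp M) V (msp M) (L M m) (\<lambda>u m0. pact N u n \<otimes>\<^bsub>msp N \<boxtimes> msp M\<^esub> m0)"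
proof -
  show "yd_braid_map K H M N \<in> linear_maps K (msp M \<boxtimes> msp N) (msp N \<boxtimes> msp M)"
    by (subst braid_map_eq, simp_all) (rule linear_maps_restrict, simp_all)
qed (simp add: braid_map_eq)

lemma assoc_map_simps [simp]:
  assumes "yobj M" "yobj N" "yobj P" "A = msp M" "B = msp N" "C = msp P"
  shows "t \<in> carrier ((A \<boxtimes> B) \<boxtimes> C) \<Longrightarrow> assoc_map K M N P t \<in> carrier (A \<boxtimes> (B \<boxtimes> C))"
    and "lin K X ((A \<boxtimes> B) \<boxtimes> C) g \<Longrightarrow> lin K X (A \<boxtimes> (B \<boxtimes> C)) (\<lambda>x. assoc_map K M N P (g x))"
    and "m \<in> carrier A \<Longrightarrow> n \<in> carrier B \<Longrightarrow> p \<in> carrier C \<Longrightarrow>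
      assoc_map K M N P ((m \<otimes>\<^bsub>A \<boxtimes> B\<^esub> n) \<otimes>\<^bsub>(A \<boxtimes> B) \<boxtimes> C\<^esub> p) =
      malpha M m \<otimes>\<^bsub>A \<boxtimes> (B \<boxtimes> C)\<^esub> (n \<otimes>\<^bsub>B \<boxtimes> C\<^esub> malpha_inv P p)"
    and "Module.module K Y \<Longrightarrow> Module.module K Z \<Longrightarrow> s \<in> carrier (Y \<boxtimes> Z) \<Longrightarrow>
      (\<And>a b. a \<in> carrier Y \<Longrightarrow> b \<in> carrier Z \<Longrightarrow> F a b \<in> carrier ((A \<boxtimes> B) \<boxtimes> C)) \<Longrightarrow>
      assoc_map K M N P (sw K ((A \<boxtimes> B) \<boxtimes> C) Y Z s F) =
      sw K (A \<boxtimes> (B \<boxtimes> C)) Y Z s (\<lambda>a b. assoc_map K M N P (F a b))"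
  using assms assoc_map_yd[OF assms(1-3)] by (simp_all add: linear_maps_closed linear_maps_comp linear_maps_sw)

lemma assoc_inv_map_simps [simp]:
  assumes "yobj M" "yobj N" "yobj P" "A = msp M" "B = msp N" "C = msp P"
  shows "t \<in> carrier (A \<boxtimes> (B \<boxtimes> C)) \<Longrightarrow> assoc_inv_map M N P t \<in> carrier ((A \<boxtimes> B) \<boxtimes> C)"
    and "lin K X (A \<boxtimes> (B \<boxtimes> C)) g \<Longrightarrow> lin K X ((A \<boxtimes> B) \<boxtimes> C) (\<lambda>x. assoc_inv_map M N P (g x))"
    and "m \<in> carrier A \<Longrightarrow> n \<in> carrier B \<Longrightarrow> p \<in> carrier C \<Longrightarrow>
      assoc_inv_map M N P (m \<otimes>\<^bsub>A \<boxtimes> (B \<boxtimes> C)\<^esub> (n \<otimes>\<^bsub>B \<boxtimes> C\<^esub> p)) =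
      (malpha_inv M m \<otimes>\<^bsub>A \<boxtimes> B\<^esub> n) \<otimes>\<^bsub>(A \<boxtimes> B) \<boxtimes> C\<^esub> malpha P p"
    and "Module.module K Y \<Longrightarrow> Module.module K Z \<Longrightarrow> s \<in> carrier (Y \<boxtimes> Z) \<Longrightarrow>
      (\<And>a b. a \<in> carrier Y \<Longrightarrow> b \<in> carrier Z \<Longrightarrow> F a b \<in> carrier (A \<boxtimes> (B \<boxtimes> C))) \<Longrightarrow>
      assoc_inv_map M N P (sw K (A \<boxtimes> (B \<boxtimes> C)) Y Z s F) =
      sw K ((A \<boxtimes> B) \<boxtimes> C) Y Z s (\<lambda>a b. assoc_inv_map M N P (F a b))"
  using assms assoc_inv_map_yd[OF assms(1-3)] by (simp_all add: linear_maps_closed linear_maps_comp linear_maps_sw)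

lemma braid_map_simps [simp]:
  assumes "yobj M" "yobj N" "A = msp M" "B = msp N"
  shows "t \<in> carrier (A \<boxtimes> B) \<Longrightarrow> yd_braid_map K H M N t \<in> carrier (B \<boxtimes> A)"
    and "lin K X (A \<boxtimes> B) g \<Longrightarrow> lin K X (B \<boxtimes> A) (\<lambda>x. yd_braid_map K H M N (g x))"
    and "m \<in> carrier A \<Longrightarrow> n \<in> carrier B \<Longrightarrow>
      yd_braid_map K H M N (m \<otimes>\<^bsub>A \<boxtimes> B\<^esub> n) =
      sw K (B \<boxtimes> A) V A (L M m) (\<lambda>u m0. pact N u n \<otimes>\<^bsub>B \<boxtimes> A\<^esub> m0)"
    and "Module.module K Y \<Longrightarrow> Module.module K Z \<Longrightarrow> s \<in> carrier (Y \<boxtimes> Z) \<Longrightarrow>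
      (\<And>a b. a \<in> carrier Y \<Longrightarrow> b \<in> carrier Z \<Longrightarrow> F a b \<in> carrier (A \<boxtimes> B)) \<Longrightarrow>
      yd_braid_map K H M N (sw K (A \<boxtimes> B) Y Z s F) =
      sw K (B \<boxtimes> A) Y Z s (\<lambda>a b. yd_braid_map K H M N (F a b))"
  using assms braid_map_yd[OF assms(1-2)] by (simp_all add: linear_maps_closed linear_maps_comp linear_maps_sw)

text \<open>On the three factors h acts through \<beta> \<beta>, \<beta> \<beta>, \<beta> in the
  left bracketing, but through \<beta>, \<beta> \<beta>, \<beta> \<beta> in the right one. Moving
  \<open>malpha\<close> past the action on M and \<open>malpha_inv\<close> past the action on P
  corrects exactly this, and \<open>D_coassoc\<close> regroups the legs. The twists in the coaction
  are balanced in the same way.\<close>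

lemma ymor_assoc:
  assumes [simp]: "yobj M" "yobj N" "yobj P"
  shows "ymor (yd_tensor K H (yd_tensor K H M N) P) (yd_tensor K H M (yd_tensor K H N P)) (assoc_map K M N P)"
proof (rule ymorI, simp_all only: yd_tensor_sel)
  let ?A = "(msp M \<boxtimes> msp N) \<boxtimes> msp P" and ?B = "msp M \<boxtimes> (msp N \<boxtimes> msp P)"
  show "\<forall>x\<in>carrier ?A.
    assoc_map K M N P (tensor_alpha K (yd_tensor K H M N) P x) = tensor_alpha K M (yd_tensor K H N P) (assoc_map K M N P x)"
    by (rule tensor3_ext[where P = ?B]) simp_all
  show "\<forall>x\<in>carrier ?A. assoc_map K M N P (pact (yd_tensor K H (yd_tensor K H M N) P) h x) =
      pact (yd_tensor K H M (yd_tensor K H N P)) h (assoc_map K M N P x)" if "h \<in> carrier V" for h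
    by (rule tensor3_ext[where P = ?B]) (use that in \<open>simp_all add: D_coassoc\<close>)
  show "\<forall>x\<in>carrier ?A. sw K (V \<boxtimes> ?B) V ?A (L (yd_tensor K H (yd_tensor K H M N) P) x)
      (\<lambda>u y. u \<otimes>\<^bsub>V \<boxtimes> ?B\<^esub> assoc_map K M N P y) = L (yd_tensor K H M (yd_tensor K H N P)) (assoc_map K M N P x)"
    by (rule tensor3_ext[where P = "V \<boxtimes> ?B"]) simp_all
  show "assoc_map K M N P \<in> linear_maps K ?A ?B" by (rule assoc_map_yd) simp_all
qed simp_all

lemma ymor_assoc_inv:
  assumes [simp]: "yobj M" "yobj N" "yobj P"
  shows "ymor (yd_tensor K H M (yd_tensor K H N P)) (yd_tensor K H (yd_tensor K H M N) P) (assoc_inv_map M N P)"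
proof (rule ymorI, simp_all only: yd_tensor_sel)
  let ?A = "(msp M \<boxtimes> msp N) \<boxtimes> msp P" and ?B = "msp M \<boxtimes> (msp N \<boxtimes> msp P)"
  show "\<forall>x\<in>carrier ?B.
    assoc_inv_map M N P (tensor_alpha K M (yd_tensor K H N P) x) = tensor_alpha K (yd_tensor K H M N) P (assoc_inv_map M N P x)"
    by (rule tensor3_right_ext[where P = ?A]) simp_all
  show "\<forall>x\<in>carrier ?B. assoc_inv_map M N P (pact (yd_tensor K H M (yd_tensor K H N P)) h x) =
      pact (yd_tensor K H (yd_tensor K H M N) P) h (assoc_inv_map M N P x)" if "h \<in> carrier V" for h
    by (rule tensor3_right_ext[where P = ?A]) (use that in \<open>simp_all add: D_coassoc\<close>)
  show "\<forall>x\<in>carrier ?B. sw K (V \<boxtimes> ?A) V ?B (L (yd_tensor K H M (yd_tensor K H N P)) x)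
      (\<lambda>u y. u \<otimes>\<^bsub>V \<boxtimes> ?A\<^esub> assoc_inv_map M N P y) = L (yd_tensor K H (yd_tensor K H M N) P) (assoc_inv_map M N P x)"
    by (rule tensor3_right_ext[where P = "V \<boxtimes> ?A"]) simp_all
  show "assoc_inv_map M N P \<in> linear_maps K ?B ?A" by (rule assoc_inv_map_yd) simp_all
qed simp_all

section \<open>Quasi-braiding\<close>

text \<open>Linearity over H is the Yetter-Drinfeld condition of M. Colinearity is the condition of
  N, applied to the coproduct that \<open>L_coassoc\<close> produces from two successive coactions
  on M.\<close>

lemma ymor_braid:
  assumes M [simp]: "yobj M" and N [simp]: "yobj N"
  shows "ymor (yd_tensor K H M N) (yd_tensor K H N M) (yd_braid_map K H M N)"
proof (rule ymorI, simp_all only: yd_tensor_sel)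
  let ?A = "msp M \<boxtimes> msp N" and ?B = "msp N \<boxtimes> msp M"
  let ?c = "yd_braid_map K H M N"
  show "\<forall>x\<in>carrier ?A. ?c (tensor_alpha K M N x) = tensor_alpha K N M (?c x)"
    by (rule tensor_ext[where P = ?B]) simp_all
  show "\<forall>x\<in>carrier ?A. ?c (pact (yd_tensor K H M N) h x) = pact (yd_tensor K H N M) h (?c x)"
    (is "\<forall>x\<in>_. ?l x = ?r x")
    if h: "h \<in> carrier V" for h
  proof (rule tensor_ext[where P = ?B])
    fix m n assume mn [simp]: "m \<in> carrier (msp M)" "n \<in> carrier (msp N)"
    define k where "k = \<beta> h"
    have k [simp]: "k \<in> carrier V" and h: "h = \<alpha> k" using h by (simp_all add: k_def)
    have "?l (m \<otimes>\<^bsub>?A\<^esub> n) =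
      sw K ?B V V (D k) (\<lambda>a b. sw K ?B V (msp M) (L M (pact M a m)) (\<lambda>u m0. pact N (mul u b) n \<otimes>\<^bsub>?B\<^esub> m0))"
      unfolding h by simp
    also have "\<dots> = sw K ?B V V (D k) (\<lambda>a b. sw K ?B V (msp M) (L M m) (\<lambda>u m0. pact N (mul a u) n \<otimes>\<^bsub>?B\<^esub> pact M b m0))"
      by (rule sw_yd[OF M, where f = "\<lambda>x m0. pact N x n \<otimes>\<^bsub>?B\<^esub> m0"]) simp_all
    also have "\<dots> = sw K ?B V (msp M) (L M m) (\<lambda>u m0. sw K ?B V V (D k) (\<lambda>a b. pact N (mul a u) n \<otimes>\<^bsub>?B\<^esub> pact M b m0))"
      by (rule sw_swap) simp_all
    also have "\<dots> = ?r (m \<otimes>\<^bsub>?A\<^esub> n)"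
      unfolding h by simp
    finally show "?l (m \<otimes>\<^bsub>?A\<^esub> n) = ?r (m \<otimes>\<^bsub>?A\<^esub> n)" .
  qed (use h in simp_all)
  show "\<forall>x\<in>carrier ?A. sw K (V \<boxtimes> ?B) V ?A (L (yd_tensor K H M N) x) (\<lambda>u y. u \<otimes>\<^bsub>V \<boxtimes> ?B\<^esub> ?c y) =
    L (yd_tensor K H N M) (?c x)"
    (is "\<forall>x\<in>_. ?l x = ?r x")
  proof (rule tensor_ext[where P = "V \<boxtimes> ?B"])
    fix m n assume mn [simp]: "m \<in> carrier (msp M)" "n \<in> carrier (msp N)"
    let ?P = "V \<boxtimes> ?B"
    let ?F = "\<lambda>a v n0 m0. mul (\<alpha> a) (\<alpha> v) \<otimes>\<^bsub>?P\<^esub> (n0 \<otimes>\<^bsub>?B\<^esub> m0)"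
    have "?l (m \<otimes>\<^bsub>?A\<^esub> n) =
      sw K ?P V (msp M) (L M m) (\<lambda>u m0. sw K ?P V (msp N) (L N n) (\<lambda>v n0.
        sw K ?P V (msp M) (L M m0) (\<lambda>w m00. ?F u v (pact N w n0) m00)))"
      by simp
    also have "\<dots> = sw K ?P V (msp M) (L M m) (\<lambda>u m0. sw K ?P V (msp M) (L M m0) (\<lambda>w m00.
        sw K ?P V (msp N) (L N n) (\<lambda>v n0. ?F u v (pact N w n0) m00)))"
      by (rule sw_body_cong, rule sw_swap) simp_all
    also have "\<dots> = sw K ?P V (msp M) (L M m) (\<lambda>u m0. sw K ?P V V (D u) (\<lambda>a b.
        sw K ?P V (msp N) (L N n) (\<lambda>v n0. ?F a v (pact N b n0) m0)))"
      by (rule L_coassoc) simp_all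
    also have "\<dots> = sw K ?P V (msp M) (L M m) (\<lambda>u m0. sw K ?P V V (D u) (\<lambda>a b.
        sw K ?P V (msp N) (L N (pact N a n)) (\<lambda>v n0. ?F v b n0 m0)))"
    proof (rule sw_body_cong)
      fix u m0 assume [simp]: "u \<in> carrier V" "m0 \<in> carrier (msp M)"
      show "sw K ?P V V (D u) (\<lambda>a b. sw K ?P V (msp N) (L N n) (\<lambda>v n0. ?F a v (pact N b n0) m0)) =
        sw K ?P V V (D u) (\<lambda>a b. sw K ?P V (msp N) (L N (pact N a n)) (\<lambda>v n0. ?F v b n0 m0))"
        using sw_yd[OF N, of u n ?P "\<lambda>x n0. \<alpha> x \<otimes>\<^bsub>?P\<^esub> (n0 \<otimes>\<^bsub>?B\<^esub> m0)"] by simp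
    qed
    also have "\<dots> = sw K ?P V (msp M) (L M m) (\<lambda>u m0. sw K ?P V (msp M) (L M m0) (\<lambda>w m00.
        sw K ?P V (msp N) (L N (pact N u n)) (\<lambda>v n0. ?F v w n0 m00)))"
      by (rule L_coassoc[symmetric]) simp_all
    also have "\<dots> = sw K ?P V (msp M) (L M m) (\<lambda>u m0. sw K ?P V (msp N) (L N (pact N u n)) (\<lambda>v n0.
        sw K ?P V (msp M) (L M m0) (\<lambda>w m00. ?F v w n0 m00)))"
      by (rule sw_body_cong, rule sw_swap) simp_all
    also have "\<dots> = ?r (m \<otimes>\<^bsub>?A\<^esub> n)"
      by simp
    finally show "?l (m \<otimes>\<^bsub>?A\<^esub> n) = ?r (m \<otimes>\<^bsub>?A\<^esub> n)" .
  qed simp_all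
  show "?c \<in> linear_maps K ?A ?B" by (rule braid_map_yd) simp_all
qed simp_all

section \<open>Inverse associators, naturality, pentagon and hexagons\<close>

lemma assoc_map_inverse:
  assumes [simp]: "yobj M" "yobj N" "yobj P"
  shows "\<forall>x\<in>carrier ((msp M \<boxtimes> msp N) \<boxtimes> msp P). assoc_inv_map M N P (assoc_map K M N P x) = x"
    and "\<forall>x\<in>carrier (msp M \<boxtimes> (msp N \<boxtimes> msp P)). assoc_map K M N P (assoc_inv_map M N P x) = x"
proof -
  let ?A = "(msp M \<boxtimes> msp N) \<boxtimes> msp P" and ?B = "msp M \<boxtimes> (msp N \<boxtimes> msp P)"
  show "\<forall>x\<in>carrier ?A. assoc_inv_map M N P (assoc_map K M N P x) = x"
    by (rule tensor3_ext[where P = ?A]) simp_all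
  show "\<forall>x\<in>carrier ?B. assoc_map K M N P (assoc_inv_map M N P x) = x"
    by (rule tensor3_right_ext[where P = ?B]) simp_all
qed

lemma assoc_map_natural:
  assumes [simp]: "yobj M" "yobj N" "yobj P" "yobj M'" "yobj N'" "yobj P'"
    and f: "ymor M M' f" and g: "ymor N N' g" and h: "ymor P P' h"
  shows "\<forall>x\<in>carrier ((msp M \<boxtimes> msp N) \<boxtimes> msp P).
    assoc_map K M' N' P' (tensor_map K (msp M \<boxtimes> msp N) (msp P) (msp M' \<boxtimes> msp N') (msp P')
       (tensor_map K (msp M) (msp N) (msp M') (msp N') f g) h x) =
    tensor_map K (msp M) (msp N \<boxtimes> msp P) (msp M') (msp N' \<boxtimes> msp P')
       f (tensor_map K (msp N) (msp P) (msp N') (msp P') g h) (assoc_map K M N P x)"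
proof -
  note [simp] = ymorD[OF _ _ f] ymorD[OF _ _ g] ymorD[OF _ _ h]
  show ?thesis
    by (rule tensor3_ext[where P = "msp M' \<boxtimes> (msp N' \<boxtimes> msp P')"]) simp_all
qed

text \<open>On a pure tensor of m, n, p, q both composites yield \<open>malpha\<close> twice on m,
  \<open>malpha\<close> once on n, \<open>malpha_inv\<close> once on p and \<open>malpha_inv\<close>
  twice on q.\<close>

lemma assoc_map_pentagon:
  assumes [simp]: "yobj M" "yobj N" "yobj P" "yobj Q"
  shows "\<forall>x\<in>carrier (((msp M \<boxtimes> msp N) \<boxtimes> msp P) \<boxtimes> msp Q).
    assoc_map K M N (yd_tensor K H P Q) (assoc_map K (yd_tensor K H M N) P Q x) =
    tensor_map K (msp M) ((msp N \<boxtimes> msp P) \<boxtimes> msp Q) (msp M) (msp N \<boxtimes> (msp P \<boxtimes> msp Q))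
       (\<lambda>m\<in>carrier (msp M). m) (assoc_map K N P Q) (assoc_map K M (yd_tensor K H N P) Q
      (tensor_map K ((msp M \<boxtimes> msp N) \<boxtimes> msp P) (msp Q) (msp M \<boxtimes> (msp N \<boxtimes> msp P)) (msp Q)
       (assoc_map K M N P) (\<lambda>m\<in>carrier (msp Q). m) x))"
  by (rule tensor4_ext[where P = "msp M \<boxtimes> (msp N \<boxtimes> (msp P \<boxtimes> msp Q))"]) simp_all

lemma braid_map_natural:
  assumes [simp]: "yobj M" "yobj N" "yobj M'" "yobj N'"
    and f: "ymor M M' f" and g: "ymor N N' g"
  shows "\<forall>x\<in>carrier (msp M \<boxtimes> msp N).
    yd_braid_map K H M' N' (tensor_map K (msp M) (msp N) (msp M') (msp N') f g x) =
    tensor_map K (msp N) (msp M) (msp N') (msp M') g f (yd_braid_map K H M N x)"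
proof -
  note [simp] = ymorD[OF _ _ f] ymorD[OF _ _ g]
  show ?thesis
    by (rule tensor_ext[where P = "msp N' \<boxtimes> msp M'"]) simp_all
qed

text \<open>On the left one coaction leg of U acts diagonally on the product of M and N, through its
  coproduct; on the right U coacts twice. These agree by \<open>L_coassoc\<close>.\<close>

lemma braid_map_hexagon1:
  assumes [simp]: "yobj U" "yobj M" "yobj N"
  shows "\<forall>x\<in>carrier ((msp U \<boxtimes> msp M) \<boxtimes> msp N).
    assoc_map K M N U (yd_braid_map K H U (yd_tensor K H M N) (assoc_map K U M N x)) =
    tensor_map K (msp M) (msp U \<boxtimes> msp N) (msp M) (msp N \<boxtimes> msp U) (\<lambda>m\<in>carrier (msp M). m) (yd_braid_map K H U N)
      (assoc_map K M U N (tensor_map K (msp U \<boxtimes> msp M) (msp N) (msp M \<boxtimes> msp U) (msp N)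
        (yd_braid_map K H U M) (\<lambda>m\<in>carrier (msp N). m) x))"
  by (rule tensor3_ext[where P = "msp M \<boxtimes> (msp N \<boxtimes> msp U)"]) (simp_all add: L_coassoc)

text \<open>The coaction of the product of U and M multiplies the two legs, and by
  \<open>pact_pact\<close> this product acts on N as the legs do one after the other. Only the order
  of the two sums remains to be changed.\<close>

lemma braid_map_hexagon2:
  assumes [simp]: "yobj U" "yobj M" "yobj N"
  shows "\<forall>x\<in>carrier (msp U \<boxtimes> (msp M \<boxtimes> msp N)).
    assoc_inv_map N U M (yd_braid_map K H (yd_tensor K H U M) N (assoc_inv_map U M N x)) =
    tensor_map K (msp U \<boxtimes> msp N) (msp M) (msp N \<boxtimes> msp U) (msp M) (yd_braid_map K H U N) (\<lambda>m\<in>carrier (msp M). m)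
      (assoc_inv_map U N M (tensor_map K (msp U) (msp M \<boxtimes> msp N) (msp U) (msp N \<boxtimes> msp M)
        (\<lambda>m\<in>carrier (msp U). m) (yd_braid_map K H M N) x))"
  by (rule tensor3_right_ext[where P = "(msp N \<boxtimes> msp U) \<boxtimes> msp M"]) (simp_all, rule sw_swap, simp_all)

section \<open>The category of Yetter-Drinfeld modules\<close>

lemma yd_category_simps:
  "obj (yd_category K H) = {M. yobj M}"
  "arr (yd_category K H) = {(M, f, N). yobj M \<and> yobj N \<and> ymor M N f}"
  "dom (yd_category K H) (M, f, N) = M"
  "cod (yd_category K H) (M, f, N) = N"
  "ident (yd_category K H) M = (M, \<lambda>m\<in>carrier (msp M). m, M)"
  "comp (yd_category K H) (M', g, N') (M, f, N) = (M, compose (carrier (msp M)) g f, N')"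
  "tobj (yd_category K H) = yd_tensor K H"
  "tarr (yd_category K H) (M, f, N) (M', f', N') =
    (yd_tensor K H M M', tensor_map K (msp M) (msp M') (msp N) (msp N') f f', yd_tensor K H N N')"
  "assoc (yd_category K H) M N P =
    (yd_tensor K H (yd_tensor K H M N) P, assoc_map K M N P, yd_tensor K H M (yd_tensor K H N P))"
  "braid (yd_category K H) M N = (yd_tensor K H M N, yd_braid_map K H M N, yd_tensor K H N M)"
  by (simp_all add: yd_category_def Let_def yobj_def ymor_def)

lemma ymor_extensional: "ymor M N f \<Longrightarrow> f \<in> extensional (carrier (msp M))"
  using ymor_linear_maps by (simp add: linear_maps_lin)

lemma ymor_maps_to: "ymor M N f \<Longrightarrow> f \<in> carrier (msp M) \<rightarrow> carrier (msp N)"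
  using ymor_linear_maps by (auto intro: linear_maps_closed)

lemma category_yd: "category (yd_category K H)"
proof -
  \<comment> \<open>The unit laws are equalities of functions because morphisms are extensional on
    their domain.\<close>
  have left: "compose (carrier (msp M)) (\<lambda>m\<in>carrier (msp N). m) f = f" if "ymor M N f" for M N f
    by (rule extensionalityI[OF compose_extensional ymor_extensional[OF that]])
      (use ymor_maps_to[OF that] in auto)
  have right: "compose (carrier (msp M)) f (\<lambda>m\<in>carrier (msp M). m) = f" if "ymor M N f" for M N f
    by (rule extensionalityI[OF compose_extensional ymor_extensional[OF that]])
      (use ymor_maps_to[OF that] in auto)
  have as: "compose (carrier (msp M)) h (compose (carrier (msp M)) g f) =
      compose (carrier (msp M)) (compose (carrier (msp N)) h g) f" if "ymor M N f" for M N f g h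
    using ymor_maps_to[OF that] by (intro compose_eqI) (simp add: Pi_iff)
  show ?thesis
    unfolding category_def hom_set_def
    by (auto simp: yd_category_simps ymor_id ymor_compose left right as)
qed

lemma inverse_assoc_yd:
  assumes [simp]: "yobj A" "yobj B" "yobj Q"
  shows "inverse_arrow (yd_category K H) (assoc (yd_category K H) A B Q)
    (yd_tensor K H A (yd_tensor K H B Q), assoc_inv_map A B Q, yd_tensor K H (yd_tensor K H A B) Q)"
proof -
  let ?A = "(msp A \<boxtimes> msp B) \<boxtimes> msp Q" and ?B = "msp A \<boxtimes> (msp B \<boxtimes> msp Q)"
  have "compose (carrier ?A) (assoc_inv_map A B Q) (assoc_map K A B Q) = (\<lambda>m\<in>carrier ?A. m)"
    "compose (carrier ?B) (assoc_map K A B Q) (assoc_inv_map A B Q) = (\<lambda>m\<in>carrier ?B. m)"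
    using assoc_map_inverse[of A B Q] unfolding compose_def by (auto intro!: restrict_ext)
  then show ?thesis
    by (simp add: inverse_arrow_def hom_set_def yd_category_simps ymor_assoc_inv)
qed

lemma pre_tensor_category_yd: "pre_tensor_category (yd_category K H)"
  unfolding pre_tensor_category_def
proof (intro conjI ballI impI category_yd)
  let ?C = "yd_category K H"
  fix A B assume "A \<in> obj ?C" "B \<in> obj ?C"
  then have [simp]: "yobj A" "yobj B" by (simp_all add: yd_category_simps)
  show "tobj ?C A B \<in> obj ?C" by (simp add: yd_category_simps)
  have "tensor_map K (msp A) (msp B) (msp A) (msp B) (\<lambda>m\<in>carrier (msp A). m) (\<lambda>m\<in>carrier (msp B). m) =
      (\<lambda>m\<in>carrier (msp A \<boxtimes> msp B). m)"
    by (rule linear_maps_eqI[OF lin_tensor_map(1) id_linear_maps])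
      (simp_all, rule tensor_ext[where P = "msp A \<boxtimes> msp B" and g = "\<lambda>x. x", simplified], simp_all)
  then show "tarr ?C (ident ?C A) (ident ?C B) = ident ?C (tobj ?C A B)"
    by (simp add: yd_category_simps)
next
  let ?C = "yd_category K H"
  fix f g assume "f \<in> arr ?C" "g \<in> arr ?C"
  then show "tarr ?C f g \<in> hom_set ?C (tobj ?C (dom ?C f) (dom ?C g)) (tobj ?C (cod ?C f) (cod ?C g))"
    by (auto simp: yd_category_simps hom_set_def ymor_tensor)
next
  let ?C = "yd_category K H"
  fix f f' g g'
  assume "f \<in> arr ?C" "f' \<in> arr ?C" "g \<in> arr ?C" "g' \<in> arr ?C" "cod ?C f = dom ?C f'" "cod ?C g = dom ?C g'"
  then obtain M N P M' N' P' x y x' y'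
    where eq: "f = (M, x, N)" "f' = (N, y, P)" "g = (M', x', N')" "g' = (N', y', P')"
      and [simp]: "yobj M" "yobj N" "yobj P" "yobj M'" "yobj N'" "yobj P'"
      and m: "ymor M N x" "ymor N P y" "ymor M' N' x'" "ymor N' P' y'"
    by (auto simp: yd_category_simps)
  note [simp] = ymorD[OF _ _ m(1)] ymorD[OF _ _ m(2)] ymorD[OF _ _ m(3)] ymorD[OF _ _ m(4)]
  have c: "lin K (msp M) (msp P) (compose (carrier (msp M)) y x)"
    "lin K (msp M') (msp P') (compose (carrier (msp M')) y' x')"
    using compose_linear_maps[OF _ ymorD(1)[OF _ _ m(1)] ymorD(1)[OF _ _ m(2)]]
      compose_linear_maps[OF _ ymorD(1)[OF _ _ m(3)] ymorD(1)[OF _ _ m(4)]]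
    by (simp_all add: linear_maps_lin)
  note [simp] = c
  have "tensor_map K (msp M) (msp M') (msp P) (msp P') (compose (carrier (msp M)) y x) (compose (carrier (msp M')) y' x') =
    compose (carrier (msp M \<boxtimes> msp M')) (tensor_map K (msp N) (msp N') (msp P) (msp P') y y')
      (tensor_map K (msp M) (msp M') (msp N) (msp N') x x')"
    by (rule linear_maps_eqI[OF lin_tensor_map(1) compose_linear_maps[OF _ lin_tensor_map(1) lin_tensor_map(1)]])
      (simp_all, rule tensor_ext[where P = "msp P \<boxtimes> msp P'"], simp_all)
  then show "tarr ?C (comp ?C f' f) (comp ?C g' g) = comp ?C (tarr ?C f' g') (tarr ?C f g)"
    by (simp add: eq yd_category_simps)
next
  let ?C = "yd_category K H"
  fix A B Q assume "A \<in> obj ?C" "B \<in> obj ?C" "Q \<in> obj ?C"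
  then have [simp]: "yobj A" "yobj B" "yobj Q" by (simp_all add: yd_category_simps)
  show "assoc ?C A B Q \<in> hom_set ?C (tobj ?C (tobj ?C A B) Q) (tobj ?C A (tobj ?C B Q))"
    by (simp add: yd_category_simps hom_set_def ymor_assoc)
  show "\<exists>g. inverse_arrow ?C (assoc ?C A B Q) g"
    using inverse_assoc_yd[of A B Q] by auto
next
  let ?C = "yd_category K H"
  fix f g h assume "f \<in> arr ?C" "g \<in> arr ?C" "h \<in> arr ?C"
  then show "comp ?C (assoc ?C (cod ?C f) (cod ?C g) (cod ?C h)) (tarr ?C (tarr ?C f g) h) =
      comp ?C (tarr ?C f (tarr ?C g h)) (assoc ?C (dom ?C f) (dom ?C g) (dom ?C h))"
    by (auto simp: yd_category_simps assoc_map_natural intro!: compose_eqI)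
next
  let ?C = "yd_category K H"
  fix A B Q E assume "A \<in> obj ?C" "B \<in> obj ?C" "Q \<in> obj ?C" "E \<in> obj ?C"
  then have [simp]: "yobj A" "yobj B" "yobj Q" "yobj E" by (simp_all add: yd_category_simps)
  show "comp ?C (assoc ?C A B (tobj ?C Q E)) (assoc ?C (tobj ?C A B) Q E) =
      comp ?C (comp ?C (tarr ?C (ident ?C A) (assoc ?C B Q E)) (assoc ?C A (tobj ?C B Q) E))
        (tarr ?C (assoc ?C A B Q) (ident ?C E))"
    by (simp add: yd_category_simps, rule compose_eqI) (simp add: assoc_map_pentagon)
qed

lemma quasi_braided_pre_tensor_category_yd: "quasi_braided_pre_tensor_category (yd_category K H)"
  unfolding quasi_braided_pre_tensor_category_def
proof (intro conjI ballI pre_tensor_category_yd)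
  let ?C = "yd_category K H"
  fix A B assume "A \<in> obj ?C" "B \<in> obj ?C"
  then show "braid ?C A B \<in> hom_set ?C (tobj ?C A B) (tobj ?C B A)"
    by (simp add: yd_category_simps hom_set_def ymor_braid)
next
  let ?C = "yd_category K H"
  fix f g assume "f \<in> arr ?C" "g \<in> arr ?C"
  then show "comp ?C (braid ?C (cod ?C f) (cod ?C g)) (tarr ?C f g) =
      comp ?C (tarr ?C g f) (braid ?C (dom ?C f) (dom ?C g))"
    by (auto simp: yd_category_simps braid_map_natural intro!: compose_eqI)
next
  let ?C = "yd_category K H"
  fix U A B assume "U \<in> obj ?C" "A \<in> obj ?C" "B \<in> obj ?C"
  then have [simp]: "yobj U" "yobj A" "yobj B" by (simp_all add: yd_category_simps)
  show "comp ?C (comp ?C (assoc ?C A B U) (braid ?C U (tobj ?C A B))) (assoc ?C U A B) =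
      comp ?C (comp ?C (tarr ?C (ident ?C A) (braid ?C U B)) (assoc ?C A U B))
        (tarr ?C (braid ?C U A) (ident ?C B))"
    by (simp add: yd_category_simps, rule compose_eqI) (simp add: braid_map_hexagon1)
  \<comment> \<open>Uniqueness of inverses replaces the definite description by the explicit
    inverse, so the hexagon becomes an equation between concrete maps.\<close>
  have inv: "inv_arrow ?C (assoc ?C A B Q) =
      (yd_tensor K H A (yd_tensor K H B Q), assoc_inv_map A B Q, yd_tensor K H (yd_tensor K H A B) Q)"
    if "yobj A" "yobj B" "yobj Q" for A B Q
    using that by (intro inv_arrow_eq[OF category_yd _ inverse_assoc_yd])
      (simp_all add: yd_category_simps ymor_assoc)
  show "comp ?C (comp ?C (inv_arrow ?C (assoc ?C B U A)) (braid ?C (tobj ?C U A) B)) (inv_arrow ?C (assoc ?C U A B)) =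
      comp ?C (comp ?C (tarr ?C (braid ?C U B) (ident ?C A)) (inv_arrow ?C (assoc ?C U B A)))
        (tarr ?C (ident ?C U) (braid ?C A B))"
    by (simp add: inv, simp add: yd_category_simps, rule compose_eqI) (simp add: braid_map_hexagon2)
qed

end

section \<open>Coquasitriangular structures\<close>

locale coquasitriangular_hom_bialgebra = hom_bialgebra_bij K H
  for K :: "('k, 'r) ring_scheme" and H :: "('k, 'a) hom_bialg" +
  fixes \<sigma> :: "'a univ \<Rightarrow> 'k"
  assumes cqt: "coquasitriangular K H \<sigma>"
    and \<sigma>_inv: "\<forall>t\<in>carrier (V \<boxtimes> V). \<sigma> t = \<sigma> (tensor_map K V V V V \<alpha> \<alpha> t)"
begin

definition s :: "'a univ \<Rightarrow> 'a univ \<Rightarrow> 'k" where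
  "s u v = \<sigma> (u \<otimes>\<^bsub>V \<boxtimes> V\<^esub> v)"

lemma cqt_raw:
  shows "\<sigma> \<in> linear_maps K (V \<boxtimes> V) (self_module K)"
    and "\<forall>x\<in>carrier V. \<forall>y\<in>carrier V. \<forall>z\<in>carrier V. s (hprod K H x y) (\<alpha> z) =
      sweedler K (hdelta H z) (\<lambda>z1 z2. s (\<alpha> x) z1 \<otimes>\<^bsub>K\<^esub> s (\<alpha> y) z2)"
    and "\<forall>x\<in>carrier V. \<forall>y\<in>carrier V. \<forall>z\<in>carrier V. s (\<alpha> x) (hprod K H y z) =
      sweedler K (hdelta H x) (\<lambda>x1 x2. s x1 (\<alpha> z) \<otimes>\<^bsub>K\<^esub> s x2 (\<alpha> y))"
    and "\<forall>x\<in>carrier V. \<forall>y\<in>carrier V.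
      sweedler V (hdelta H x) (\<lambda>x1 x2. sweedler V (hdelta H y) (\<lambda>y1 y2. s x2 y2 \<odot>\<^bsub>V\<^esub> hprod K H y1 x1)) =
      sweedler V (hdelta H x) (\<lambda>x1 x2. sweedler V (hdelta H y) (\<lambda>y1 y2. s x1 y1 \<odot>\<^bsub>V\<^esub> hprod K H x2 y2))"
  using cqt unfolding coquasitriangular_def Let_def s_def by - (elim conjE, assumption)+

lemma s_bilin: "bilin K V V (self_module K) s"
proof -
  have "lin K (V \<boxtimes> V) (self_module K) \<sigma>" using cqt_raw(1) by (simp add: linear_maps_lin)
  then show ?thesis unfolding s_def by (simp add: lin_comp[OF _ \<open>lin K _ _ \<sigma>\<close>])
qed

lemmas s_lin [simp] = bilin_left[OF s_bilin] bilin_right[OF s_bilin]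

lemma s_closed [simp]: "u \<in> carrier V \<Longrightarrow> v \<in> carrier V \<Longrightarrow> s u v \<in> carrier K"
  using bilin_closed[OF s_bilin] by simp

lemma smult_closed [simp]:
  "Module.module K P \<Longrightarrow> a \<in> carrier K \<Longrightarrow> p \<in> carrier P \<Longrightarrow> a \<odot>\<^bsub>P\<^esub> p \<in> carrier P"
  by (rule module.smult_closed)

lemma s_alpha_alpha: "u \<in> carrier V \<Longrightarrow> v \<in> carrier V \<Longrightarrow> s (\<alpha> u) (\<alpha> v) = s u v"
  using \<sigma>_inv[THEN bspec, of "u \<otimes>\<^bsub>V \<boxtimes> V\<^esub> v"] by (simp add: s_def raw_lin)

text \<open>Invariance of \<sigma> moves a twist from one argument to the other with its direction
  reversed. Collecting all twists in the second argument gives a normal form in which they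
  cancel.\<close>

lemma s_alpha [simp]: "u \<in> carrier V \<Longrightarrow> v \<in> carrier V \<Longrightarrow> s (\<alpha> u) v = s u (\<beta> v)"
  and s_beta [simp]: "u \<in> carrier V \<Longrightarrow> v \<in> carrier V \<Longrightarrow> s (\<beta> u) v = s u (\<alpha> v)"
  using s_alpha_alpha[of u "\<beta> v"] s_alpha_alpha[of "\<beta> u" v] by simp_all

text \<open>By invariance all twists of the axiom cancel. The result is stated for scalars acting on
  a module element, the form in which pairings occur in Sweedler sums, so that products in K become
  iterated scalar multiplications.\<close>

lemma s_mul_left [simp]:
  assumes P: "Module.module K P" and xyz: "x \<in> carrier V" "y \<in> carrier V" "z \<in> carrier V" and p: "p \<in> carrier P"
  shows "s (mul x y) z \<odot>\<^bsub>P\<^esub> p = sw K P V V (D z) (\<lambda>z1 z2. s x z1 \<odot>\<^bsub>P\<^esub> (s y z2 \<odot>\<^bsub>P\<^esub> p))"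
proof -
  interpret P: Module.module K P by fact
  have "s (hprod K H x y) (\<alpha> z) = sweedler K (hdelta H z) (\<lambda>z1 z2. s (\<alpha> x) z1 \<otimes>\<^bsub>K\<^esub> s (\<alpha> y) z2)"
    using xyz by (intro cqt_raw(2)[rule_format])
  also have "\<dots> = sw K (self_module K) V V (D z) (\<lambda>z1 z2. s x z1 \<otimes>\<^bsub>K\<^esub> s y z2)"
    using xyz
    \<comment> \<open>The product of K is the scalar multiplication of \<open>self_module K\<close>,
      so the rules for scalars supply its bilinearity.\<close>
    by (simp add: lin_smult_left[OF module_K, unfolded self_module_simps] lin_smult_right[OF module_K, unfolded self_module_simps]
        sweedler_self_module[of K, symmetric] hdelta_eq sweedler_D)
  finally have *: "s (mul x y) z = sw K (self_module K) V V (D z) (\<lambda>z1 z2. s x z1 \<otimes>\<^bsub>K\<^esub> s y z2)"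
    using xyz by (simp add: hprod_eq s_alpha_alpha del: s_alpha alpha_mul)
  have "s (mul x y) z \<odot>\<^bsub>P\<^esub> p = sw K P V V (D z) (\<lambda>z1 z2. (s x z1 \<otimes>\<^bsub>K\<^esub> s y z2) \<odot>\<^bsub>P\<^esub> p)"
    unfolding * by (rule sw_lin[where g = "\<lambda>a. a \<odot>\<^bsub>P\<^esub> p"]) (use P xyz p in simp_all)
  also have "\<dots> = sw K P V V (D z) (\<lambda>z1 z2. s x z1 \<odot>\<^bsub>P\<^esub> (s y z2 \<odot>\<^bsub>P\<^esub> p))"
    using xyz p by (intro sw_body_cong P.smult_assoc1) simp_all
  finally show ?thesis .
qed

text \<open>As for \<open>s_mul_left\<close>, but in this axiom the legs of x meet the two factors
  in reversed order.\<close>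

lemma s_mul_right [simp]:
  assumes P: "Module.module K P" and xyz: "x \<in> carrier V" "y \<in> carrier V" "z \<in> carrier V" and p: "p \<in> carrier P"
  shows "s x (mul y z) \<odot>\<^bsub>P\<^esub> p = sw K P V V (D x) (\<lambda>x1 x2. s x1 z \<odot>\<^bsub>P\<^esub> (s x2 y \<odot>\<^bsub>P\<^esub> p))"
proof -
  interpret P: Module.module K P by fact
  have "s (\<alpha> x) (hprod K H y z) = sweedler K (hdelta H x) (\<lambda>x1 x2. s x1 (\<alpha> z) \<otimes>\<^bsub>K\<^esub> s x2 (\<alpha> y))"
    using xyz by (intro cqt_raw(3)[rule_format])
  also have "\<dots> = sw K (self_module K) V V (D x) (\<lambda>x1 x2. s x1 z \<otimes>\<^bsub>K\<^esub> s x2 y)"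
    using xyz
    by (simp add: lin_smult_left[OF module_K, unfolded self_module_simps] lin_smult_right[OF module_K, unfolded self_module_simps]
        sweedler_self_module[of K, symmetric] hdelta_eq sweedler_D)
  finally have *: "s x (mul y z) = sw K (self_module K) V V (D x) (\<lambda>x1 x2. s x1 z \<otimes>\<^bsub>K\<^esub> s x2 y)"
    using xyz by (simp add: hprod_eq s_alpha_alpha del: s_alpha alpha_mul)
  have "s x (mul y z) \<odot>\<^bsub>P\<^esub> p = sw K P V V (D x) (\<lambda>x1 x2. (s x1 z \<otimes>\<^bsub>K\<^esub> s x2 y) \<odot>\<^bsub>P\<^esub> p)"
    unfolding * by (rule sw_lin[where g = "\<lambda>a. a \<odot>\<^bsub>P\<^esub> p"]) (use P xyz p in simp_all)
  also have "\<dots> = sw K P V V (D x) (\<lambda>x1 x2. s x1 z \<odot>\<^bsub>P\<^esub> (s x2 y \<odot>\<^bsub>P\<^esub> p))"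
    using xyz p by (intro sw_body_cong P.smult_assoc1) simp_all
  finally show ?thesis .
qed

text \<open>The commutation axiom is taken at \<beta> x and \<beta> y, where \<open>hdelta\<close>
  becomes \<open>D\<close>. Applying \<open>f\<close> after \<beta> turns \<open>hprod\<close> into
  \<open>mul\<close>, and linearity brings the result inside the sums.\<close>

lemma s_comm:
  fixes P :: "('k, 'p) module"
  assumes P [simp]: "Module.module K P" and xy [simp]: "x \<in> carrier V" "y \<in> carrier V" and f: "lin K V P f"
  shows "sw K P V V (D x) (\<lambda>x1 x2. sw K P V V (D y) (\<lambda>y1 y2. s x2 y2 \<odot>\<^bsub>P\<^esub> f (mul y1 x1))) =
    sw K P V V (D x) (\<lambda>x1 x2. sw K P V V (D y) (\<lambda>y1 y2. s x1 y1 \<odot>\<^bsub>P\<^esub> f (mul x2 y2)))"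
proof -
  have fl: "f (\<beta> (sw K V A B t F)) = sw K P A B t (\<lambda>a b. f (\<beta> (F a b)))"
    if "Module.module K A" "Module.module K B" "t \<in> carrier (A \<boxtimes> B)"
      "\<And>a b. a \<in> carrier A \<Longrightarrow> b \<in> carrier B \<Longrightarrow> F a b \<in> carrier V" for A B t F
    by (rule sw_lin[OF _ _ _ lin_comp[OF beta_lin f]]) (use that in simp_all)
  have fs: "f (\<beta> (a \<odot>\<^bsub>V\<^esub> v)) = a \<odot>\<^bsub>P\<^esub> f (\<beta> v)" if "a \<in> carrier K" "v \<in> carrier V" for a v
    using that by (rule lin_smult[OF lin_comp[OF beta_lin f]])
  note [simp] = lin_comp[OF _ f] lin_closed[OF f] fl fs
  let ?x = "\<beta> x" and ?y = "\<beta> y"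
  have "sweedler V (hdelta H ?x) (\<lambda>x1 x2. sweedler V (hdelta H ?y) (\<lambda>y1 y2. s x2 y2 \<odot>\<^bsub>V\<^esub> hprod K H y1 x1)) =
      sweedler V (hdelta H ?x) (\<lambda>x1 x2. sweedler V (hdelta H ?y) (\<lambda>y1 y2. s x1 y1 \<odot>\<^bsub>V\<^esub> hprod K H x2 y2))"
    using xy by (intro cqt_raw(4)[rule_format]) simp_all
  then have *: "sw K V V V (D x) (\<lambda>x1 x2. sw K V V V (D y) (\<lambda>y1 y2. s x2 y2 \<odot>\<^bsub>V\<^esub> hprod K H y1 x1)) =
      sw K V V V (D x) (\<lambda>x1 x2. sw K V V V (D y) (\<lambda>y1 y2. s x1 y1 \<odot>\<^bsub>V\<^esub> hprod K H x2 y2))"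
    by (simp add: D_def[symmetric] sweedler_D)
  have "f (\<beta> (sw K V V V (D x) (\<lambda>x1 x2. sw K V V V (D y) (\<lambda>y1 y2. s x2 y2 \<odot>\<^bsub>V\<^esub> hprod K H y1 x1)))) =
    sw K P V V (D x) (\<lambda>x1 x2. sw K P V V (D y) (\<lambda>y1 y2. s x2 y2 \<odot>\<^bsub>P\<^esub> f (mul y1 x1)))"
    by (simp add: mul_def[symmetric])
  moreover have "f (\<beta> (sw K V V V (D x) (\<lambda>x1 x2. sw K V V V (D y) (\<lambda>y1 y2. s x1 y1 \<odot>\<^bsub>V\<^esub> hprod K H x2 y2)))) =
    sw K P V V (D x) (\<lambda>x1 x2. sw K P V V (D y) (\<lambda>y1 y2. s x1 y1 \<odot>\<^bsub>P\<^esub> f (mul x2 y2)))"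
    by (simp add: mul_def[symmetric])
  ultimately show ?thesis unfolding * by simp
qed

section \<open>Comodules as Yetter-Drinfeld modules\<close>

abbreviation "YD \<equiv> comod_to_yd K H \<sigma>"

lemma comod_to_yd_sel [simp]:
  "msp (YD M) = msp M" "malpha (YD M) = malpha M" "mcoact (YD M) = mcoact M"
  by (simp_all add: comod_to_yd_def)

lemma comod_to_yd_primed [simp]: "malpha_inv (YD M) = malpha_inv M" "L (YD M) = L M"
  by (simp_all add: malpha_inv_def L_def fun_eq_iff)

lemma cobj_comod_to_yd [simp]: "cobj (YD M) = cobj M"
  unfolding cobj_def left_comodule_def by (simp only: comod_to_yd_sel)

lemma mact_comod_to_yd:
  assumes [simp]: "cobj M"
  shows "mact (YD M) = (\<lambda>t\<in>carrier (V \<boxtimes> msp M). sw K (msp M) V (msp M) t (\<lambda>h m.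
      sw K (msp M) V (msp M) (L M m) (\<lambda>u m0. s u h \<odot>\<^bsub>msp M\<^esub> malpha M m0)))"
  unfolding comod_to_yd_def s_def[symmetric] hom_yd.simps
  by (rule restrict_ext) (simp add: sweedler_eq_sw[of K V "msp M"] mcoact_eq sweedler_L)

lemma mact_linear: "cobj M \<Longrightarrow> mact (YD M) \<in> linear_maps K (V \<boxtimes> msp M) (msp M)"
  unfolding mact_comod_to_yd by (rule linear_maps_restrict) simp_all

text \<open>The \<alpha> on h prescribed in the action cancels, by invariance of \<sigma>, against
  the \<alpha> that \<open>mcoact_eq\<close> puts on the coaction leg; the \<open>malpha M\<close>
  on the other leg is cancelled by \<open>malpha_inv M\<close>.\<close>

lemma pact_comod_to_yd [simp]:
  assumes [simp]: "cobj M" "h \<in> carrier V" "m \<in> carrier (msp M)"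
  shows "pact (YD M) h m = sw K (msp M) V (msp M) (L M m) (\<lambda>u m0. s u h \<odot>\<^bsub>msp M\<^esub> m0)"
proof -
  have "malpha_inv M (sw K (msp M) V (msp M) (L M m) (\<lambda>u m0. s u h \<odot>\<^bsub>msp M\<^esub> malpha M m0)) =
     sw K (msp M) V (msp M) (L M m) (\<lambda>u m0. malpha_inv M (s u h \<odot>\<^bsub>msp M\<^esub> malpha M m0))"
    by (rule sw_lin[OF _ _ _ malpha_inv_lin]) simp_all
  also have "\<dots> = sw K (msp M) V (msp M) (L M m) (\<lambda>u m0. s u h \<odot>\<^bsub>msp M\<^esub> m0)"
    by (rule sw_body_cong) (simp add: lin_smult[OF malpha_inv_lin])
  finally show ?thesis by (simp add: pact_def act_def mact_comod_to_yd)
qed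

lemma yobj_comod_to_yd [simp]:
  assumes M [simp]: "cobj M"
  shows "yobj (YD M)"
proof -
  have [simp]: "malpha M (sw K (msp M) A B t f) = sw K (msp M) A B t (\<lambda>a b. malpha M (f a b))"
    "L M (sw K (msp M) A B t f) = sw K (V \<boxtimes> msp M) A B t (\<lambda>a b. L M (f a b))"
    if "Module.module K A" "Module.module K B" "t \<in> carrier (A \<boxtimes> B)"
      "\<And>a b. a \<in> carrier A \<Longrightarrow> b \<in> carrier B \<Longrightarrow> f a b \<in> carrier (msp M)" for A B t f
    using that by (auto intro!: sw_lin cobj_raw_lin L_lin)
  note [simp] = lin_smult[OF cobj_raw_lin(1)] lin_smult[OF L_lin]
  show ?thesis
  proof (rule yobjI, simp_all only: comod_to_yd_sel comod_to_yd_primed cobj_comod_to_yd M)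
    show "mact (YD M) \<in> linear_maps K (V \<boxtimes> msp M) (msp M)" by (rule mact_linear[OF M])
    fix h m assume hm [simp]: "h \<in> carrier V" "m \<in> carrier (msp M)"
    show "malpha M (pact (YD M) h m) = pact (YD M) (\<alpha> h) (malpha M m)" by simp
    show "pact (YD M) h (pact (YD M) k m) = pact (YD M) (mul h k) m" if [simp]: "k \<in> carrier V" for k
      \<comment> \<open>Both sides become the sum of the pairings of the first leg of u with k and
        of its second leg with h. The reversed order in \<open>s_mul_right\<close> is what makes
        this a left action.\<close>
      by (simp add: L_coassoc)
    let ?P = "V \<boxtimes> msp M"
    show "sw K ?P V V (D h) (\<lambda>h1 h2. sw K ?P V (msp M) (L M (pact (YD M) h1 m)) (\<lambda>u n. mul u h2 \<otimes>\<^bsub>?P\<^esub> n)) =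
       sw K ?P V V (D h) (\<lambda>h1 h2. sw K ?P V (msp M) (L M m) (\<lambda>u n. mul h1 u \<otimes>\<^bsub>?P\<^esub> pact (YD M) h2 n))"
      (is "?l = ?r")
    \<comment> \<open>\<open>L_coassoc\<close> turns both sides into sums over the coproducts of h
      and of the coaction leg u. \<open>s_comm\<close> at u and h relates them, and the exchanges
      bring the sum over \<open>D u\<close> outside the one over \<open>D h\<close>, as that rule
      requires.\<close>
    proof -
      have "?l =
         sw K ?P V V (D h) (\<lambda>h1 h2. sw K ?P V (msp M) (L M m) (\<lambda>u m0. sw K ?P V V (D u) (\<lambda>a b.
           s a h1 \<odot>\<^bsub>?P\<^esub> (mul b h2 \<otimes>\<^bsub>?P\<^esub> m0))))"
        by (simp add: L_coassoc)
      also have "\<dots> = sw K ?P V (msp M) (L M m) (\<lambda>u m0. sw K ?P V V (D h) (\<lambda>h1 h2. sw K ?P V V (D u) (\<lambda>a b.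
           s a h1 \<odot>\<^bsub>?P\<^esub> (mul b h2 \<otimes>\<^bsub>?P\<^esub> m0))))"
        by (rule sw_swap) simp_all
      also have "\<dots> = sw K ?P V (msp M) (L M m) (\<lambda>u m0. sw K ?P V V (D u) (\<lambda>a b. sw K ?P V V (D h) (\<lambda>h1 h2.
           s a h1 \<odot>\<^bsub>?P\<^esub> (mul b h2 \<otimes>\<^bsub>?P\<^esub> m0))))"
        by (rule sw_body_cong, rule sw_swap) simp_all
      also have "\<dots> = sw K ?P V (msp M) (L M m) (\<lambda>u m0. sw K ?P V V (D u) (\<lambda>a b. sw K ?P V V (D h) (\<lambda>h1 h2.
           s b h2 \<odot>\<^bsub>?P\<^esub> (mul h1 a \<otimes>\<^bsub>?P\<^esub> m0))))"
        by (rule sw_body_cong, rule s_comm[symmetric]) simp_all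
      also have "\<dots> = sw K ?P V (msp M) (L M m) (\<lambda>u m0. sw K ?P V V (D h) (\<lambda>h1 h2. sw K ?P V V (D u) (\<lambda>a b.
           s b h2 \<odot>\<^bsub>?P\<^esub> (mul h1 a \<otimes>\<^bsub>?P\<^esub> m0))))"
        by (rule sw_body_cong, rule sw_swap) simp_all
      also have "\<dots> = sw K ?P V V (D h) (\<lambda>h1 h2. sw K ?P V (msp M) (L M m) (\<lambda>u m0. sw K ?P V V (D u) (\<lambda>a b.
           s b h2 \<odot>\<^bsub>?P\<^esub> (mul h1 a \<otimes>\<^bsub>?P\<^esub> m0))))"
        by (rule sw_swap) simp_all
      also have "\<dots> = ?r"
        by (simp add: L_coassoc)
      finally show ?thesis .
    qed
  qed
qed

lemma comodule_morphism_comod_to_yd: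
  "comodule_morphism K H (YD M) (YD N) f = comodule_morphism K H M N f"
  unfolding comodule_morphism_def by (simp only: comod_to_yd_sel)

text \<open>The action is assembled from the coaction and scalars, both of which a comodule morphism
  respects. This is what makes the embedding full.\<close>

lemma ymor_comod_to_yd:
  assumes M [simp]: "cobj M" and N [simp]: "cobj N"
  shows "ymor (YD M) (YD N) f \<longleftrightarrow> comodule_morphism K H M N f"
proof
  show "ymor (YD M) (YD N) f \<Longrightarrow> comodule_morphism K H M N f"
    by (simp add: ymor_def comodule_morphism_comod_to_yd)
next
  assume f: "comodule_morphism K H M N f"
  note C = comodule_morphism_L[OF M N f]
  have 0: "f \<in> linear_maps K (msp M) (msp N)" using f by (simp add: comodule_morphism_def)
  then have 1: "lin K (msp M) (msp N) f" by (simp add: linear_maps_lin)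
  note [simp] = C(3-5) lin_smult[OF 1] lin_comp[OF _ 1] C(6)
  have [simp]: "f (sw K (msp M) A B t F) = sw K (msp N) A B t (\<lambda>a b. f (F a b))"
    if "Module.module K A" "Module.module K B" "t \<in> carrier (A \<boxtimes> B)"
      "\<And>a b. a \<in> carrier A \<Longrightarrow> b \<in> carrier B \<Longrightarrow> F a b \<in> carrier (msp M)" for A B t F
    by (rule sw_lin[OF _ _ _ 1]) (use that in simp_all)
  show "ymor (YD M) (YD N) f"
    by (rule ymorI) (use 0 in simp_all)
qed

section \<open>Strict compatibility of the embedding with the structure\<close>

lemma comod_tensor_sel [simp]:
  "msp (comod_tensor K H M N) = msp M \<boxtimes> msp N"
  "malpha (comod_tensor K H M N) = tensor_alpha K (YD M) (YD N)"
  "mcoact (comod_tensor K H M N) = tensor_coact K H (YD M) (YD N)"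
  by (simp_all add: comod_tensor_def tensor_alpha_def tensor_coact_def)

lemma comod_tensor_primed:
  "malpha_inv (comod_tensor K H M N) = malpha_inv (yd_tensor K H (YD M) (YD N))"
  "L (comod_tensor K H M N) = L (yd_tensor K H (YD M) (YD N))"
  by (simp_all add: malpha_inv_def L_def fun_eq_iff)

lemma cobj_comod_tensor [simp]:
  assumes "cobj M" "cobj N"
  shows "cobj (comod_tensor K H M N)"
proof -
  have "cobj (yd_tensor K H (YD M) (YD N))" using assms by simp
  then show ?thesis
    unfolding cobj_def left_comodule_def by (simp only: comod_tensor_sel yd_tensor_sel comod_to_yd_sel)
qed

text \<open>The two records agree in all other fields, so only the actions are compared.
  \<open>s_mul_left\<close> distributes the pairing with a product of two coaction legs over
  \<open>D h\<close>, and invariance of \<sigma> converts the \<alpha> in the tensor coaction into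
  the \<beta> in the tensor action.\<close>

lemma comod_to_yd_tensor:
  assumes [simp]: "cobj M" "cobj N"
  shows "YD (comod_tensor K H M N) = yd_tensor K H (YD M) (YD N)"
proof -
  let ?C = "comod_tensor K H M N" and ?T = "yd_tensor K H (YD M) (YD N)"
  let ?MN = "msp M \<boxtimes> msp N"
  note [simp] = comod_tensor_primed
  have C: "yobj (YD ?C)" and T: "yobj ?T" by simp_all
  have 1: "mact (YD ?C) \<in> linear_maps K (V \<boxtimes> ?MN) ?MN" "mact ?T \<in> linear_maps K (V \<boxtimes> ?MN) ?MN"
    using yobj_raw(1)[OF C] yobj_raw(1)[OF T] by simp_all
  then have l: "lin K (V \<boxtimes> ?MN) ?MN (mact (YD ?C))" "lin K (V \<boxtimes> ?MN) ?MN (mact ?T)"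
    unfolding linear_maps_lin by simp_all
  have "mact (YD ?C) = mact ?T"
  proof (rule linear_maps_eqI[OF 1], rule tensor3_right_ext[OF _ _ _ _ l])
    fix h m n assume [simp]: "h \<in> carrier V" "m \<in> carrier (msp M)" "n \<in> carrier (msp N)"
    \<comment> \<open>The expansions of the two actions differ only in the order of the three sums
      and of the two scalars.\<close>
    have sums: "sw K ?MN V V (D h) (\<lambda>h1 h2. sw K ?MN V (msp N) (L N n) (\<lambda>v n0. sw K ?MN V (msp M) (L M m) (\<lambda>u m0.
        s v (\<beta> h2) \<odot>\<^bsub>?MN\<^esub> (s u (\<beta> h1) \<odot>\<^bsub>?MN\<^esub> (m0 \<otimes>\<^bsub>?MN\<^esub> n0))))) =
      sw K ?MN V (msp M) (L M m) (\<lambda>u m0. sw K ?MN V (msp N) (L N n) (\<lambda>v n0. sw K ?MN V V (D h) (\<lambda>h1 h2.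
        s u (\<beta> h1) \<odot>\<^bsub>?MN\<^esub> (s v (\<beta> h2) \<odot>\<^bsub>?MN\<^esub> (m0 \<otimes>\<^bsub>?MN\<^esub> n0)))))" (is "?l = ?r")
    proof -
      have "?l = sw K ?MN V V (D h) (\<lambda>h1 h2. sw K ?MN V (msp M) (L M m) (\<lambda>u m0. sw K ?MN V (msp N) (L N n) (\<lambda>v n0.
        s v (\<beta> h2) \<odot>\<^bsub>?MN\<^esub> (s u (\<beta> h1) \<odot>\<^bsub>?MN\<^esub> (m0 \<otimes>\<^bsub>?MN\<^esub> n0)))))"
        by (rule sw_body_cong, rule sw_swap) simp_all
      also have "\<dots> = sw K ?MN V V (D h) (\<lambda>h1 h2. sw K ?MN V (msp M) (L M m) (\<lambda>u m0. sw K ?MN V (msp N) (L N n) (\<lambda>v n0.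
        s u (\<beta> h1) \<odot>\<^bsub>?MN\<^esub> (s v (\<beta> h2) \<odot>\<^bsub>?MN\<^esub> (m0 \<otimes>\<^bsub>?MN\<^esub> n0)))))"
        by (rule sw_body_cong, rule sw_body_cong, rule sw_body_cong, rule smult_left_commute[where K = K]) simp_all
      also have "\<dots> = sw K ?MN V (msp M) (L M m) (\<lambda>u m0. sw K ?MN V V (D h) (\<lambda>h1 h2. sw K ?MN V (msp N) (L N n) (\<lambda>v n0.
        s u (\<beta> h1) \<odot>\<^bsub>?MN\<^esub> (s v (\<beta> h2) \<odot>\<^bsub>?MN\<^esub> (m0 \<otimes>\<^bsub>?MN\<^esub> n0)))))"
        by (rule sw_swap) simp_all
      also have "\<dots> = ?r"
        by (rule sw_body_cong, rule sw_swap) simp_all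
      finally show ?thesis .
    qed
    have p: "pact (YD ?C) h (m \<otimes>\<^bsub>?MN\<^esub> n) = pact ?T h (m \<otimes>\<^bsub>?MN\<^esub> n)"
      by (simp add: sums)
    have "act K H (YD ?C) h (m \<otimes>\<^bsub>?MN\<^esub> n) = act K H ?T h (m \<otimes>\<^bsub>?MN\<^esub> n)"
      \<comment> \<open>\<open>act\<close> is \<open>malpha\<close> after \<open>pact\<close>, and
        both objects have the same twist, so comparing \<open>pact\<close> suffices.\<close>
      by (subst (1 2) act_eq) (simp_all del: pact_comod_to_yd yd_tensor_simps malpha_pact add: p)
    then show "mact (YD ?C) (h \<otimes>\<^bsub>V \<boxtimes> ?MN\<^esub> (m \<otimes>\<^bsub>?MN\<^esub> n)) = mact ?T (h \<otimes>\<^bsub>V \<boxtimes> ?MN\<^esub> (m \<otimes>\<^bsub>?MN\<^esub> n))"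
      by (simp only: act_def comod_to_yd_sel comod_tensor_sel yd_tensor_sel)
  qed (simp_all only: module_V cobj_module module_tensor_prod assms)
  then show ?thesis by (intro hom_yd.equality) simp_all
qed

text \<open>In the Yetter-Drinfeld braiding the leg u of m acts on n, and by definition of the
  action this pairs the coaction leg of n with u.\<close>

lemma comod_braid_map_eq:
  assumes [simp]: "cobj M" "cobj N"
  shows "comod_braid_map K H \<sigma> M N = yd_braid_map K H (YD M) (YD N)"
proof -
  have "comod_braid_map K H \<sigma> M N = (\<lambda>x\<in>carrier (msp M \<boxtimes> msp N).
     sw K (msp N \<boxtimes> msp M) (msp M) (msp N) x (\<lambda>m n.
       sw K (msp N \<boxtimes> msp M) V (msp M) (L M m) (\<lambda>u m0. sw K (msp N \<boxtimes> msp M) V (msp N) (L N n) (\<lambda>v n0.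
         s v u \<odot>\<^bsub>msp N \<boxtimes> msp M\<^esub> (n0 \<otimes>\<^bsub>msp N \<boxtimes> msp M\<^esub> m0)))))"
    unfolding comod_braid_map_def Let_def s_def[symmetric]
    by (rule restrict_ext) (simp add: sweedler_eq_sw[of K "msp M" "msp N"] mcoact_eq sweedler_L)
  also have "\<dots> = yd_braid_map K H (YD M) (YD N)"
    by (subst braid_map_eq) simp_all
  finally show ?thesis .
qed

lemma assoc_map_comod_to_yd: "assoc_map K (YD M) (YD N) (YD P) = assoc_map K M N P"
  by (simp add: assoc_map_def)

lemma inj_comod_to_yd: "inj YD"
proof (rule injI)
  fix M N :: "('k, 'a) hom_comod" assume "YD M = YD N"
  then have "msp M = msp N" "malpha M = malpha N" "mcoact M = mcoact N"
    by (metis comod_to_yd_sel)+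
  then show "M = N" by simp
qed

section \<open>The embedding of the category of comodules\<close>

lemma comod_category_simps:
  "obj (comod_category K H \<sigma>) = {M. cobj M}"
  "arr (comod_category K H \<sigma>) = {(M, f, N). cobj M \<and> cobj N \<and> comodule_morphism K H M N f}"
  "dom (comod_category K H \<sigma>) x = fst x"
  "cod (comod_category K H \<sigma>) x = snd (snd x)"
  "ident (comod_category K H \<sigma>) M = (M, \<lambda>m\<in>carrier (msp M). m, M)"
  "comp (comod_category K H \<sigma>) (M', g, N') (M, f, N) = (M, compose (carrier (msp M)) g f, N')"
  "tobj (comod_category K H \<sigma>) = comod_tensor K H"
  "tarr (comod_category K H \<sigma>) (M, f, N) (M', f', N') =
    (comod_tensor K H M M', tensor_map K (msp M) (msp M') (msp N) (msp N') f f', comod_tensor K H N N')"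
  "assoc (comod_category K H \<sigma>) M N P =
    (comod_tensor K H (comod_tensor K H M N) P, assoc_map K M N P, comod_tensor K H M (comod_tensor K H N P))"
  "braid (comod_category K H \<sigma>) M N = (comod_tensor K H M N, comod_braid_map K H \<sigma> M N, comod_tensor K H N M)"
  by (simp_all add: comod_category_def Let_def cobj_def split_def)

text \<open>Arrows keep their underlying maps, so recognising them is
  \<open>ymor_comod_to_yd\<close>; the conditions on tensor products, associators and braidings rest
  on \<open>comod_to_yd_tensor\<close> and on the equality of the underlying maps.\<close>

lemma full_embedding_comod_to_yd:
  "full_embedding YD (\<lambda>(M, f, N). (YD M, f, YD N)) (comod_category K H \<sigma>) (yd_category K H)"
proof
  let ?C = "comod_category K H \<sigma>" and ?D = "yd_category K H" and ?G = "\<lambda>(M, f, N). (YD M, f, YD N)"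
  note [simp] = comod_category_simps yd_category_simps
  show "quasi_braided_pre_tensor_category ?D" by (rule quasi_braided_pre_tensor_category_yd)
  show "YD A \<in> obj ?D" if "A \<in> obj ?C" for A using that by simp
  show "inj_on YD (obj ?C)" using inj_comod_to_yd by (rule inj_on_subset) simp
  show "inj_on ?G (arr ?C)" using inj_comod_to_yd by (auto simp: inj_on_def)
  show "f \<in> arr ?C \<longleftrightarrow> dom ?C f \<in> obj ?C \<and> cod ?C f \<in> obj ?C \<and> ?G f \<in> arr ?D" for f
    by (cases f) (auto simp: ymor_comod_to_yd)
  show "dom ?D (?G f) = YD (dom ?C f)" "cod ?D (?G f) = YD (cod ?C f)" for f
    by (cases f; simp)+
  show "\<exists>f. dom ?C f = A \<and> cod ?C f = B \<and> ?G f = g" if "g \<in> hom_set ?D (YD A) (YD B)" for g A B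
    using that by (intro exI[of _ "(A, fst (snd g), B)"]) (auto simp: hom_set_def)
  show "dom ?C (ident ?C A) = A \<and> cod ?C (ident ?C A) = A \<and> ?G (ident ?C A) = ident ?D (YD A)" for A
    by simp
  show "dom ?C (comp ?C g f) = dom ?C f \<and> cod ?C (comp ?C g f) = cod ?C g \<and>
      ?G (comp ?C g f) = comp ?D (?G g) (?G f)" for f g
    by (cases f; cases g) simp
  show "tobj ?C A B \<in> obj ?C \<and> YD (tobj ?C A B) = tobj ?D (YD A) (YD B)"
    if "A \<in> obj ?C" "B \<in> obj ?C" for A B
    using that by (simp add: comod_to_yd_tensor)
  show "dom ?C (tarr ?C f g) = tobj ?C (dom ?C f) (dom ?C g) \<and>
      cod ?C (tarr ?C f g) = tobj ?C (cod ?C f) (cod ?C g) \<and>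
      ?G (tarr ?C f g) = tarr ?D (?G f) (?G g)" if "f \<in> arr ?C" "g \<in> arr ?C" for f g
    using that by (auto simp: comod_to_yd_tensor)
  show "dom ?C (assoc ?C A B E) = tobj ?C (tobj ?C A B) E \<and> cod ?C (assoc ?C A B E) = tobj ?C A (tobj ?C B E) \<and>
      ?G (assoc ?C A B E) = assoc ?D (YD A) (YD B) (YD E)"
    if "A \<in> obj ?C" "B \<in> obj ?C" "E \<in> obj ?C" for A B E
    using that by (simp add: comod_to_yd_tensor assoc_map_comod_to_yd)
  show "dom ?C (braid ?C A B) = tobj ?C A B \<and> cod ?C (braid ?C A B) = tobj ?C B A \<and>
      ?G (braid ?C A B) = braid ?D (YD A) (YD B)" if "A \<in> obj ?C" "B \<in> obj ?C" for A B
    using that by (simp add: comod_to_yd_tensor comod_braid_map_eq)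
qed

end

theorem theorem4p3:
  fixes K :: "('k, 'r) ring_scheme"
    and H :: "('k, 'a) hom_bialg"
    and \<sigma> :: "'a univ \<Rightarrow> 'k"
  assumes "field K"
    and "hom_bialgebra K H"
    and "coquasitriangular K H \<sigma>"
    and "bij_betw (halpha H) (carrier (hsp H)) (carrier (hsp H))"
    and "\<forall>t\<in>carrier (hsp H \<boxtimes>\<^bsub>K\<^esub> hsp H).
      \<sigma> t = \<sigma> (tensor_map K (hsp H) (hsp H) (hsp H) (hsp H) (halpha H) (halpha H) t)"
  shows "quasi_braided_pre_tensor_subcategory
      (comod_to_yd K H \<sigma>)
      (\<lambda>(M, f, N). (comod_to_yd K H \<sigma> M, f, comod_to_yd K H \<sigma> N))
      (comod_category K H \<sigma>)
      (yd_category K H)"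
proof -
  interpret coquasitriangular_hom_bialgebra K H \<sigma>
    using assms fieldE(1)[OF assms(1)]
    by (intro coquasitriangular_hom_bialgebra.intro hom_bialgebra_bij.intro
      coquasitriangular_hom_bialgebra_axioms.intro)
  show ?thesis
    by (rule full_embedding.quasi_braided_pre_tensor_subcategory[OF full_embedding_comod_to_yd])
qed

end
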